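(* Let $\{\mu_n^d\}_{n\ge\tau_0}$ be a sequence of empirical measures defined by the addition urn model on $\mathbb{Z}^d$. Suppose $\mathbf{X}_n\in\mathbb{Z}^d$ is the label of the $n$th ball added to the urn (i.e. the ball added at the step at which the urn goes from $n-1$ to $n$ balls). Let $$\mathbf{A}=\lim_{n\to\infty}\frac{\mathbb{E}[\mathbf{X}_{n+1}\mid\mu_n^d]}{2(n+1)}.$$ Then $\mathbf{A}=(A(1),\dots,A(d))\in\mathbb{R}^d$ exists almost surely, $\mathbb{P}(A(i)\neq0)>0$ for all $i=1,\dots,d$, and (quenched statement: for almost every realization of the urn process) $$\lim_{n\to\infty}\mathcal{L}\left(\frac{\mathbf{X}_n}{n}\,\Big|\,\mu_{n-1}^d\right)=\mathcal{L}(\mathbf{X})$$ in the sense of weak convergence of probability measures on $\mathbb{R}^d$, where $\mathbf{X}\sim G\cdot\mathbf{A}$ and $G\sim\mathrm{Gamma}(2,1)$ is a one-dimensional random variable; that is, with the value of $\mathbf{A}$ fixed by the realization of the urn, $\mathcal{L}(\mathbf{X})$ is the law of $G\cdot\mathbf{A}$.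
   Context: The addition urn model on $\mathbb{Z}^d$ ($d\ge1$): the urn initially contains a finite nonempty collection (with multiplicity) of $\tau_0\ge1$ balls with labels in $\mathbb{Z}^d$, written $\mathbf{X}_1,\dots,\mathbf{X}_{\tau_0}$. Time is indexed so that at time $n\ge\tau_0$ there are exactly $n$ balls in the urn. At each time $n\ge\tau_0$, two balls are drawn independently, uniformly at random and with replacement from the $n$ balls, and a new ball is added whose label $\mathbf{X}_{n+1}$ is the sum of the two drawn labels. The drawn balls remain in the urn. The empirical measure at time $n$ is $\mu_n^d=\frac1n\sum_{i=1}^n\delta_{\mathbf{X}_i}$. Quenched convention: the realization of the urn process is fixed, and $\mathcal{L}(\mathbf{X}_n\mid\mu_{n-1}^d)$ is the law of the sum of two independent random vectors with law $\mu_{n-1}^d$. $\mathrm{Gamma}(2,1)$ is the Gamma law with shape $2$ and scale $1$ (density $xe^{-x}$ on $(0,\infty)$). $\mathcal{L}(\cdot)$ denotes the law of a random variable.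
   Formalization: The claim P(A(i)≠0)>0 is stated only for those i for which at least one initial ball has a nonzero i-th coordinate; if all initial labels have i-th coordinate 0, then every label does and A(i)=0 almost surely, so the claim fails there. *)

theory Defs
  imports "HOL-Probability.Probability"
begin

text \<open>
  The addition urn on \<open>int ^ 'd\<close>. \<open>X i\<close> is the label of the \<open>i\<close>-th ball, counted from 1;
  \<open>X 0\<close> is unspecified and never used. \<open>x0 1, \<dots>, x0 \<tau>0\<close> are the given initial labels.
  \<open>D n False\<close> and \<open>D n True\<close> are the indices of the first and the second ball drawn
  when the urn holds \<open>n\<close> balls, so labels are drawn with their multiplicity.
\<close>

locale addition_urn = prob_space M for M :: "'a measure" +
  fixes \<tau>0 :: nat
    and x0 :: "nat \<Rightarrow> int ^ 'd"
    and D :: "nat \<Rightarrow> bool \<Rightarrow> 'a \<Rightarrow> nat"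
    and X :: "nat \<Rightarrow> 'a \<Rightarrow> int ^ 'd"
  assumes initial_size: "1 \<le> \<tau>0"
    and draws_indep:
      "indep_vars (\<lambda>(n, b). count_space {1..n}) (\<lambda>(n, b). D n b) ({\<tau>0..} \<times> UNIV)"
    and draws_uniform:
      "\<And>n b. \<tau>0 \<le> n \<Longrightarrow>
        distr M (count_space {1..n}) (D n b) = uniform_count_measure {1..n}"
    and initial_labels: "\<And>i \<omega>. i \<in> {1..\<tau>0} \<Longrightarrow> \<omega> \<in> space M \<Longrightarrow> X i \<omega> = x0 i"
    and added_label: "\<And>n \<omega>. \<tau>0 \<le> n \<Longrightarrow> \<omega> \<in> space M \<Longrightarrow>
        X (Suc n) \<omega> = X (D n False \<omega>) \<omega> + X (D n True \<omega>) \<omega>"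

text \<open>The empirical measure of the labels \<open>x 1, \<dots>, x n\<close>; see \<open>emeasure_empirical\<close>.\<close>

definition empirical :: "(nat \<Rightarrow> 'b) \<Rightarrow> nat \<Rightarrow> 'b pmf" where
  "empirical x n = map_pmf x (pmf_of_set {1..n})"

lemma emeasure_empirical:
  assumes "1 \<le> n"
  shows "emeasure (measure_pmf (empirical x n)) S =
    ennreal ((1 / real n) * (\<Sum>i = 1..n. indicator S (x i)))"
proof -
  have "(\<Sum>i = 1..n. indicator S (x i) :: real) = real (card ({1..n} \<inter> x -` S))"
    by (simp add: indicator_def sum.If_cases Int_def vimage_def)
  then show ?thesis using assms
    by (simp add: empirical_def emeasure_pmf_of_set)
qed

text \<open>The law of the sum of two independent random variables with law \<open>\<mu>\<close>.\<close>

definition sum_law :: "'b::plus pmf \<Rightarrow> 'b pmf" where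
  "sum_law \<mu> = map_pmf (\<lambda>(x, y). x + y) (pair_pmf \<mu> \<mu>)"

definition real_vec :: "int ^ 'd \<Rightarrow> real ^ 'd" where
  "real_vec x = (\<chi> i. real_of_int (x $ i))"

text \<open>The \<open>\<sigma>\<close>-algebra generated by the random measure \<open>\<mu>\<^sub>n\<close>.\<close>

definition empirical_algebra :: "'a measure \<Rightarrow> (nat \<Rightarrow> 'a \<Rightarrow> int ^ 'd) \<Rightarrow> nat \<Rightarrow> 'a measure" where
  "empirical_algebra M X n =
    vimage_algebra (space M) (\<lambda>\<omega>. measure_pmf (empirical (\<lambda>i. X i \<omega>) n))
      (subprob_algebra (count_space UNIV))"

text \<open>\<open>E[X\<^sub>n\<^sub>+\<^sub>1 | \<mu>\<^sub>n]\<close>, taken coordinatewise.\<close>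

definition urn_cond_exp ::
  "'a measure \<Rightarrow> (nat \<Rightarrow> 'a \<Rightarrow> int ^ 'd) \<Rightarrow> nat \<Rightarrow> 'a \<Rightarrow> real ^ 'd" where
  "urn_cond_exp M X n \<omega> =
    (\<chi> i. real_cond_exp M (empirical_algebra M X n) (\<lambda>\<omega>. real_vec (X (n + 1) \<omega>) $ i) \<omega>)"

definition urn_ratio ::
  "'a measure \<Rightarrow> (nat \<Rightarrow> 'a \<Rightarrow> int ^ 'd) \<Rightarrow> nat \<Rightarrow> 'a \<Rightarrow> real ^ 'd" where
  "urn_ratio M X n \<omega> = (1 / (2 * (real n + 1))) *\<^sub>R urn_cond_exp M X n \<omega>"

text \<open>Meaningful only where the limit exists.\<close>

definition urn_limit :: "'a measure \<Rightarrow> (nat \<Rightarrow> 'a \<Rightarrow> int ^ 'd) \<Rightarrow> 'a \<Rightarrow> real ^ 'd" where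
  "urn_limit M X \<omega> = lim (\<lambda>n. urn_ratio M X n \<omega>)"

text \<open>
  The quenched law of \<open>X\<^sub>n / n\<close> given \<open>\<mu>\<^sub>n\<^sub>-\<^sub>1\<close>, for a fixed realization \<open>x\<close> of the label sequence.
\<close>

definition quenched_law :: "(nat \<Rightarrow> int ^ 'd) \<Rightarrow> nat \<Rightarrow> (real ^ 'd) measure" where
  "quenched_law x n =
    distr (measure_pmf (sum_law (empirical x (n - 1)))) borel (\<lambda>y. (1 / real n) *\<^sub>R real_vec y)"

text \<open>The Gamma law with shape 2 and scale 1 is the Erlang law with \<open>k = 1\<close> and rate 1.\<close>

definition gamma_2_1 :: "real measure" where
  "gamma_2_1 = density lborel (erlang_density 1 1)"

lemma gamma_2_1_density: "erlang_density 1 1 x = (if 0 < x then x * exp (- x) else 0)"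
  by (simp add: erlang_density_def)

text \<open>The library's \<open>weak_conv_m\<close> covers only measures on the real line.\<close>

definition weakly_converges :: "(nat \<Rightarrow> 'b::topological_space measure) \<Rightarrow> 'b measure \<Rightarrow> bool" where
  "weakly_converges N L \<longleftrightarrow>
    (\<forall>f :: 'b \<Rightarrow> real. continuous_on UNIV f \<and> bounded (range f) \<longrightarrow>
      (\<lambda>n. \<integral>x. f x \<partial>N n) \<longlonglongrightarrow> (\<integral>x. f x \<partial>L))"

end

theory Submission
  imports Defs "HOL-Computational_Algebra.Nth_Powers"
begin

text \<open>
  For a direction \<open>\<theta>\<close> the projected labels \<open>Y i = \<theta> \<bullet> X i\<close> again form an urn, now with real labels, so
  everything reduces to real \<^emph>\<open>label processes\<close>. Put \<open>S n = Y 1 + \<dots> + Y n\<close> and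
  \<open>Q n = (Y 1)\<^sup>2 + \<dots> + (Y n)\<^sup>2\<close>.

  \<^emph>\<open>The limit.\<close> Given the past, the next label has mean \<open>2 S n / n\<close>, hence \<open>S n / (n (n + 1))\<close> is a martingale.
  The second moments of \<open>S n\<close> and \<open>Q n\<close> satisfy a closed linear recursion, which shows that the
  martingale is bounded in \<open>L\<^sup>2\<close> and that after time \<open>n\<close> it moves by at most \<open>O (1 / n)\<close> in squared
  \<open>L\<^sup>2\<close> norm (\<open>normalized_sum_dist_bound\<close>). This rate is summable along the times \<open>m ^ 24\<close>, where it gives
  almost sure convergence. Between these times \<open>S\<close> moves less than the corresponding sum for the urn whose initial
  labels are all 1, up to a constant; the latter sum is increasing, so it can be interpolated
  (\<open>AE_label_sum_convergent\<close>). The second moment of the martingale never decreases and is positive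
  after the first step unless all initial labels vanish, so the limit is not almost surely 0
  (\<open>label_limit_nonzero\<close>).

  \<^emph>\<open>The law.\<close> Let \<open>\<psi> n t = (1 / n) (exp (i t Y 1) + \<dots> + exp (i t Y n))\<close>. The next label is a sum of two
  independent draws, so
  \<open>(n + 1) \<psi> (n + 1) t = n \<psi> n t + (\<psi> n t)\<^sup>2 + noise\<close> with a centred and bounded noise. Without noise, and
  up to lower order terms, the solution that starts from \<open>\<psi> n t \<approx> 1 + i t S n / n\<close> is
  \<open>1 / (1 - i t a n)\<close> with \<open>a = S n / n\<^sup>2\<close>, because \<open>1 / \<psi> - 1\<close> grows linearly. Now take \<open>t = 1 / N\<close> and run the
  recursion from \<open>n0\<close> to \<open>N\<close>, where \<open>n0\<close> is much smaller than \<open>N\<close> but not too small: the initial error is of order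
  \<open>(n0 / N)\<^sup>2\<close> and the noise is damped by \<open>1 / n\<close>, so \<open>\<psi> N (1 / N)\<close> is close to
  \<open>1 / (1 - i A)\<close>, the characteristic function of \<open>A\<close> times a standard exponential variable
  (\<open>AE_ecf_limit\<close>). The quenched law of the next label squares this, which gives \<open>Gamma(2,1)\<close>.

  \<^emph>\<open>Several dimensions.\<close> Almost surely the one-dimensional statement holds for a countable dense set of
  directions, and by equicontinuity for all directions. In the directions orthogonal to \<open>A\<close> the limit is 0, so the
  quenched laws concentrate on the line spanned by \<open>A\<close>; on this line Levy's continuity theorem for the real line
  applies (\<open>weak_convergence_to_line\<close>).
\<close>

section \<open>The draws and their history\<close>

context addition_urn begin

definition history_map :: "nat \<Rightarrow> 'a \<Rightarrow> nat \<times> bool \<Rightarrow> nat" where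
  "history_map n \<omega> = restrict (\<lambda>p. (case p of (m, b) \<Rightarrow> D m b) \<omega>) ({\<tau>0..<n} \<times> UNIV)"

text \<open>
  The \<open>\<sigma>\<close>-algebra of all draws from urns with fewer than \<open>n\<close> balls. It determines the labels of the first \<open>n\<close>
  balls.
\<close>

definition history :: "nat \<Rightarrow> 'a measure" where
  "history n = vimage_algebra (space M) (history_map n)
     (PiM ({\<tau>0..<n} \<times> UNIV) (\<lambda>(m, b). count_space {1..m}))"

lemma space_history [simp]: "space (history n) = space M"
  by (simp add: history_def)

lemma draw_measurable:
  assumes "\<tau>0 \<le> n"
  shows "D n b \<in> M \<rightarrow>\<^sub>M count_space {1..n}"
  using draws_indep assms unfolding indep_vars_def by (auto split: prod.splits)

lemma draw_range:
  assumes "\<tau>0 \<le> n" "\<omega> \<in> space M"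
  shows "D n b \<omega> \<in> {1..n}"
  using measurable_space[OF draw_measurable[OF assms(1)] assms(2)] by simp

lemma restrict_draws_measurable:
  assumes N: "\<And>m b. \<tau>0 \<le> m \<Longrightarrow> m < n \<Longrightarrow> D m b \<in> N \<rightarrow>\<^sub>M count_space {1..m}"
  shows "history_map n \<in> N \<rightarrow>\<^sub>M PiM ({\<tau>0..<n} \<times> UNIV) (\<lambda>(m, b). count_space {1..m})"
  unfolding history_map_def using N by (intro measurable_restrict) auto

lemma draw_measurable_history:
  assumes "\<tau>0 \<le> m" "m < n"
  shows "D m b \<in> history n \<rightarrow>\<^sub>M count_space {1..m}"
proof -
  let ?P = "PiM ({\<tau>0..<n} \<times> (UNIV :: bool set)) (\<lambda>(m, b). count_space {1..m})"
  have "history_map n \<in> M \<rightarrow>\<^sub>M ?P"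
    by (intro restrict_draws_measurable draw_measurable)
  then have "history_map n \<in> history n \<rightarrow>\<^sub>M ?P"
    unfolding history_def by (intro measurable_vimage_algebra1) (auto dest: measurable_space)
  moreover have "(\<lambda>h. h (m, b)) \<in> ?P \<rightarrow>\<^sub>M count_space {1..m}"
    using measurable_component_singleton[of "(m, b)" "{\<tau>0..<n} \<times> UNIV"
        "\<lambda>(m, b). count_space {1..m}"] assms by simp
  ultimately have "(\<lambda>\<omega>. history_map n \<omega> (m, b)) \<in> history n \<rightarrow>\<^sub>M count_space {1..m}"
    by (rule measurable_compose)
  then show ?thesis using assms by (simp add: history_map_def)
qed

lemma history_mono:
  assumes "m \<le> n"
  shows "sets (history m) \<subseteq> sets (history n)"
  unfolding history_def[of m] using assms
  by (intro sets_image_in_sets restrict_draws_measurable draw_measurable_history) auto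

lemma history_subset: "sets (history n) \<subseteq> events"
  unfolding history_def[of n]
  by (intro sets_image_in_sets restrict_draws_measurable draw_measurable) auto

lemma measurable_history_mono:
  assumes "f \<in> history m \<rightarrow>\<^sub>M N" "m \<le> n"
  shows "f \<in> history n \<rightarrow>\<^sub>M N"
  using assms history_mono[OF assms(2)] by (auto simp: measurable_def)

lemma measurable_from_history:
  assumes "f \<in> history m \<rightarrow>\<^sub>M N"
  shows "f \<in> M \<rightarrow>\<^sub>M N"
  using assms history_subset[of m] by (auto simp: measurable_def)

lemma prob_draw:
  assumes "\<tau>0 \<le> n" "j \<in> {1..n}"
  shows "prob (D n b -` {j} \<inter> space M) = 1 / n"
proof -
  have "measure (distr M (count_space {1..n}) (D n b)) {j} = prob (D n b -` {j} \<inter> space M)"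
    using assms by (intro measure_distr draw_measurable) auto
  then show ?thesis
    using assms draws_uniform[OF assms(1)] by (simp add: measure_uniform_count_measure)
qed

text \<open>
  The independence of the two new draws from the past, for the single event that the drawn pair is \<open>(j, k)\<close>: all
  expectations below are computed by summing over the finitely many pairs.
\<close>

lemma indep_pair_history:
  assumes n: "\<tau>0 \<le> n" and jk: "j \<in> {1..n}" "k \<in> {1..n}"
  shows "indep_set (sets (history n))
      (sigma_sets (space M) {D n False -` {j} \<inter> D n True -` {k} \<inter> space M})"
proof -
  let ?N = "\<lambda>(m, b::bool). count_space {1..m}"
  let ?A = "{\<tau>0..<n} \<times> (UNIV :: bool set)" and ?B = "{n} \<times> (UNIV :: bool set)"
  let ?new = "\<lambda>\<omega>. restrict (\<lambda>p. (case p of (m, b) \<Rightarrow> D m b) \<omega>) ?B"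
  have iv: "indep_var (PiM ?A ?N) (history_map n) (PiM ?B ?N) ?new"
    unfolding history_map_def using n
    by (intro indep_var_restrict[OF draws_indep]) auto
  have hist: "sets (history n) =
      sigma_sets (space M) {history_map n -` A \<inter> space M | A. A \<in> sets (PiM ?A ?N)}"
    by (simp add: history_def sets_vimage_algebra)
  have sub: "sigma_sets (space M) {D n False -` {j} \<inter> D n True -` {k} \<inter> space M}
      \<subseteq> sigma_sets (space M) {?new -` A \<inter> space M | A. A \<in> sets (PiM ?B ?N)}"
  proof (rule sigma_sets_mono')
    let ?E = "PiE ?B (\<lambda>(m, b). if b then {k} else {j})"
    have "?E \<in> sets (PiM ?B ?N)"
      using jk by (intro sets_PiM_I_finite) auto
    moreover have "D n False -` {j} \<inter> D n True -` {k} \<inter> space M = ?new -` ?E \<inter> space M"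
      by (auto simp: PiE_iff split: if_splits)
    ultimately show "{D n False -` {j} \<inter> D n True -` {k} \<inter> space M}
        \<subseteq> {?new -` A \<inter> space M | A. A \<in> sets (PiM ?B ?N)}"
      by blast
  qed
  show ?thesis
    using iv[unfolded indep_var_eq] sub unfolding hist[symmetric] indep_set_def
    by (auto elim!: indep_sets_mono_sets split: bool.splits)
qed

lemma prob_draw_pair:
  assumes n: "\<tau>0 \<le> n" and jk: "j \<in> {1..n}" "k \<in> {1..n}"
  shows "prob (D n False -` {j} \<inter> D n True -` {k} \<inter> space M) = 1 / (real n)\<^sup>2"
proof -
  let ?A = "\<lambda>(m::nat, b). if b then {k} else {j}"
  have "prob (\<Inter>p\<in>{n} \<times> UNIV. (case p of (m, b) \<Rightarrow> D m b) -` ?A p \<inter> space M)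
      = (\<Prod>p\<in>{n} \<times> UNIV. prob ((case p of (m, b) \<Rightarrow> D m b) -` ?A p \<inter> space M))"
    using n jk by (intro indep_varsD[OF draws_indep]) auto
  also have "\<dots> = (\<Prod>b\<in>UNIV. prob (D n b -` (if b then {k} else {j}) \<inter> space M))"
    by (rule prod.reindex_bij_witness[of _ "\<lambda>b. (n, b)" snd]) auto
  also have "\<dots> = 1 / (real n)\<^sup>2"
    using n jk by (simp add: UNIV_bool prob_draw power2_eq_square)
  also have "(\<Inter>p\<in>{n} \<times> UNIV. (case p of (m, b) \<Rightarrow> D m b) -` ?A p \<inter> space M)
      = D n False -` {j} \<inter> D n True -` {k} \<inter> space M"
    by (auto simp: UNIV_bool)
  finally show ?thesis .
qed

lemma expectation_on_pair:
  fixes Y :: "'a \<Rightarrow> real"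
  assumes n: "\<tau>0 \<le> n" and jk: "j \<in> {1..n}" "k \<in> {1..n}"
    and Y: "Y \<in> borel_measurable (history n)" "integrable M Y"
  defines "E \<equiv> D n False -` {j} \<inter> D n True -` {k} \<inter> space M"
  shows "integrable M (\<lambda>\<omega>. Y \<omega> * indicator E \<omega>)"
    and "expectation (\<lambda>\<omega>. Y \<omega> * indicator E \<omega>) = expectation Y / (real n)\<^sup>2"
proof -
  have "E = (D n False -` {j} \<inter> space M) \<inter> (D n True -` {k} \<inter> space M)"
    by (auto simp: E_def)
  also have "\<dots> \<in> events"
    using n jk by (intro sets.Int measurable_sets[OF draw_measurable]) auto
  finally have E: "E \<in> events" .
  have "indep_var borel Y borel (indicator E :: 'a \<Rightarrow> real)"
    unfolding indep_var_eq indep_set_def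
  proof (intro conjI)
    show "random_variable borel Y" using Y by auto
    show "random_variable borel (indicator E :: 'a \<Rightarrow> real)" using E by auto
    have "sigma_sets (space M) {Y -` A \<inter> space M | A. A \<in> sets borel} \<subseteq> sets (history n)"
      using measurable_sets[OF Y(1)] by (subst sets.sigma_sets_subset[of _ "history n", simplified]) auto
    moreover have "sigma_sets (space M) {indicator E -` A \<inter> space M | A::real set. A \<in> sets borel}
        \<subseteq> sigma_sets (space M) {E}"
    proof (rule sigma_sets_mono, safe)
      fix A :: "real set"
      have EM: "E \<subseteq> space M" by (auto simp: E_def)
      have "(indicator E -` A \<inter> space M :: 'a set) =
        (if 1 \<in> A then (if 0 \<in> A then space M else E) else if 0 \<in> A then space M - E else {})"
        using EM by (auto simp: indicator_def of_bool_def split: if_splits)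
      then show "indicator E -` A \<inter> space M \<in> sigma_sets (space M) {E}"
        by (auto intro: sigma_sets.intros sigma_sets_top)
    qed
    ultimately show "indep_sets (case_bool (sigma_sets (space M) {Y -` A \<inter> space M |A. A \<in> sets borel})
        (sigma_sets (space M) {indicator E -` A \<inter> space M |A::real set. A \<in> sets borel})) UNIV"
      using indep_pair_history[OF n jk] unfolding indep_set_def E_def[symmetric]
      by (auto elim!: indep_sets_mono_sets split: bool.splits)
  qed
  moreover have "integrable M (indicator E :: 'a \<Rightarrow> real)"
    using E by (intro integrable_real_indicator) (simp_all add: emeasure_eq_measure)
  ultimately show "integrable M (\<lambda>\<omega>. Y \<omega> * indicator E \<omega>)"
    "expectation (\<lambda>\<omega>. Y \<omega> * indicator E \<omega>) = expectation Y / (real n)\<^sup>2"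
    using indep_var_integrable[of Y "indicator E"] indep_var_lebesgue_integral[of Y "indicator E"] E Y(2)
      prob_draw_pair[OF n jk, folded E_def] by auto
qed

text \<open>
  Finitely many draws, each with finitely many outcomes, precede time \<open>n\<close>. So all quantities of interest are
  simple functions, and simplicity is an adaptedness condition that carries integrability with it.
\<close>

lemma simple_function_history_integrable:
  fixes f :: "'a \<Rightarrow> real"
  assumes "simple_function (history n) f"
  shows "integrable M f" and "f \<in> borel_measurable (history n)"
proof -
  show m: "f \<in> borel_measurable (history n)"
    using assms by (rule borel_measurable_simple_function)
  have "finite (f ` space M)"
    using simple_functionD(1)[OF assms] by simp
  from finite_imp_bounded[OF this] obtain B where "\<forall>x\<in>f ` space M. norm x \<le> B"
    unfolding bounded_iff ..
  then have "AE \<omega> in M. norm (f \<omega>) \<le> B" by (intro AE_I2) simp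
  then show "integrable M f"
    by (rule integrable_const_bound[OF _ measurable_from_history[OF m]])
qed

text \<open>
  This replaces conditioning on the past: inside an expectation, the drawn pair may be averaged out
  while everything determined by the past is held fixed.
\<close>

lemma expectation_draws:
  fixes K :: "nat \<Rightarrow> nat \<Rightarrow> 'a \<Rightarrow> real"
  assumes n: "\<tau>0 \<le> n"
    and sf: "\<And>j k. j \<in> {1..n} \<Longrightarrow> k \<in> {1..n} \<Longrightarrow> simple_function (history n) (K j k)"
  shows "integrable M (\<lambda>\<omega>. K (D n False \<omega>) (D n True \<omega>) \<omega>)"
    and "expectation (\<lambda>\<omega>. K (D n False \<omega>) (D n True \<omega>) \<omega>)
      = expectation (\<lambda>\<omega>. (\<Sum>j=1..n. \<Sum>k=1..n. K j k \<omega>) / (real n)\<^sup>2)"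
proof -
  note meas = simple_function_history_integrable(2)[OF sf]
    and int = simple_function_history_integrable(1)[OF sf]
  define E where "E j k = D n False -` {j} \<inter> D n True -` {k} \<inter> space M" for j k
  have eq: "K (D n False \<omega>) (D n True \<omega>) \<omega> = (\<Sum>j=1..n. \<Sum>k=1..n. K j k \<omega> * indicator (E j k) \<omega>)"
    if \<omega>: "\<omega> \<in> space M" for \<omega>
  proof -
    have "(\<Sum>j=1..n. \<Sum>k=1..n. K j k \<omega> * indicator (E j k) \<omega>)
        = (\<Sum>j=1..n. \<Sum>k=1..n. if k = D n True \<omega> then (if j = D n False \<omega> then K j k \<omega> else 0) else 0)"
      using \<omega> by (intro sum.cong refl) (auto simp: E_def)
    also have "\<dots> = (\<Sum>j=1..n. if j = D n False \<omega> then K j (D n True \<omega>) \<omega> else 0)"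
      using draw_range[OF n \<omega>, of True] by (intro sum.cong refl) (simp add: sum.delta)
    also have "\<dots> = K (D n False \<omega>) (D n True \<omega>) \<omega>"
      using draw_range[OF n \<omega>, of False] by (simp add: sum.delta)
    finally show ?thesis by simp
  qed
  have i: "integrable M (\<lambda>\<omega>. K j k \<omega> * indicator (E j k) \<omega>)"
    and e: "expectation (\<lambda>\<omega>. K j k \<omega> * indicator (E j k) \<omega>) = expectation (K j k) / (real n)\<^sup>2"
    if "j \<in> {1..n}" "k \<in> {1..n}" for j k
    using expectation_on_pair[OF n that meas[OF that] int[OF that]] unfolding E_def by blast+
  let ?S = "\<lambda>\<omega>. \<Sum>j=1..n. \<Sum>k=1..n. K j k \<omega> * indicator (E j k) \<omega>"
  have S: "integrable M ?S"
    by (intro Bochner_Integration.integrable_sum i)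
  have cong: "integrable M (\<lambda>\<omega>. K (D n False \<omega>) (D n True \<omega>) \<omega>) \<longleftrightarrow> integrable M ?S"
    by (rule Bochner_Integration.integrable_cong[OF refl eq])
  show "integrable M (\<lambda>\<omega>. K (D n False \<omega>) (D n True \<omega>) \<omega>)"
    unfolding cong by (rule S)
  have "expectation (\<lambda>\<omega>. K (D n False \<omega>) (D n True \<omega>) \<omega>) = expectation ?S"
    by (rule Bochner_Integration.integral_cong[OF refl eq])
  also have "\<dots> = (\<Sum>j=1..n. expectation (\<lambda>\<omega>. \<Sum>k=1..n. K j k \<omega> * indicator (E j k) \<omega>))"
    by (intro Bochner_Integration.integral_sum Bochner_Integration.integrable_sum i)
  also have "\<dots> = (\<Sum>j=1..n. \<Sum>k=1..n. expectation (\<lambda>\<omega>. K j k \<omega> * indicator (E j k) \<omega>))"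
    by (intro sum.cong refl Bochner_Integration.integral_sum i)
  also have "\<dots> = (\<Sum>j=1..n. \<Sum>k=1..n. expectation (K j k) / (real n)\<^sup>2)"
    by (intro sum.cong refl e)
  also have "\<dots> = (\<Sum>j=1..n. \<Sum>k=1..n. expectation (K j k)) / (real n)\<^sup>2"
    by (simp only: sum_divide_distrib)
  also have "(\<Sum>j=1..n. \<Sum>k=1..n. expectation (K j k)) = (\<Sum>j=1..n. expectation (\<lambda>\<omega>. \<Sum>k=1..n. K j k \<omega>))"
    by (intro sum.cong refl Bochner_Integration.integral_sum[symmetric] int)
  also have "\<dots> = expectation (\<lambda>\<omega>. \<Sum>j=1..n. \<Sum>k=1..n. K j k \<omega>)"
    by (intro Bochner_Integration.integral_sum[symmetric] Bochner_Integration.integrable_sum int)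
  finally show "expectation (\<lambda>\<omega>. K (D n False \<omega>) (D n True \<omega>) \<omega>)
      = expectation (\<lambda>\<omega>. (\<Sum>j=1..n. \<Sum>k=1..n. K j k \<omega>) / (real n)\<^sup>2)"
    by (simp only: integral_divide_zero)
qed

text \<open>
  A label process is driven by the same draws as the urn, with arbitrary deterministic initial labels. Besides
  \<open>X\<close> itself, additive images of \<open>X\<close> and the number of summands of a label are label processes.
\<close>

definition label_process :: "(nat \<Rightarrow> 'a \<Rightarrow> 'b::plus) \<Rightarrow> bool" where
  "label_process Y \<longleftrightarrow>
    (\<exists>y. \<forall>i\<in>{1..\<tau>0}. \<forall>\<omega>\<in>space M. Y i \<omega> = y i) \<and>
    (\<forall>n\<ge>\<tau>0. \<forall>\<omega>\<in>space M. Y (Suc n) \<omega> = Y (D n False \<omega>) \<omega> + Y (D n True \<omega>) \<omega>)"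

lemma label_process_step:
  assumes "label_process Y" "\<tau>0 \<le> n" "\<omega> \<in> space M"
  shows "Y (Suc n) \<omega> = Y (D n False \<omega>) \<omega> + Y (D n True \<omega>) \<omega>"
  using conjunct2[OF assms(1)[unfolded label_process_def], rule_format, OF assms(2,3)] .

lemma label_process_X: "label_process X"
  unfolding label_process_def
  by (intro conjI exI[of _ x0] allI impI ballI initial_labels added_label)

lemma label_process_map:
  assumes "label_process Y" "\<And>x y. f (x + y) = f x + f y"
  shows "label_process (\<lambda>i \<omega>. f (Y i \<omega>))"
  unfolding label_process_def
proof (intro conjI allI impI ballI)
  obtain y where "\<forall>i\<in>{1..\<tau>0}. \<forall>\<omega>\<in>space M. Y i \<omega> = y i"
    using assms(1) unfolding label_process_def by blast
  then show "\<exists>y. \<forall>i\<in>{1..\<tau>0}. \<forall>\<omega>\<in>space M. f (Y i \<omega>) = y i"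
    by (intro exI[of _ "\<lambda>i. f (y i)"]) simp
  show "f (Y (Suc n) \<omega>) = f (Y (D n False \<omega>) \<omega>) + f (Y (D n True \<omega>) \<omega>)"
    if "\<tau>0 \<le> n" "\<omega> \<in> space M" for n \<omega>
    by (simp only: label_process_step[OF assms(1) that] assms(2))
qed

lemma simple_function_draw:
  assumes "\<tau>0 \<le> m" "m < n" "\<And>j. j \<in> {1..m} \<Longrightarrow> simple_function (history n) (f j)"
  shows "simple_function (history n) (\<lambda>\<omega>. f (D m b \<omega>) \<omega>)"
  unfolding simple_function_eq_measurable
proof
  have "(\<lambda>\<omega>. f (D m b \<omega>) \<omega>) ` space (history n) \<subseteq> (\<Union>j\<in>{1..m}. f j ` space (history n))"
  proof safe
    fix \<omega> assume "\<omega> \<in> space (history n)"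
    then show "f (D m b \<omega>) \<omega> \<in> (\<Union>j\<in>{1..m}. f j ` space (history n))"
      using draw_range[OF assms(1), of \<omega> b] by (intro UN_I[of "D m b \<omega>"] imageI) simp_all
  qed
  moreover have "finite (\<Union>j\<in>{1..m}. f j ` space (history n))"
    by (rule finite_UN_I[OF finite_atLeastAtMost], rule simple_functionD(1)[OF assms(3)])
  ultimately show "finite ((\<lambda>\<omega>. f (D m b \<omega>) \<omega>) ` space (history n))"
    by (rule finite_subset)
  show "(\<lambda>\<omega>. f (D m b \<omega>) \<omega>) \<in> history n \<rightarrow>\<^sub>M count_space UNIV"
    by (rule measurable_compose_countable'[OF _ draw_measurable_history[OF assms(1,2)]])
      (rule measurable_simple_function[OF assms(3)], assumption, rule countable_finite, rule finite_atLeastAtMost)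
qed

lemma label_simple_function:
  fixes Y :: "nat \<Rightarrow> 'a \<Rightarrow> 'b::plus"
  assumes Y: "label_process Y" and i: "1 \<le> i" "i \<le> n"
  shows "simple_function (history n) (Y i)"
  using i
proof (induction i arbitrary: n rule: less_induct)
  case (less i)
  show ?case
  proof (cases "i \<le> \<tau>0")
    case True
    obtain y where "\<forall>i\<in>{1..\<tau>0}. \<forall>\<omega>\<in>space M. Y i \<omega> = y i"
      using Y unfolding label_process_def by blast
    then have "\<forall>\<omega>\<in>space M. Y i \<omega> = y i" using True less.prems by simp
    then show ?thesis by (subst simple_function_cong[of _ _ "\<lambda>_. y i"]) auto
  next
    case False
    then obtain m where m: "i = Suc m" "\<tau>0 \<le> m" by (cases i) auto
    have sf: "simple_function (history n) (\<lambda>\<omega>. Y (D m b \<omega>) \<omega>)" for b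
      by (rule simple_function_draw) (use less m in auto)
    have "simple_function (history n) (\<lambda>\<omega>. Y (D m False \<omega>) \<omega> + Y (D m True \<omega>) \<omega>)"
      by (rule simple_function_compose2[where h = plus, OF sf sf])
    moreover have "simple_function (history n) (Y i) \<longleftrightarrow>
        simple_function (history n) (\<lambda>\<omega>. Y (D m False \<omega>) \<omega> + Y (D m True \<omega>) \<omega>)"
      unfolding m(1) by (rule simple_function_cong, rule label_process_step[OF Y m(2)]) simp
    ultimately show ?thesis by blast
  qed
qed

end

section \<open>First and second moments of a real label process\<close>

lemma sum_pairs_square:
  fixes y :: "nat \<Rightarrow> real"
  shows "(\<Sum>j=1..n. \<Sum>k=1..n. (g + (y j + y k))\<^sup>2) =
    (real n)\<^sup>2 * g\<^sup>2 + 4 * real n * g * (\<Sum>i=1..n. y i) + 2 * real n * (\<Sum>i=1..n. (y i)\<^sup>2)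
      + 2 * (\<Sum>i=1..n. y i)\<^sup>2"
proof -
  let ?S = "\<Sum>i=1..n. y i" and ?Q = "\<Sum>i=1..n. (y i)\<^sup>2"
  have "(g + (y j + y k))\<^sup>2 = (g + y j)\<^sup>2 + 2 * (g + y j) * y k + (y k)\<^sup>2" for j k
    by (simp add: power2_eq_square algebra_simps)
  then have "(\<Sum>j=1..n. \<Sum>k=1..n. (g + (y j + y k))\<^sup>2) =
      (\<Sum>j=1..n. real n * (g + y j)\<^sup>2 + 2 * (g + y j) * ?S + ?Q)"
    by (simp add: sum.distrib sum_distrib_left[symmetric])
  also have "\<dots> = (\<Sum>j=1..n. real n * g\<^sup>2 + 2 * g * ?S + ?Q + (2 * real n * g + 2 * ?S) * y j + real n * (y j)\<^sup>2)"
    by (rule sum.cong) (simp_all add: power2_eq_square algebra_simps)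
  also have "\<dots> = real n * (real n * g\<^sup>2 + 2 * g * ?S + ?Q) + (2 * real n * g + 2 * ?S) * ?S + real n * ?Q"
    by (simp add: sum.distrib sum_distrib_left[symmetric])
  also have "\<dots> = (real n)\<^sup>2 * g\<^sup>2 + 4 * real n * g * ?S + 2 * real n * ?Q + 2 * ?S\<^sup>2"
    by (simp add: power2_eq_square algebra_simps)
  finally show ?thesis .
qed

definition label_sum :: "(nat \<Rightarrow> 'a \<Rightarrow> real) \<Rightarrow> nat \<Rightarrow> 'a \<Rightarrow> real" where
  "label_sum Y n \<omega> = (\<Sum>i=1..n. Y i \<omega>)"

definition square_sum :: "(nat \<Rightarrow> 'a \<Rightarrow> real) \<Rightarrow> nat \<Rightarrow> 'a \<Rightarrow> real" where
  "square_sum Y n \<omega> = (\<Sum>i=1..n. (Y i \<omega>)\<^sup>2)"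

definition normalized_sum :: "(nat \<Rightarrow> 'a \<Rightarrow> real) \<Rightarrow> nat \<Rightarrow> 'a \<Rightarrow> real" where
  "normalized_sum Y n \<omega> = label_sum Y n \<omega> / (real n * (real n + 1))"

lemma label_sum_Suc: "label_sum Y (Suc n) \<omega> = label_sum Y n \<omega> + Y (Suc n) \<omega>"
  and square_sum_Suc: "square_sum Y (Suc n) \<omega> = square_sum Y n \<omega> + (Y (Suc n) \<omega>)\<^sup>2"
  by (simp_all add: label_sum_def square_sum_def)

lemma square_sum_nonneg: "0 \<le> square_sum Y n \<omega>"
  by (simp add: square_sum_def sum_nonneg)

lemma label_sum_Cauchy_Schwarz: "(label_sum Y n \<omega>)\<^sup>2 \<le> real n * square_sum Y n \<omega>"
  using Cauchy_Schwarz_ineq_sum[of "\<lambda>_. 1" "\<lambda>i. Y i \<omega>" "{1..n}"]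
  by (simp add: label_sum_def square_sum_def)

context addition_urn begin

lemma simple_function_label_sum:
  assumes Y: "label_process Y" and "m \<le> n"
  shows "simple_function (history n) (label_sum Y m)"
    and "simple_function (history n) (square_sum Y m)"
proof -
  have sf: "simple_function (history n) (Y i)" if "i \<in> {1..m}" for i
    using that assms by (intro label_simple_function[OF Y]) auto
  have "simple_function (history n) (\<lambda>\<omega>. \<Sum>i=1..m. Y i \<omega>)"
    by (rule simple_function_sum[OF sf])
  then show "simple_function (history n) (label_sum Y m)"
    by (simp add: label_sum_def[abs_def])
  have "simple_function (history n) (\<lambda>\<omega>. \<Sum>i=1..m. (Y i \<omega>)\<^sup>2)"
    by (rule simple_function_sum, rule simple_function_compose1[where g = "\<lambda>x. x\<^sup>2", OF sf])
  then show "simple_function (history n) (square_sum Y m)"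
    by (simp add: square_sum_def[abs_def])
qed

text \<open>
  Different choices of \<open>G\<close> yield the recursions for \<open>S\<^sup>2\<close> (take \<open>G = S\<close>), for \<open>Q\<close> (take \<open>G = 0\<close>) and for the
  increments of the martingale.
\<close>

lemma expectation_square_step:
  assumes Y: "label_process Y" and n: "\<tau>0 \<le> n" and G: "simple_function (history n) G"
  shows "expectation (\<lambda>\<omega>. (G \<omega> + Y (Suc n) \<omega>)\<^sup>2) =
    expectation (\<lambda>\<omega>. (G \<omega>)\<^sup>2 + 4 * G \<omega> * label_sum Y n \<omega> / n + 2 * square_sum Y n \<omega> / n
      + 2 * (label_sum Y n \<omega>)\<^sup>2 / n\<^sup>2)"
proof -
  have n0: "real n > 0" using n initial_size by simp
  let ?K = "\<lambda>j k \<omega>. (G \<omega> + (Y j \<omega> + Y k \<omega>))\<^sup>2"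
  have sf: "simple_function (history n) (?K j k)" if "j \<in> {1..n}" "k \<in> {1..n}" for j k
  proof -
    have 1: "simple_function (history n) (\<lambda>\<omega>. (Y j \<omega>, Y k \<omega>))"
      using that by (intro simple_function_Pair label_simple_function[OF Y]) auto
    show ?thesis
      using simple_function_compose2[where h = "\<lambda>g (a, b). (g + (a + b))\<^sup>2", OF G 1] by simp
  qed
  have "expectation (\<lambda>\<omega>. (G \<omega> + Y (Suc n) \<omega>)\<^sup>2)
      = expectation (\<lambda>\<omega>. ?K (D n False \<omega>) (D n True \<omega>) \<omega>)"
    by (intro Bochner_Integration.integral_cong refl) (simp add: label_process_step[OF Y n])
  also have "\<dots> = expectation (\<lambda>\<omega>. (\<Sum>j=1..n. \<Sum>k=1..n. ?K j k \<omega>) / (real n)\<^sup>2)"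
    by (rule expectation_draws(2)[OF n sf])
  also have "\<dots> = expectation (\<lambda>\<omega>. (G \<omega>)\<^sup>2 + 4 * G \<omega> * label_sum Y n \<omega> / n
      + 2 * square_sum Y n \<omega> / n + 2 * (label_sum Y n \<omega>)\<^sup>2 / n\<^sup>2)"
    unfolding sum_pairs_square label_sum_def[symmetric] square_sum_def[symmetric] using n0
    by (intro Bochner_Integration.integral_cong refl) (simp add: power2_eq_square field_simps)
  finally show ?thesis .
qed

lemma integrable_label_polynomial:
  assumes Y: "label_process Y"
  shows "integrable M (\<lambda>\<omega>. (label_sum Y n \<omega>)\<^sup>2)" "integrable M (square_sum Y n)"
    "1 \<le> n \<Longrightarrow> integrable M (\<lambda>\<omega>. (Y n \<omega>)\<^sup>2)"
proof -
  note sf = simple_function_label_sum[OF Y order_refl, of n]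
  show "integrable M (\<lambda>\<omega>. (label_sum Y n \<omega>)\<^sup>2)"
    by (rule simple_function_history_integrable(1), rule simple_function_compose1[where g = "\<lambda>x. x\<^sup>2", OF sf(1)])
  show "integrable M (square_sum Y n)"
    by (rule simple_function_history_integrable(1)[OF sf(2)])
  show "1 \<le> n \<Longrightarrow> integrable M (\<lambda>\<omega>. (Y n \<omega>)\<^sup>2)"
    by (rule simple_function_history_integrable(1), rule simple_function_compose1[where g = "\<lambda>x. x\<^sup>2"],
        rule label_simple_function[OF Y _ order_refl])
qed

lemma second_moment_recursion:
  assumes Y: "label_process Y" and n: "\<tau>0 \<le> n"
  defines "s \<equiv> \<lambda>n. expectation (\<lambda>\<omega>. (label_sum Y n \<omega>)\<^sup>2)" and "q \<equiv> \<lambda>n. expectation (square_sum Y n)"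
  shows "s (Suc n) = s n * (1 + 4 / n + 2 / n\<^sup>2) + 2 * q n / n"
    and "q (Suc n) = q n * (1 + 2 / n) + 2 * s n / n\<^sup>2"
proof -
  note int = integrable_label_polynomial[OF Y]
  have n0: "real n > 0" using n initial_size by simp
  have "s (Suc n) = expectation (\<lambda>\<omega>. (label_sum Y n \<omega> + Y (Suc n) \<omega>)\<^sup>2)"
    by (simp add: s_def label_sum_Suc)
  also have "\<dots> = expectation (\<lambda>\<omega>. (label_sum Y n \<omega>)\<^sup>2 + 4 * label_sum Y n \<omega> * label_sum Y n \<omega> / n
      + 2 * square_sum Y n \<omega> / n + 2 * (label_sum Y n \<omega>)\<^sup>2 / n\<^sup>2)"
    by (rule expectation_square_step[OF Y n simple_function_label_sum(1)[OF Y order_refl]])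
  also have "\<dots> = expectation (\<lambda>\<omega>. (label_sum Y n \<omega>)\<^sup>2 * (1 + 4 / n + 2 / n\<^sup>2) + square_sum Y n \<omega> * (2 / n))"
    using n0 by (intro Bochner_Integration.integral_cong refl) (simp add: power2_eq_square field_simps)
  also have "\<dots> = s n * (1 + 4 / n + 2 / n\<^sup>2) + q n * (2 / n)"
    unfolding s_def q_def
    by (subst Bochner_Integration.integral_add)
      (simp_all only: integral_mult_left_zero integrable_mult_left int)
  finally show "s (Suc n) = s n * (1 + 4 / n + 2 / n\<^sup>2) + 2 * q n / n" by simp
  have "q (Suc n) = q n + expectation (\<lambda>\<omega>. (0 + Y (Suc n) \<omega>)\<^sup>2)"
    using int(2)[of n] int(3)[of "Suc n"]
    by (simp add: q_def square_sum_Suc[abs_def])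
  also have "expectation (\<lambda>\<omega>. (0 + Y (Suc n) \<omega>)\<^sup>2) =
     expectation (\<lambda>\<omega>. 0\<^sup>2 + 4 * 0 * label_sum Y n \<omega> / n + 2 * square_sum Y n \<omega> / n
      + 2 * (label_sum Y n \<omega>)\<^sup>2 / n\<^sup>2)"
    by (rule expectation_square_step[OF Y n simple_function_const])
  also have "\<dots> = expectation (\<lambda>\<omega>. square_sum Y n \<omega> * (2 / n) + (label_sum Y n \<omega>)\<^sup>2 * (2 / n\<^sup>2))"
    by (intro Bochner_Integration.integral_cong refl) (simp add: mult.commute)
  also have "\<dots> = q n * (2 / n) + s n * (2 / n\<^sup>2)"
    unfolding s_def q_def
    by (subst Bochner_Integration.integral_add)
      (simp_all only: integral_mult_left_zero integrable_mult_left int)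
  finally show "q (Suc n) = q n * (1 + 2 / n) + 2 * s n / n\<^sup>2" by (simp add: algebra_simps)
qed

text \<open>
  The recursions for \<open>s n = E (S n)\<^sup>2\<close> and \<open>q n = E (Q n)\<close> are coupled, but the plain sum \<open>s + q\<close> decouples them: in
  \<open>s (n + 1) + q (n + 1)\<close> the coefficient of \<open>s n\<close> is exactly \<open>((n + 2) / n)\<^sup>2\<close> and that of \<open>q n\<close> is smaller.
  Hence \<open>s n + q n = O (n\<^sup>4)\<close>, and then the recursion for \<open>q\<close> alone improves the bound on \<open>q\<close> to \<open>O (n\<^sup>3)\<close>.
\<close>

lemma second_moment_bounds:
  assumes Y: "label_process Y"
  obtains B where "0 \<le> B"
    "\<And>n. \<tau>0 \<le> n \<Longrightarrow> expectation (square_sum Y n) \<le> B * real n ^ 2 * (real n + 1)"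
proof -
  define s where "s n = expectation (\<lambda>\<omega>. (label_sum Y n \<omega>)\<^sup>2)" for n
  define q where "q n = expectation (square_sum Y n)" for n
  have s0: "0 \<le> s n" and q0: "0 \<le> q n" for n
    by (auto simp: s_def q_def intro!: Bochner_Integration.integral_nonneg square_sum_nonneg)
  note rec = second_moment_recursion[OF Y, folded s_def q_def]
  define C where "C = s \<tau>0 + q \<tau>0"
  have C0: "0 \<le> C" using s0 q0 by (simp add: C_def)
  have w: "s n + q n \<le> C * real n ^ 2 * (real n + 1) ^ 2" if "\<tau>0 \<le> n" for n
    using that
  proof (induction n rule: dec_induct)
    case base
    have "1 \<le> real \<tau>0 ^ 2 * (real \<tau>0 + 1) ^ 2"
      using initial_size mult_mono[of 1 "real \<tau>0 ^ 2" 1 "(real \<tau>0 + 1) ^ 2"]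
      by (simp add: one_le_power)
    then show ?case using C0 mult_left_mono[of 1 "real \<tau>0 ^ 2 * (real \<tau>0 + 1) ^ 2" C]
      by (simp add: C_def mult.assoc)
  next
    case (step n)
    have n0: "real n > 0" using step initial_size by simp
    have "s (Suc n) + q (Suc n) = s n * (1 + 4 / n + 4 / n\<^sup>2) + q n * (1 + 4 / n)"
      using n0 by (simp add: rec[OF step(1)] field_simps)
    also have "\<dots> \<le> s n * (1 + 4 / n + 4 / n\<^sup>2) + q n * (1 + 4 / n + 4 / n\<^sup>2)"
      using q0 by (intro add_left_mono mult_left_mono) auto
    also have "\<dots> = (s n + q n) * ((n + 2) / n)\<^sup>2"
      using n0 by (simp add: power2_eq_square field_simps)
    also have "\<dots> \<le> (C * real n ^ 2 * (real n + 1) ^ 2) * ((n + 2) / n)\<^sup>2"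
      by (intro mult_right_mono step.IH) auto
    also have "\<dots> = C * real (Suc n) ^ 2 * (real (Suc n) + 1) ^ 2"
      using n0 by (simp add: power_divide power2_eq_square field_simps)
    finally show ?case .
  qed
  define B where "B = 2 * C"
  have "q n \<le> B * real n ^ 2 * (real n + 1)" if "\<tau>0 \<le> n" for n
    using that
  proof (induction n rule: dec_induct)
    case base
    have "1 \<le> real \<tau>0 ^ 2 * (real \<tau>0 + 1)"
      using initial_size mult_mono[of 1 "real \<tau>0 ^ 2" 1 "real \<tau>0 + 1"]
      by (simp add: one_le_power)
    then have "B \<le> B * (real \<tau>0 ^ 2 * (real \<tau>0 + 1))"
      using C0 mult_left_mono[of 1 "real \<tau>0 ^ 2 * (real \<tau>0 + 1)" B] by (simp add: B_def)
    moreover have "q \<tau>0 \<le> B" using s0[of \<tau>0] q0[of \<tau>0] by (simp add: B_def C_def)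
    ultimately show ?case by (simp add: mult.assoc)
  next
    case (step n)
    have n0: "real n > 0" using step initial_size by simp
    have sn: "s n \<le> C * real n ^ 2 * (real n + 1) ^ 2"
      using w[OF step(1)] q0[of n] by linarith
    have "q (Suc n) = q n * (1 + 2 / n) + 2 * s n / n\<^sup>2"
      by (rule rec(2)[OF step(1)])
    also have "\<dots> \<le> (B * real n ^ 2 * (real n + 1)) * (1 + 2 / n)
        + 2 * (C * real n ^ 2 * (real n + 1) ^ 2) / n\<^sup>2"
      using step.IH sn n0 by (intro add_mono mult_right_mono divide_right_mono mult_left_mono) auto
    also have "\<dots> = B * (real n * (real n + 1) * (real n + 2) + (real n + 1) ^ 2)"
      using n0 by (simp add: B_def power2_eq_square field_simps)
    also have "\<dots> \<le> B * (real n * (real n + 1) * (real n + 2) + (real n + 1) * (real n + 2))"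
      using C0 by (intro mult_left_mono add_left_mono) (auto simp: B_def power2_eq_square)
    also have "\<dots> = B * real (Suc n) ^ 2 * (real (Suc n) + 1)"
      by (simp add: power2_eq_square algebra_simps)
    finally show ?case .
  qed
  moreover have "0 \<le> B" using C0 by (simp add: B_def)
  ultimately show thesis using that unfolding q_def by blast
qed

lemma simple_function_normalized_sum:
  assumes Y: "label_process Y" and "m \<le> n"
  shows "simple_function (history n) (normalized_sum Y m)"
  unfolding normalized_sum_def[abs_def]
  by (rule simple_function_compose1[OF simple_function_label_sum(1)[OF assms]])

text \<open>
  Orthogonality of martingale increments. With \<open>k = 0\<close> the subtracted term is \<open>0 / 0 = 0\<close>, so the same
  formula shows how the second moment of the martingale itself grows.
\<close>

lemma normalized_sum_increment:
  assumes Y: "label_process Y" and n: "\<tau>0 \<le> n" and k: "k \<le> n"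
  shows "expectation (\<lambda>\<omega>. (normalized_sum Y (Suc n) \<omega> - normalized_sum Y k \<omega>)\<^sup>2) =
    expectation (\<lambda>\<omega>. (normalized_sum Y n \<omega> - normalized_sum Y k \<omega>)\<^sup>2) +
    (2 * expectation (square_sum Y n) / n - 2 * expectation (\<lambda>\<omega>. (label_sum Y n \<omega>)\<^sup>2) / n\<^sup>2)
      / ((real n + 1) * (real n + 2))\<^sup>2"
proof -
  have n0: "real n > 0" using n initial_size by simp
  define c where "c = (real n + 1) * (real n + 2)"
  have c0: "c > 0" by (simp add: c_def)
  \<comment> \<open>\<open>G\<close> is chosen such that the increment up to time \<open>n + 1\<close> equals \<open>(G + Y (n + 1)) / c\<close>\<close>
  define T where "T \<omega> = normalized_sum Y n \<omega> - normalized_sum Y k \<omega>" for \<omega>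
  define G where "G \<omega> = c * T \<omega> - 2 * label_sum Y n \<omega> / n" for \<omega>
  have T: "simple_function (history n) T"
    unfolding T_def[abs_def] using k
    by (intro simple_function_diff simple_function_normalized_sum[OF Y]) auto
  have G: "simple_function (history n) G"
    unfolding G_def[abs_def]
    by (rule simple_function_compose2[where h = "\<lambda>t s. c * t - 2 * s / n",
          OF T simple_function_label_sum(1)[OF Y order_refl]])
  have eq: "normalized_sum Y (Suc n) \<omega> - normalized_sum Y k \<omega> = (G \<omega> + Y (Suc n) \<omega>) / c" for \<omega>
  proof -
    have "normalized_sum Y (Suc n) \<omega> = (label_sum Y n \<omega> + Y (Suc n) \<omega>) / c"
      by (simp add: normalized_sum_def label_sum_Suc c_def algebra_simps)
    moreover have "G \<omega> / c = normalized_sum Y n \<omega> - normalized_sum Y k \<omega> - 2 * label_sum Y n \<omega> / (n * c)"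
      using c0 n0 by (simp add: G_def T_def field_simps)
    moreover have "normalized_sum Y n \<omega> - 2 * label_sum Y n \<omega> / (n * c) = label_sum Y n \<omega> / c"
      using n0 unfolding normalized_sum_def c_def by (simp add: divide_simps) (simp add: algebra_simps)
    ultimately show ?thesis by (simp add: add_divide_distrib)
  qed
  have intT: "integrable M (\<lambda>\<omega>. (T \<omega>)\<^sup>2)"
    by (rule simple_function_history_integrable(1)[OF simple_function_compose1[OF T]])
  note int = integrable_label_polynomial[OF Y, of n]
  have "expectation (\<lambda>\<omega>. (normalized_sum Y (Suc n) \<omega> - normalized_sum Y k \<omega>)\<^sup>2)
      = expectation (\<lambda>\<omega>. (G \<omega> + Y (Suc n) \<omega>)\<^sup>2) / c\<^sup>2"
    unfolding eq power_divide by simp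
  also have "expectation (\<lambda>\<omega>. (G \<omega> + Y (Suc n) \<omega>)\<^sup>2) =
     expectation (\<lambda>\<omega>. (G \<omega>)\<^sup>2 + 4 * G \<omega> * label_sum Y n \<omega> / n + 2 * square_sum Y n \<omega> / n
      + 2 * (label_sum Y n \<omega>)\<^sup>2 / n\<^sup>2)"
    by (rule expectation_square_step[OF Y n G])
  also have "\<dots> = expectation (\<lambda>\<omega>. (T \<omega>)\<^sup>2 * c\<^sup>2 + (square_sum Y n \<omega> * (2 / n)
      - (label_sum Y n \<omega>)\<^sup>2 * (2 / n\<^sup>2)))"
    using n0 by (intro Bochner_Integration.integral_cong refl)
      (simp add: G_def power2_eq_square field_simps)
  also have "\<dots> = expectation (\<lambda>\<omega>. (T \<omega>)\<^sup>2) * c\<^sup>2 + (expectation (square_sum Y n) * (2 / n)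
      - expectation (\<lambda>\<omega>. (label_sum Y n \<omega>)\<^sup>2) * (2 / n\<^sup>2))"
    by (subst Bochner_Integration.integral_add Bochner_Integration.integral_diff;
        (subst Bochner_Integration.integral_diff)?;
        simp only: integral_mult_left_zero integrable_mult_left int intT Bochner_Integration.integrable_diff)
  finally show ?thesis
    using c0 by (simp add: T_def c_def[symmetric] add_divide_distrib mult.commute)
qed

lemma normalized_sum_dist_bound:
  assumes Y: "label_process Y"
  obtains C where "0 \<le> C"
    "\<And>n m. \<tau>0 \<le> n \<Longrightarrow> n \<le> m \<Longrightarrow>
      expectation (\<lambda>\<omega>. (normalized_sum Y m \<omega> - normalized_sum Y n \<omega>)\<^sup>2) \<le> C / n"
proof -
  obtain B where B: "0 \<le> B"
    "\<And>n. \<tau>0 \<le> n \<Longrightarrow> expectation (square_sum Y n) \<le> B * real n ^ 2 * (real n + 1)"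
    using second_moment_bounds[OF Y] by blast
  have main: "expectation (\<lambda>\<omega>. (normalized_sum Y m \<omega> - normalized_sum Y n \<omega>)\<^sup>2) \<le> 2 * B * (1 / n - 1 / m)"
    if n: "\<tau>0 \<le> n" and "n \<le> m" for n m
    using that(2)
  proof (induction m rule: dec_induct)
    case base
    then show ?case by simp
  next
    case (step m)
    have m0: "real m > 0" "\<tau>0 \<le> m" using n step initial_size by auto
    have "0 \<le> expectation (\<lambda>\<omega>. (label_sum Y m \<omega>)\<^sup>2)" by (intro Bochner_Integration.integral_nonneg) simp
    then have "(2 * expectation (square_sum Y m) / m - 2 * expectation (\<lambda>\<omega>. (label_sum Y m \<omega>)\<^sup>2) / m\<^sup>2)
      / ((real m + 1) * (real m + 2))\<^sup>2 \<le> (2 * (B * real m ^ 2 * (real m + 1)) / m - 0) / ((real m + 1) * (real m + 2))\<^sup>2"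
      using B(2)[OF m0(2)] m0 by (intro divide_right_mono diff_mono mult_left_mono) auto
    also have "\<dots> = 2 * B * (real m / ((real m + 1) * (real m + 2)\<^sup>2))"
    proof -
      have "real m \<noteq> 0" "real m + 1 \<noteq> 0" "real m + 2 \<noteq> 0" using m0 by auto
      then show ?thesis by (simp add: power2_eq_square divide_simps)
    qed
    also have "\<dots> \<le> 2 * B * (1 / (real m * (real m + 1)))"
    proof (intro mult_left_mono)
      let ?a = "(real m + 1) * (real m + 2)\<^sup>2" and ?b = "real m * (real m + 1)"
      have pos: "0 < ?a" "0 < ?b" using m0 by (auto intro!: mult_pos_pos)
      have "real m * real m \<le> (real m + 2) * (real m + 2)" by (intro mult_mono) auto
      then have "real m * ?b \<le> ?a"
        using mult_right_mono[of "real m * real m" "(real m + 2) * (real m + 2)" "real m + 1"]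
        by (simp add: power2_eq_square mult_ac)
      then show "real m / ?a \<le> 1 / ?b"
        unfolding pos_divide_le_eq[OF pos(1)] times_divide_eq_left mult_1_left pos_le_divide_eq[OF pos(2)] .
    qed (use B(1) in simp)
    also have "1 / (real m * (real m + 1)) = 1 / m - 1 / Suc m"
      using m0 by (simp add: field_simps)
    finally show ?case
      using step.IH unfolding normalized_sum_increment[OF Y m0(2) step(1)] by (simp add: algebra_simps)
  qed
  show thesis
  proof (rule that[of "2 * B"])
    show "expectation (\<lambda>\<omega>. (normalized_sum Y m \<omega> - normalized_sum Y n \<omega>)\<^sup>2) \<le> 2 * B / n"
      if "\<tau>0 \<le> n" "n \<le> m" for n m
    proof -
      have "2 * B * (1 / n - 1 / m) \<le> 2 * B * (1 / n)"
        using B(1) by (intro mult_left_mono) auto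
      then show ?thesis using main[OF that] by simp
    qed
  qed (use B(1) in simp)
qed

end

section \<open>Interpolation from powers to all integers\<close>

lemma nth_root_nat_at_top:
  assumes "p > 0"
  shows "filterlim (nth_root_nat p) at_top sequentially"
  unfolding filterlim_at_top
proof
  fix Z :: nat
  show "\<forall>\<^sub>F n in sequentially. Z \<le> nth_root_nat p n"
    using eventually_ge_at_top[of "Z ^ p"] by eventually_elim (rule nth_root_nat_ge[OF assms])
qed

lemma power_at_top:
  assumes "p > 0"
  shows "filterlim (\<lambda>m::nat. m ^ p) at_top sequentially"
  unfolding filterlim_at_top
proof
  fix Z :: nat
  show "\<forall>\<^sub>F m in sequentially. Z \<le> m ^ p"
    using eventually_ge_at_top[of "max 1 Z"]
  proof eventually_elim
    case (elim m)
    then have "m \<le> m ^ p" using assms by (intro self_le_power) auto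
    with elim show ?case by simp
  qed
qed

lemma nth_root_nat_Suc_power_gt:
  assumes "p > 0"
  shows "n < Suc (nth_root_nat p n) ^ p"
  using nth_root_nat_ge[OF assms, of "Suc (nth_root_nat p n)" n] by (meson not_less Suc_n_not_le_n)

lemma ratio_Suc_tendsto_1: "(\<lambda>r. (real r / real (Suc r)) ^ p) \<longlonglongrightarrow> 1"
  using tendsto_power[OF LIMSEQ_n_over_Suc_n, of p] by simp

lemma nth_root_nat_ratio:
  assumes p: "p > 0"
  shows "(\<lambda>n. real (nth_root_nat p n ^ p) / real n) \<longlonglongrightarrow> 1"
    and "(\<lambda>n. real (Suc (nth_root_nat p n) ^ p) / real n) \<longlonglongrightarrow> 1"
proof -
  let ?r = "nth_root_nat p"
  have lim: "(\<lambda>n. (real (?r n) / real (Suc (?r n))) ^ p) \<longlonglongrightarrow> 1"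
    by (rule filterlim_compose[OF ratio_Suc_tendsto_1 nth_root_nat_at_top[OF p]])
  have ev: "\<forall>\<^sub>F n in sequentially. 0 < n" by (rule eventually_gt_at_top)
  show "(\<lambda>n. real (?r n ^ p) / real n) \<longlonglongrightarrow> 1"
  proof (rule tendsto_sandwich[OF _ _ lim tendsto_const])
    show "\<forall>\<^sub>F n in sequentially. (real (?r n) / real (Suc (?r n))) ^ p \<le> real (?r n ^ p) / real n"
      using ev
    proof eventually_elim
      case (elim n)
      have "real n \<le> real (Suc (?r n) ^ p)"
        using nth_root_nat_Suc_power_gt[OF p, of n] by linarith
      then show ?case
        using elim unfolding power_divide of_nat_power[symmetric]
        by (intro divide_left_mono) auto
    qed
    show "\<forall>\<^sub>F n in sequentially. real (?r n ^ p) / real n \<le> 1"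
      using ev
    proof eventually_elim
      case (elim n)
      have "real (?r n ^ p) \<le> real n"
        using nth_root_nat_power_le[OF p, of n] by linarith
      then show ?case using elim by simp
    qed
  qed
  have lim': "(\<lambda>n. inverse ((real (?r n) / real (Suc (?r n))) ^ p)) \<longlonglongrightarrow> 1"
    using tendsto_inverse[OF lim] by simp
  show "(\<lambda>n. real (Suc (?r n) ^ p) / real n) \<longlonglongrightarrow> 1"
  proof (rule tendsto_sandwich[OF _ _ tendsto_const lim'])
    show "\<forall>\<^sub>F n in sequentially. 1 \<le> real (Suc (?r n) ^ p) / real n"
      using ev
    proof eventually_elim
      case (elim n)
      have "real n \<le> real (Suc (?r n) ^ p)"
        using nth_root_nat_Suc_power_gt[OF p, of n] by linarith
      then show ?case using elim by simp
    qed
    show "\<forall>\<^sub>F n in sequentially. real (Suc (?r n) ^ p) / real n \<le> inverse ((real (?r n) / real (Suc (?r n))) ^ p)"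
      using ev
    proof eventually_elim
      case (elim n)
      have "1 \<le> ?r n" using nth_root_nat_ge[OF p, of 1 n] elim by simp
      then have "0 < real (?r n ^ p)" by simp
      moreover have "real (?r n ^ p) \<le> real n"
        using nth_root_nat_power_le[OF p, of n] by linarith
      ultimately show ?case
        using elim unfolding power_divide inverse_divide of_nat_power[symmetric]
        by (intro divide_left_mono) auto
    qed
  qed
qed

lemma rescale_square:
  fixes k :: nat and x n :: real
  assumes "1 \<le> k"
  shows "x / (real k)\<^sup>2 * (real k / n)\<^sup>2 = x / n\<^sup>2"
  using assms by (simp add: power_divide)

lemma interpolate_increasing:
  fixes u :: "nat \<Rightarrow> real"
  assumes p: "p > 0" and mono: "mono u"
    and lim: "(\<lambda>m. u (m ^ p) / (real (m ^ p))\<^sup>2) \<longlonglongrightarrow> L"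
  shows "(\<lambda>n. u n / (real n)\<^sup>2) \<longlonglongrightarrow> L"
proof -
  let ?r = "nth_root_nat p"
  have top: "filterlim ?r sequentially sequentially"
    by (rule nth_root_nat_at_top[OF p])
  have topS: "filterlim (\<lambda>n. Suc (?r n)) sequentially sequentially"
    by (rule filterlim_compose[OF filterlim_Suc top])
  have main: "(\<lambda>n. u (s n ^ p) / (real n)\<^sup>2) \<longlonglongrightarrow> L"
    if "filterlim s sequentially sequentially" "(\<lambda>n. real (s n ^ p) / real n) \<longlonglongrightarrow> 1" for s
  proof -
    have "(\<lambda>n. u (s n ^ p) / (real (s n ^ p))\<^sup>2 * (real (s n ^ p) / real n)\<^sup>2) \<longlonglongrightarrow> L * 1\<^sup>2"
      by (intro tendsto_mult filterlim_compose[OF lim] tendsto_power that)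
    moreover have "\<forall>\<^sub>F n in sequentially. 1 \<le> s n ^ p"
      using eventually_compose_filterlim[OF eventually_ge_at_top[of 1] that(1)]
      by eventually_elim (rule one_le_power)
    then have "\<forall>\<^sub>F n in sequentially. u (s n ^ p) / (real (s n ^ p))\<^sup>2 * (real (s n ^ p) / real n)\<^sup>2
        = u (s n ^ p) / (real n)\<^sup>2"
      by eventually_elim (rule rescale_square)
    ultimately show ?thesis by (simp only: filterlim_cong[OF refl refl] mult_1_right power_one)
  qed
  show ?thesis
  proof (rule tendsto_sandwich[OF _ _ main[OF top nth_root_nat_ratio(1)[OF p]] main[OF topS nth_root_nat_ratio(2)[OF p]]])
    show "\<forall>\<^sub>F n in sequentially. u (?r n ^ p) / (real n)\<^sup>2 \<le> u n / (real n)\<^sup>2"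
      by (intro always_eventually allI divide_right_mono monoD[OF mono] nth_root_nat_power_le[OF p]) simp
    show "\<forall>\<^sub>F n in sequentially. u n / (real n)\<^sup>2 \<le> u (Suc (?r n) ^ p) / (real n)\<^sup>2"
      by (intro always_eventually allI divide_right_mono monoD[OF mono]
          less_imp_le[OF nth_root_nat_Suc_power_gt[OF p]]) simp
  qed
qed

lemma increasing_gap_tendsto_0:
  fixes u :: "nat \<Rightarrow> real"
  assumes p: "p > 0" and lim: "(\<lambda>n. u n / (real n)\<^sup>2) \<longlonglongrightarrow> L"
  shows "(\<lambda>n. (u n - u (nth_root_nat p n ^ p)) / (real n)\<^sup>2) \<longlonglongrightarrow> 0"
proof -
  let ?k = "\<lambda>n. nth_root_nat p n ^ p"
  have k: "filterlim ?k sequentially sequentially"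
    by (rule filterlim_compose[OF power_at_top[OF p] nth_root_nat_at_top[OF p]])
  have "(\<lambda>n. u n / (real n)\<^sup>2 - u (?k n) / (real (?k n))\<^sup>2 * (real (?k n) / real n)\<^sup>2) \<longlonglongrightarrow> L - L * 1\<^sup>2"
    by (intro tendsto_diff tendsto_mult lim filterlim_compose[OF lim k] tendsto_power nth_root_nat_ratio(1)[OF p])
  moreover have "\<forall>\<^sub>F n in sequentially. 1 \<le> ?k n"
    using k unfolding filterlim_at_top by blast
  then have "\<forall>\<^sub>F n in sequentially. u n / (real n)\<^sup>2 - u (?k n) / (real (?k n))\<^sup>2 * (real (?k n) / real n)\<^sup>2
      = (u n - u (?k n)) / (real n)\<^sup>2"
    by eventually_elim (simp only: rescale_square diff_divide_distrib)
  ultimately show ?thesis by (simp only: filterlim_cong[OF refl refl] mult_1_right power_one diff_self)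
qed

text \<open>
  Extends convergence along \<open>p\<close>-th powers to all integers: the fluctuation of \<open>s\<close> between consecutive powers is at
  most that of \<open>u\<close>, which is negligible because \<open>u n / n\<^sup>2\<close> converges and consecutive powers have
  ratio tending to 1.
\<close>

lemma interpolate_dominated:
  fixes s u :: "nat \<Rightarrow> real"
  assumes p: "p > 0" and dom: "\<And>k n. k \<le> n \<Longrightarrow> \<bar>s n - s k\<bar> \<le> u n - u k"
    and u: "(\<lambda>n. u n / (real n)\<^sup>2) \<longlonglongrightarrow> L"
    and lim: "(\<lambda>m. s (m ^ p) / (real (m ^ p))\<^sup>2) \<longlonglongrightarrow> A"
  shows "(\<lambda>n. s n / (real n)\<^sup>2) \<longlonglongrightarrow> A"
proof -
  let ?r = "nth_root_nat p" and ?k = "\<lambda>n. nth_root_nat p n ^ p"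
  have "(\<lambda>n. (s n - s (?k n)) / (real n)\<^sup>2) \<longlonglongrightarrow> 0"
    by (rule Lim_null_comparison[OF _ increasing_gap_tendsto_0[OF p u]])
      (auto intro!: always_eventually divide_right_mono dom nth_root_nat_power_le[OF p])
  moreover have "(\<lambda>n. s (?k n) / (real (?k n))\<^sup>2 * (real (?k n) / real n)\<^sup>2) \<longlonglongrightarrow> A * 1\<^sup>2"
    by (intro tendsto_mult filterlim_compose[OF lim nth_root_nat_at_top[OF p]] tendsto_power
        nth_root_nat_ratio(1)[OF p])
  ultimately have "(\<lambda>n. (s n - s (?k n)) / (real n)\<^sup>2 + s (?k n) / (real (?k n))\<^sup>2 * (real (?k n) / real n)\<^sup>2) \<longlonglongrightarrow> 0 + A * 1\<^sup>2"
    by (rule tendsto_add)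
  moreover have "\<forall>\<^sub>F n in sequentially. 1 \<le> ?k n"
    using eventually_compose_filterlim[OF eventually_ge_at_top[of 1] nth_root_nat_at_top[OF p]]
    by eventually_elim (rule one_le_power)
  then have "\<forall>\<^sub>F n in sequentially. (s n - s (?k n)) / (real n)\<^sup>2 + s (?k n) / (real (?k n))\<^sup>2 * (real (?k n) / real n)\<^sup>2
      = s n / (real n)\<^sup>2"
    by eventually_elim (simp only: rescale_square diff_divide_distrib diff_add_cancel)
  ultimately show ?thesis by (simp only: filterlim_cong[OF refl refl] mult_1_right power_one add_0_left)
qed

section \<open>Almost sure convergence of the normalized sums\<close>

lemma (in prob_space) AE_summable_of_expectation:
  fixes f :: "nat \<Rightarrow> 'a \<Rightarrow> real"
  assumes int: "\<And>m. m0 \<le> m \<Longrightarrow> integrable M (f m)"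
    and nonneg: "\<And>m \<omega>. 0 \<le> f m \<omega>"
    and bound: "\<And>m. m0 \<le> m \<Longrightarrow> expectation (f m) \<le> C / (real m)\<^sup>2"
  shows "AE \<omega> in M. summable (\<lambda>m. f m \<omega>)"
proof -
  let ?g = "\<lambda>m. f (m + m0)"
  have int': "integrable M (?g m)" for m by (rule int) simp
  then have meas: "(\<lambda>\<omega>. ennreal (?g m \<omega>)) \<in> borel_measurable M" for m by auto
  have sum: "summable (\<lambda>m. expectation (?g m))"
  proof (rule summable_comparison_test)
    show "summable (\<lambda>m. C * (1 / (real (m + m0))\<^sup>2))"
    proof (rule summable_mult, subst summable_iff_shift)
      show "summable (\<lambda>n. 1 / (real n)\<^sup>2)"
        using inverse_power_summable[of 2, where 'a = real] by (simp add: inverse_eq_divide power_one_over)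
    qed
    show "\<exists>N. \<forall>n\<ge>N. norm (expectation (?g n)) \<le> C * (1 / (real (n + m0))\<^sup>2)"
    proof (intro exI[of _ 0] allI impI)
      fix n
      have "0 \<le> expectation (?g n)" using nonneg by (intro Bochner_Integration.integral_nonneg)
      then show "norm (expectation (?g n)) \<le> C * (1 / (real (n + m0))\<^sup>2)"
        using bound[of "n + m0"] by simp
    qed
  qed
  have "(\<integral>\<^sup>+\<omega>. (\<Sum>m. ennreal (?g m \<omega>)) \<partial>M) = (\<Sum>m. \<integral>\<^sup>+\<omega>. ennreal (?g m \<omega>) \<partial>M)"
    by (rule nn_integral_suminf[OF meas])
  also have "\<dots> = (\<Sum>m. ennreal (expectation (?g m)))"
    using int' nonneg by (intro suminf_cong nn_integral_eq_integral) auto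
  also have "\<dots> = ennreal (\<Sum>m. expectation (?g m))"
    using nonneg by (intro suminf_ennreal2 sum Bochner_Integration.integral_nonneg) auto
  finally have "(\<integral>\<^sup>+\<omega>. (\<Sum>m. ennreal (?g m \<omega>)) \<partial>M) \<noteq> \<infinity>" by simp
  then have "AE \<omega> in M. (\<Sum>m. ennreal (?g m \<omega>)) \<noteq> \<infinity>"
    using meas by (intro nn_integral_noteq_infinite borel_measurable_suminf) auto
  then show ?thesis
  proof eventually_elim
    case (elim \<omega>)
    then have "summable (\<lambda>m. ?g m \<omega>)"
      using nonneg by (intro summable_suminf_not_top) auto
    then show ?case by (subst (asm) summable_iff_shift)
  qed
qed

context addition_urn begin

text \<open>
  The number of initial balls, with multiplicity, of which a label is the sum. The minimum with \<open>n\<close> only serves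
  termination: on the sample space the drawn indices are at most \<open>n\<close>.
\<close>

fun summand_count :: "nat \<Rightarrow> 'a \<Rightarrow> real" where
  "summand_count 0 \<omega> = 1"
| "summand_count (Suc n) \<omega> = (if n < \<tau>0 then 1 else
    summand_count (min n (D n False \<omega>)) \<omega> + summand_count (min n (D n True \<omega>)) \<omega>)"

lemma label_process_summand_count: "label_process summand_count"
  unfolding label_process_def
proof (intro conjI exI[of _ "\<lambda>_. 1"] ballI allI impI)
  fix i \<omega> assume "i \<in> {1..\<tau>0}"
  then show "summand_count i \<omega> = 1" by (cases i) auto
next
  fix n \<omega> assume "\<tau>0 \<le> n" "\<omega> \<in> space M"
  then show "summand_count (Suc n) \<omega> = summand_count (D n False \<omega>) \<omega> + summand_count (D n True \<omega>) \<omega>"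
    using draw_range[of n \<omega> False] draw_range[of n \<omega> True] by (simp add: min_absorb2)
qed

lemma summand_count_ge_1: "1 \<le> summand_count n \<omega>"
proof (induction n rule: less_induct)
  case (less n)
  show ?case
  proof (cases n)
    case (Suc m)
    have "1 \<le> summand_count (min m k) \<omega>" for k by (rule less) (simp add: Suc)
    from add_mono[OF this[of "D m False \<omega>"] this[of "D m True \<omega>"]] show ?thesis by (simp add: Suc)
  qed simp
qed

text \<open>
  A label is a sum of \<open>summand_count\<close> many initial labels, so the triangle inequality applies.
\<close>

lemma label_dominated:
  fixes Y :: "nat \<Rightarrow> 'a \<Rightarrow> 'b::real_normed_vector"
  assumes Y: "label_process Y"
  obtains c where "0 \<le> c"
    "\<And>n \<omega>. 1 \<le> n \<Longrightarrow> \<omega> \<in> space M \<Longrightarrow> norm (Y n \<omega>) \<le> c * summand_count n \<omega>"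
proof -
  obtain y where y: "\<And>i \<omega>. i \<in> {1..\<tau>0} \<Longrightarrow> \<omega> \<in> space M \<Longrightarrow> Y i \<omega> = y i"
    using Y unfolding label_process_def by blast
  define c where "c = (\<Sum>i=1..\<tau>0. norm (y i))"
  have c0: "0 \<le> c" by (simp add: c_def sum_nonneg)
  have "norm (Y n \<omega>) \<le> c * summand_count n \<omega>" if "1 \<le> n" "\<omega> \<in> space M" for n \<omega>
    using that(1)
  proof (induction n rule: less_induct)
    case (less n)
    show ?case
    proof (cases "n \<le> \<tau>0")
      case True
      then have "norm (Y n \<omega>) = norm (y n)" using y[of n \<omega>] less.prems that by simp
      also have "\<dots> \<le> c" unfolding c_def by (rule member_le_sum) (use True less.prems in auto)
      also have "c \<le> c * summand_count n \<omega>"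
        using c0 summand_count_ge_1[of n \<omega>] mult_left_mono[of 1 "summand_count n \<omega>" c] by simp
      finally show ?thesis .
    next
      case False
      then obtain m where m: "n = Suc m" "\<tau>0 \<le> m" by (cases n) auto
      note step = label_process_step[OF Y m(2) that(2)]
        label_process_step[OF label_process_summand_count m(2) that(2)]
      have "norm (Y (D m b \<omega>) \<omega>) \<le> c * summand_count (D m b \<omega>) \<omega>" for b
        using draw_range[OF m(2) that(2), of b] by (intro less.IH) (auto simp: m)
      from add_mono[OF this[of False] this[of True]] show ?thesis
        unfolding m(1) step distrib_left by (rule order_trans[OF norm_triangle_ineq])
    qed
  qed
  with c0 show thesis using that by blast
qed

lemma filterlim_normalized_sum:
  "((\<lambda>n. normalized_sum Y (k n) \<omega>) \<longlongrightarrow> A) sequentially \<longleftrightarrow>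
    ((\<lambda>n. label_sum Y (k n) \<omega> / (real (k n))\<^sup>2) \<longlongrightarrow> A) sequentially"
  if k: "filterlim k at_top sequentially"
proof -
  have lim: "(\<lambda>n. 1 + 1 / real (k n)) \<longlonglongrightarrow> 1 + 0"
    using filterlim_compose[OF lim_1_over_n k] by (intro tendsto_intros)
  have ev: "\<forall>\<^sub>F n in sequentially. 1 \<le> k n"
    using k unfolding filterlim_at_top by blast
  show ?thesis
  proof
    assume "(\<lambda>n. normalized_sum Y (k n) \<omega>) \<longlonglongrightarrow> A"
    from tendsto_mult[OF this lim] have "(\<lambda>n. normalized_sum Y (k n) \<omega> * (1 + 1 / real (k n))) \<longlonglongrightarrow> A" by simp
    moreover have "\<forall>\<^sub>F n in sequentially. normalized_sum Y (k n) \<omega> * (1 + 1 / real (k n)) =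
        label_sum Y (k n) \<omega> / (real (k n))\<^sup>2"
      using ev by eventually_elim (simp add: normalized_sum_def divide_simps power2_eq_square)
    ultimately show "(\<lambda>n. label_sum Y (k n) \<omega> / (real (k n))\<^sup>2) \<longlonglongrightarrow> A"
      by (simp add: filterlim_cong[OF refl refl])
  next
    assume "(\<lambda>n. label_sum Y (k n) \<omega> / (real (k n))\<^sup>2) \<longlonglongrightarrow> A"
    from tendsto_divide[OF this lim]
    have "(\<lambda>n. label_sum Y (k n) \<omega> / (real (k n))\<^sup>2 / (1 + 1 / real (k n))) \<longlonglongrightarrow> A" by simp
    moreover have "\<forall>\<^sub>F n in sequentially. label_sum Y (k n) \<omega> / (real (k n))\<^sup>2 / (1 + 1 / real (k n)) =
        normalized_sum Y (k n) \<omega>"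
      using ev by eventually_elim (simp add: normalized_sum_def divide_simps power2_eq_square)
    ultimately show "(\<lambda>n. normalized_sum Y (k n) \<omega>) \<longlonglongrightarrow> A"
      by (simp add: filterlim_cong[OF refl refl])
  qed
qed

text \<open>
  Along \<open>m ^ 24\<close> the \<open>L\<^sup>2\<close> rate makes the increments of the martingale absolutely summable. The exponent 24 is the
  one for which the characteristic functions are controlled below.
\<close>

lemma AE_convergent_along_powers:
  assumes Y: "label_process Y"
  shows "AE \<omega> in M. convergent (\<lambda>m. label_sum Y (m ^ 24) \<omega> / (real (m ^ 24))\<^sup>2)"
proof -
  obtain C where C: "0 \<le> C" "\<And>n m. \<tau>0 \<le> n \<Longrightarrow> n \<le> m \<Longrightarrow>
      expectation (\<lambda>\<omega>. (normalized_sum Y m \<omega> - normalized_sum Y n \<omega>)\<^sup>2) \<le> C / n"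
    using normalized_sum_dist_bound[OF Y] by blast
  let ?d = "\<lambda>m \<omega>. normalized_sum Y (Suc m ^ 24) \<omega> - normalized_sum Y (m ^ 24) \<omega>"
  have sf: "simple_function (history (Suc m ^ 24)) (?d m)" for m
    by (intro simple_function_diff simple_function_normalized_sum[OF Y] power_mono) auto
  have int: "integrable M (\<lambda>\<omega>. f (?d m \<omega>))" for m and f :: "real \<Rightarrow> real"
    by (rule simple_function_history_integrable(1)[OF simple_function_compose1[OF sf]])
  have "AE \<omega> in M. summable (\<lambda>m. \<bar>?d m \<omega>\<bar>)"
  proof (rule AE_summable_of_expectation[where C = "(1 + C) / 2"])
    fix m assume m: "\<tau>0 \<le> m"
    then have m0: "1 \<le> m" using initial_size by simp
    show "integrable M (\<lambda>\<omega>. \<bar>?d m \<omega>\<bar>)" by (rule int)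
    have mm: "m \<le> m ^ 24" using m0 by (intro self_le_power) auto
    have small: "m\<^sup>2 * (C / real (m ^ 24)) \<le> C / m\<^sup>2"
    proof -
      have "real m ^ 2 * real m ^ 2 \<le> real m ^ 24"
        unfolding power_add[symmetric] using m0 by (intro power_increasing) auto
      then have "C * (real m ^ 2 * real m ^ 2) \<le> C * real m ^ 24"
        using C(1) by (rule mult_left_mono)
      then show ?thesis using m0 by (simp add: field_simps)
    qed
    have "expectation (\<lambda>\<omega>. \<bar>?d m \<omega>\<bar>) \<le> expectation (\<lambda>\<omega>. (1 / m\<^sup>2 + m\<^sup>2 * (?d m \<omega>)\<^sup>2) / 2)"
    proof (rule integral_mono[OF int int])
      fix \<omega>
      \<comment> \<open>trade the first moment for the second, with weights that make both terms \<open>O (1 / m\<^sup>2)\<close>\<close>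
      have "0 \<le> (1 / m - m * \<bar>?d m \<omega>\<bar>)\<^sup>2" by simp
      also have "\<dots> = 1 / m\<^sup>2 - 2 * \<bar>?d m \<omega>\<bar> + m\<^sup>2 * (?d m \<omega>)\<^sup>2"
        using m0 by (simp add: power2_diff power_divide power_mult_distrib)
      finally show "\<bar>?d m \<omega>\<bar> \<le> (1 / m\<^sup>2 + m\<^sup>2 * (?d m \<omega>)\<^sup>2) / 2" by simp
    qed
    also have "\<dots> = (1 / m\<^sup>2 + m\<^sup>2 * expectation (\<lambda>\<omega>. (?d m \<omega>)\<^sup>2)) / 2"
      using int[of "\<lambda>x. x\<^sup>2" m] by (simp add: prob_space)
    also have "\<dots> \<le> (1 / m\<^sup>2 + m\<^sup>2 * (C / real (m ^ 24))) / 2"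
      using m mm by (intro divide_right_mono add_left_mono mult_left_mono C(2) power_mono) auto
    also have "\<dots> \<le> (1 / m\<^sup>2 + C / m\<^sup>2) / 2"
      by (intro divide_right_mono add_left_mono small) simp
    also have "\<dots> = (1 + C) / 2 / (real m)\<^sup>2"
      by (simp add: add_divide_distrib)
    finally show "expectation (\<lambda>\<omega>. \<bar>?d m \<omega>\<bar>) \<le> (1 + C) / 2 / (real m)\<^sup>2" by simp
  qed simp
  then show ?thesis
  proof eventually_elim
    case (elim \<omega>)
    then have "summable (\<lambda>m. ?d m \<omega>)" by (rule summable_rabs_cancel)
    then have "convergent (\<lambda>m. \<Sum>j<m. ?d j \<omega>)" by (simp add: summable_iff_convergent)
    then have "convergent (\<lambda>m. normalized_sum Y (m ^ 24) \<omega> - normalized_sum Y (0 ^ 24) \<omega>)"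
      by (subst (asm) sum_lessThan_telescope)
    then have "convergent (\<lambda>m. normalized_sum Y (m ^ 24) \<omega>)"
      by (simp add: normalized_sum_def label_sum_def)
    then show ?case
      unfolding convergent_def by (subst (asm) filterlim_normalized_sum[OF power_at_top]) auto
  qed
qed

text \<open>
  All labels of this process are positive, so its sums increase and convergence along powers suffices.
\<close>

lemma AE_summand_count_convergent:
  "AE \<omega> in M. convergent (\<lambda>n. label_sum summand_count n \<omega> / (real n)\<^sup>2)"
  using AE_convergent_along_powers[OF label_process_summand_count]
proof eventually_elim
  case (elim \<omega>)
  have "mono (\<lambda>n. label_sum summand_count n \<omega>)"
    unfolding mono_iff_le_Suc label_sum_Suc
    using summand_count_ge_1 by (auto intro: add_increasing2 order_trans[OF zero_le_one])
  moreover from elim obtain L where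
    "(\<lambda>m. label_sum summand_count (m ^ 24) \<omega> / (real (m ^ 24))\<^sup>2) \<longlonglongrightarrow> L"
    unfolding convergent_def by blast
  ultimately have "(\<lambda>n. label_sum summand_count n \<omega> / (real n)\<^sup>2) \<longlonglongrightarrow> L"
    by (rule interpolate_increasing[rotated]) simp
  then show ?case by (rule convergentI)
qed

lemma AE_label_sum_convergent:
  assumes Y: "label_process Y"
  shows "AE \<omega> in M. convergent (\<lambda>n. label_sum Y n \<omega> / (real n)\<^sup>2)"
proof -
  obtain c where c: "0 \<le> c"
    "\<And>n \<omega>. 1 \<le> n \<Longrightarrow> \<omega> \<in> space M \<Longrightarrow> norm (Y n \<omega>) \<le> c * summand_count n \<omega>"
    using label_dominated[OF Y] by blast
  show ?thesis
    using AE_convergent_along_powers[OF Y] AE_summand_count_convergent AE_space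
  proof eventually_elim
    case (elim \<omega>)
    let ?u = "\<lambda>n. c * label_sum summand_count n \<omega>"
    from elim obtain A L where A: "(\<lambda>m. label_sum Y (m ^ 24) \<omega> / (real (m ^ 24))\<^sup>2) \<longlonglongrightarrow> A"
      and L: "(\<lambda>n. label_sum summand_count n \<omega> / (real n)\<^sup>2) \<longlonglongrightarrow> L"
      unfolding convergent_def by blast
    have L': "(\<lambda>n. ?u n / (real n)\<^sup>2) \<longlonglongrightarrow> c * L"
      using tendsto_mult_left[OF L, of c] by simp
    have dom: "\<bar>label_sum Y n \<omega> - label_sum Y k \<omega>\<bar> \<le> ?u n - ?u k" if "k \<le> n" for k n
      using that
    proof (induction n rule: dec_induct)
      case (step n)
      have "\<bar>Y (Suc n) \<omega>\<bar> \<le> c * summand_count (Suc n) \<omega>" using c(2)[of "Suc n" \<omega>] elim by simp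
      then show ?case using step.IH by (simp add: label_sum_Suc distrib_left del: summand_count.simps)
    qed simp
    have "(\<lambda>n. label_sum Y n \<omega> / (real n)\<^sup>2) \<longlonglongrightarrow> A"
      by (rule interpolate_dominated[OF _ dom L' A]) simp_all
    then show ?case unfolding convergent_def by blast
  qed
qed

text \<open>
  If the limit were 0, Fatou's lemma and the \<open>L\<^sup>2\<close> rate would give \<open>E (M n)\<^sup>2 \<le> C / n\<close> for the martingale
  \<open>M n = S n / (n (n + 1))\<close>. But \<open>E (M n)\<^sup>2\<close> does not decrease, and it is positive after the first step: even if the
  initial labels add up to 0, the first new label has positive variance.
\<close>

lemma label_limit_nonzero:
  assumes Y: "label_process Y" and k: "k \<in> {1..\<tau>0}" "\<And>\<omega>. \<omega> \<in> space M \<Longrightarrow> Y k \<omega> \<noteq> 0"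
  shows "\<not> (AE \<omega> in M. (\<lambda>n. label_sum Y n \<omega> / (real n)\<^sup>2) \<longlonglongrightarrow> 0)"
proof
  assume lim: "AE \<omega> in M. (\<lambda>n. label_sum Y n \<omega> / (real n)\<^sup>2) \<longlonglongrightarrow> 0"
  obtain C where C: "0 \<le> C" "\<And>n m. \<tau>0 \<le> n \<Longrightarrow> n \<le> m \<Longrightarrow>
      expectation (\<lambda>\<omega>. (normalized_sum Y m \<omega> - normalized_sum Y n \<omega>)\<^sup>2) \<le> C / n"
    using normalized_sum_dist_bound[OF Y] by blast
  define e where "e n = expectation (\<lambda>\<omega>. (normalized_sum Y n \<omega>)\<^sup>2)" for n
  have sf: "simple_function (history n) (normalized_sum Y m)" if "m \<le> n" for m n
    by (rule simple_function_normalized_sum[OF Y that])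
  have int: "integrable M (\<lambda>\<omega>. (normalized_sum Y m \<omega> - normalized_sum Y n \<omega>)\<^sup>2)" for m n
    by (rule simple_function_history_integrable(1), rule simple_function_compose2[where h = "\<lambda>x y. (x - y)\<^sup>2"],
        rule sf[of _ "max m n"], simp, rule sf, simp)
  have small: "e n \<le> C / n" if n: "\<tau>0 \<le> n" for n
  proof -
    have "ennreal (e n) = (\<integral>\<^sup>+\<omega>. ennreal ((normalized_sum Y n \<omega>)\<^sup>2) \<partial>M)"
      using int[of n 0] unfolding e_def
      by (intro nn_integral_eq_integral[symmetric]) (auto simp: normalized_sum_def label_sum_def)
    also have "\<dots> \<le> (\<integral>\<^sup>+\<omega>. liminf (\<lambda>m. ennreal ((normalized_sum Y m \<omega> - normalized_sum Y n \<omega>)\<^sup>2)) \<partial>M)"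
    proof (rule nn_integral_mono_AE, use lim in eventually_elim)
      case (elim \<omega>)
      then have "(\<lambda>m. normalized_sum Y m \<omega>) \<longlonglongrightarrow> 0"
        using filterlim_normalized_sum[OF filterlim_ident, of Y \<omega> 0] by simp
      then have "(\<lambda>m. (normalized_sum Y m \<omega> - normalized_sum Y n \<omega>)\<^sup>2) \<longlonglongrightarrow> (0 - normalized_sum Y n \<omega>)\<^sup>2"
        by (intro tendsto_intros)
      then have "(\<lambda>m. ennreal ((normalized_sum Y m \<omega> - normalized_sum Y n \<omega>)\<^sup>2)) \<longlonglongrightarrow> ennreal ((normalized_sum Y n \<omega>)\<^sup>2)"
        by (intro tendsto_ennrealI) simp
      from lim_imp_Liminf[OF trivial_limit_sequentially this] show ?case by simp
    qed
    also have "\<dots> \<le> liminf (\<lambda>m. \<integral>\<^sup>+\<omega>. ennreal ((normalized_sum Y m \<omega> - normalized_sum Y n \<omega>)\<^sup>2) \<partial>M)"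
      using int by (intro nn_integral_liminf) auto
    also have "\<dots> \<le> liminf (\<lambda>m. ennreal (C / n))"
    proof (rule Liminf_mono, use eventually_ge_at_top[of n] in eventually_elim)
      case (elim m)
      then show ?case using C(2)[OF n elim] int[of m n]
        by (subst nn_integral_eq_integral) (auto intro: ennreal_leI)
    qed
    also have "\<dots> = ennreal (C / n)" by (simp add: Liminf_const)
    finally show ?thesis using C(1) by (simp add: ennreal_le_iff)
  qed
  have inc: "e (Suc n) = e n + (2 * expectation (square_sum Y n) / n -
      2 * expectation (\<lambda>\<omega>. (label_sum Y n \<omega>)\<^sup>2) / n\<^sup>2) / ((real n + 1) * (real n + 2))\<^sup>2"
    if "\<tau>0 \<le> n" for n
    using normalized_sum_increment[OF Y that, of 0] unfolding e_def
    by (simp add: normalized_sum_def label_sum_def)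
  have CS: "expectation (\<lambda>\<omega>. (label_sum Y n \<omega>)\<^sup>2) / n\<^sup>2 \<le> expectation (square_sum Y n) / n"
    if "\<tau>0 \<le> n" for n
  proof -
    have n0: "real n > 0" using that initial_size by simp
    have "expectation (\<lambda>\<omega>. (label_sum Y n \<omega>)\<^sup>2) \<le> expectation (\<lambda>\<omega>. real n * square_sum Y n \<omega>)"
      using integrable_label_polynomial[OF Y, of n] label_sum_Cauchy_Schwarz
      by (intro integral_mono) auto
    then show ?thesis using n0 by (simp add: field_simps power2_eq_square)
  qed
  have mono: "e n \<le> e m" if "\<tau>0 \<le> n" "n \<le> m" for n m
    using that(2)
  proof (induction m rule: dec_induct)
    case (step m)
    have m: "\<tau>0 \<le> m" using that step by simp
    have "0 \<le> (2 * expectation (square_sum Y m) / m -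
        2 * expectation (\<lambda>\<omega>. (label_sum Y m \<omega>)\<^sup>2) / m\<^sup>2) / ((real m + 1) * (real m + 2))\<^sup>2"
    proof (rule divide_nonneg_nonneg)
      show "0 \<le> 2 * expectation (square_sum Y m) / m - 2 * expectation (\<lambda>\<omega>. (label_sum Y m \<omega>)\<^sup>2) / m\<^sup>2"
        using mult_left_mono[OF CS[OF m], of 2] by simp
    qed simp
    then show ?case using step.IH unfolding inc[OF m] by linarith
  qed simp
  have "e (Suc \<tau>0) > 0"
  proof -
    have \<tau>: "real \<tau>0 > 0" using initial_size by simp
    have q: "0 < expectation (square_sum Y \<tau>0)"
    proof -
      obtain y where y: "\<And>i \<omega>. i \<in> {1..\<tau>0} \<Longrightarrow> \<omega> \<in> space M \<Longrightarrow> Y i \<omega> = y i"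
        using Y unfolding label_process_def by blast
      have "expectation (square_sum Y \<tau>0) = expectation (\<lambda>\<omega>. \<Sum>i=1..\<tau>0. (y i)\<^sup>2)"
        by (intro Bochner_Integration.integral_cong refl) (simp add: square_sum_def y)
      also have "\<dots> = (\<Sum>i=1..\<tau>0. (y i)\<^sup>2)" by (simp add: prob_space)
      also have "\<dots> > 0"
      proof (rule sum_pos2[of _ k])
        obtain \<omega> where "\<omega> \<in> space M" using not_empty by blast
        then have "y k \<noteq> 0" using k(2) y[OF k(1)] by simp
        then show "0 < (y k)\<^sup>2" by simp
      qed (use k in auto)
      finally show ?thesis .
    qed
    have "e (Suc \<tau>0) = expectation (\<lambda>\<omega>. (label_sum Y (Suc \<tau>0) \<omega>)\<^sup>2) / ((real \<tau>0 + 1) * (real \<tau>0 + 2))\<^sup>2"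
      by (simp add: e_def normalized_sum_def power_divide add.commute)
    moreover have "expectation (\<lambda>\<omega>. (label_sum Y (Suc \<tau>0) \<omega>)\<^sup>2) \<ge> 2 * expectation (square_sum Y \<tau>0) / \<tau>0"
      unfolding second_moment_recursion(1)[OF Y order_refl]
      by (intro add_increasing mult_nonneg_nonneg Bochner_Integration.integral_nonneg) auto
    moreover have "2 * expectation (square_sum Y \<tau>0) / \<tau>0 > 0" using q \<tau> by simp
    ultimately show ?thesis by simp
  qed
  moreover have "e (Suc \<tau>0) \<le> 0"
  proof (rule LIMSEQ_le_const)
    show "(\<lambda>n. C * (1 / real n)) \<longlonglongrightarrow> 0" using tendsto_mult_right_zero[OF lim_1_over_n] .
    show "\<exists>N. \<forall>n\<ge>N. e (Suc \<tau>0) \<le> C * (1 / real n)"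
    proof (intro exI[of _ "Suc \<tau>0"] allI impI)
      fix n assume n: "Suc \<tau>0 \<le> n"
      have "e (Suc \<tau>0) \<le> e n" by (rule mono[OF _ n]) simp
      also have "\<dots> \<le> C / n" using n by (intro small) simp
      finally show "e (Suc \<tau>0) \<le> C * (1 / real n)" by simp
    qed
  qed
  ultimately show False by simp
qed

end

section \<open>The empirical characteristic function\<close>

definition ecf :: "(nat \<Rightarrow> real) \<Rightarrow> nat \<Rightarrow> real \<Rightarrow> complex" where
  "ecf y n t = (\<Sum>j=1..n. cis (t * y j)) / of_nat n"

text \<open>
  The characteristic function of \<open>x\<close> times a standard exponential variable, evaluated at 1.
\<close>

definition exponential_cf :: "real \<Rightarrow> complex" where
  "exponential_cf x = 1 / (1 - \<i> * of_real x)"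

lemma norm_ecf_le_1: "norm (ecf y n t) \<le> 1"
proof (cases "n = 0")
  case False
  have "norm (\<Sum>j=1..n. cis (t * y j)) \<le> (\<Sum>j=1..n. 1)"
    by (rule order_trans[OF norm_sum]) (simp add: norm_cis)
  then show ?thesis using False by (simp add: ecf_def norm_divide)
qed (simp add: ecf_def)

lemma norm_one_minus_i_real_ge:
  shows "1 \<le> norm (1 - \<i> * of_real x)" and "\<bar>x\<bar> \<le> norm (1 - \<i> * of_real x)"
  using abs_Re_le_cmod[of "1 - \<i> * of_real x"] abs_Im_le_cmod[of "1 - \<i> * of_real x"] by simp_all

lemma one_minus_i_real_nonzero: "1 - \<i> * of_real x \<noteq> 0"
  using norm_one_minus_i_real_ge(1)[of x] by auto

lemma norm_exponential_cf: "norm (exponential_cf x) \<le> 1" "\<bar>x\<bar> * norm (exponential_cf x) \<le> 1"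
  using norm_one_minus_i_real_ge[of x]
  by (auto simp: exponential_cf_def norm_divide divide_le_eq_1)

lemma norm_cis_minus_1: "norm (cis x - 1) \<le> \<bar>x\<bar>"
  using iexp_approx1[of x 0] by (simp add: cis_conv_exp)

lemma norm_cis_diff: "norm (cis x - cis y) \<le> \<bar>x - y\<bar>"
proof -
  have "cis x - cis y = cis y * (cis (x - y) - 1)"
    by (simp add: algebra_simps cis_mult)
  then show ?thesis using norm_cis_minus_1[of "x - y"] by (simp add: norm_mult norm_cis)
qed

lemma norm_cis_linear: "norm (cis x - (1 + \<i> * of_real x)) \<le> x\<^sup>2 / 2"
  using iexp_approx1[of x 1] by (simp add: cis_conv_exp power2_eq_square)

text \<open>
  Both sides agree with \<open>1 + i t S / n\<close> up to second order in \<open>t\<close>.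
\<close>

lemma ecf_near_exponential_cf:
  fixes y :: "nat \<Rightarrow> real"
  assumes n: "1 \<le> n"
  defines "S \<equiv> \<Sum>j=1..n. y j" and "Q \<equiv> \<Sum>j=1..n. (y j)\<^sup>2"
  shows "norm (ecf y n t - exponential_cf (t * S / n)) \<le> 2 * t\<^sup>2 * Q / n"
proof -
  define x where "x = t * S / n"
  have n0: "real n > 0" using n by simp
  have CS: "S\<^sup>2 \<le> n * Q"
    using Cauchy_Schwarz_ineq_sum[of "\<lambda>_. 1" y "{1..n}"] by (simp add: S_def Q_def)
  have "ecf y n t - (1 + \<i> * of_real x) = (\<Sum>j=1..n. cis (t * y j) - (1 + \<i> * of_real (t * y j))) / of_nat n"
    using n0 by (simp add: ecf_def sum_subtractf sum.distrib x_def S_def sum_distrib_left[symmetric]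
        add_divide_distrib diff_divide_distrib mult.assoc flip: of_real_sum)
  also have "norm \<dots> \<le> (\<Sum>j=1..n. (t * y j)\<^sup>2 / 2) / n"
    unfolding norm_divide norm_of_nat
    by (intro divide_right_mono order_trans[OF norm_sum] sum_mono norm_cis_linear) simp
  also have "\<dots> = t\<^sup>2 * Q / n / 2"
    by (simp add: Q_def power_mult_distrib sum_distrib_left sum_divide_distrib mult.commute)
  finally have 1: "norm (ecf y n t - (1 + \<i> * of_real x)) \<le> t\<^sup>2 * Q / n / 2" .
  have "exponential_cf x - (1 + \<i> * of_real x) = - (of_real (x\<^sup>2) * exponential_cf x)"
    using one_minus_i_real_nonzero[of x]
    by (simp add: exponential_cf_def field_simps power2_eq_square)
  then have "norm (exponential_cf x - (1 + \<i> * of_real x)) = x\<^sup>2 * norm (exponential_cf x)"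
    by (simp only: norm_minus_cancel norm_mult norm_of_real abs_power2)
  also have "\<dots> \<le> x\<^sup>2"
    using mult_left_mono[OF norm_exponential_cf(1), of "x\<^sup>2" x] by simp
  also have "x\<^sup>2 = t\<^sup>2 * S\<^sup>2 / n\<^sup>2"
    by (simp add: x_def power_mult_distrib power_divide)
  also have "\<dots> \<le> t\<^sup>2 * (n * Q) / n\<^sup>2"
    using CS by (intro divide_right_mono mult_left_mono) auto
  also have "\<dots> = t\<^sup>2 * Q / n"
    using n0 by (simp add: power2_eq_square)
  finally have 2: "norm (exponential_cf x - (1 + \<i> * of_real x)) \<le> t\<^sup>2 * Q / n" .
  have Q0: "0 \<le> t\<^sup>2 * Q / n" by (simp add: Q_def sum_nonneg)
  have "norm (ecf y n t - exponential_cf x) \<le> norm (ecf y n t - (1 + \<i> * of_real x)) + norm (exponential_cf x - (1 + \<i> * of_real x))"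
    by (metis norm_triangle_ineq4 diff_diff_eq2 diff_add_cancel)
  moreover have "b \<le> a / 2 \<Longrightarrow> c \<le> a \<Longrightarrow> 0 \<le> a \<Longrightarrow> d \<le> b + c \<Longrightarrow> d \<le> 2 * a" for a b c d :: real
    by linarith
  ultimately have "norm (ecf y n t - exponential_cf x) \<le> 2 * (t\<^sup>2 * Q / n)"
    using 1 2 Q0 by blast
  then show ?thesis by (simp add: x_def mult.assoc)
qed

text \<open>
  The bias-variance decomposition for the uniformly drawn product \<open>z j * z k\<close>, whose mean is \<open>p\<close> and whose variance is at
  most 1.
\<close>

lemma average_pair_noise:
  fixes z :: "nat \<Rightarrow> complex"
  assumes n: "1 \<le> n" and z: "\<And>j. norm (z j) = 1"
  defines "p \<equiv> ((\<Sum>j=1..n. z j) / of_nat n)\<^sup>2"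
  shows "(\<Sum>j=1..n. \<Sum>k=1..n. (norm (b + z j * z k))\<^sup>2) / (real n)\<^sup>2 \<le> (norm (b + p))\<^sup>2 + 1"
proof -
  have n0: "real n > 0" using n by simp
  have sq: "(norm (b + w))\<^sup>2 = (norm b)\<^sup>2 + 2 * Re (cnj b * w) + (norm w)\<^sup>2" for w
    unfolding cmod_power2 by (simp add: power2_eq_square algebra_simps)
  have "(\<Sum>j=1..n. \<Sum>k=1..n. z j * z k) = of_real ((real n)\<^sup>2) * p"
    using n0 by (simp add: p_def power_divide power2_eq_square sum_product)
  then have mean: "(\<Sum>j=1..n. \<Sum>k=1..n. Re (cnj b * (z j * z k))) = (real n)\<^sup>2 * Re (cnj b * p)"
    by (simp only: Re_sum[symmetric] sum_distrib_left[symmetric]) (simp add: algebra_simps)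
  have "(\<Sum>j=1..n. \<Sum>k=1..n. (norm (b + z j * z k))\<^sup>2) =
      (\<Sum>j=1..n. \<Sum>k=1..n. (norm b)\<^sup>2 + 1 + 2 * Re (cnj b * (z j * z k)))"
    by (intro sum.cong refl) (simp add: sq norm_mult z)
  also have "\<dots> = (real n)\<^sup>2 * ((norm b)\<^sup>2 + 1) + 2 * (\<Sum>j=1..n. \<Sum>k=1..n. Re (cnj b * (z j * z k)))"
    by (simp only: sum.distrib sum_distrib_left[symmetric] sum_constant card_atLeastAtMost)
      (simp add: power2_eq_square algebra_simps)
  also have "\<dots> = (real n)\<^sup>2 * ((norm b)\<^sup>2 + 1 + 2 * Re (cnj b * p))"
    unfolding mean by (simp only: distrib_left mult.left_commute[of 2])
  also have "\<dots> \<le> (real n)\<^sup>2 * ((norm (b + p))\<^sup>2 + 1)"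
    unfolding sq by (intro mult_left_mono) auto
  finally show ?thesis using n0 by (simp add: divide_le_eq mult.commute)
qed

text \<open>
  The deterministic part of one step. The function \<open>\<phi> n = exponential_cf (u * n)\<close> satisfies
  \<open>(n + 1) \<phi> (n + 1) = n \<phi> n + (\<phi> n)\<^sup>2 + \<rho>\<close> with \<open>\<bar>\<rho>\<bar> \<le> 1 / n\<close>. Since \<open>\<psi>\<close> and \<open>\<phi> n\<close> lie in the unit disc, the
  error \<open>n (\<psi> - \<phi> n)\<close> is multiplied by at most \<open>1 + 2 / n\<close>; the remaining factor \<open>1 + 1 / n\<close> pays for squaring a sum.
\<close>

lemma exponential_cf_recursion:
  fixes \<psi> :: complex
  assumes n: "1 \<le> n" and \<psi>: "norm \<psi> \<le> 1"
  shows "(norm (of_nat n * \<psi> - of_nat (Suc n) * exponential_cf (u * real (Suc n)) + \<psi>\<^sup>2))\<^sup>2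
    \<le> (1 + 1 / n) ^ 5 * (norm (of_nat n * (\<psi> - exponential_cf (u * n))))\<^sup>2 + 2"
proof -
  have n0: "real n > 0" using n by simp
  define \<phi> where "\<phi> = exponential_cf (u * n)"
  define \<phi>' where "\<phi>' = exponential_cf (u * real (Suc n))"
  define \<rho> where "\<rho> = \<i> * of_real u * \<phi>\<^sup>2 * \<phi>'"
  have inv: "\<phi> * (1 - \<i> * of_real u * of_nat n) = 1" "\<phi>' * (1 - \<i> * of_real u * (of_nat n + 1)) = 1"
    using one_minus_i_real_nonzero[of "u * n"] one_minus_i_real_nonzero[of "u * real (Suc n)"]
    by (simp_all add: \<phi>_def \<phi>'_def exponential_cf_def algebra_simps)
  have diff: "\<phi>' = \<phi> + \<i> * of_real u * \<phi> * \<phi>'" using inv by algebra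
  have rec: "of_nat (Suc n) * \<phi>' = of_nat n * \<phi> + \<phi>\<^sup>2 + \<rho>"
    unfolding \<rho>_def of_nat_Suc using inv by algebra
  have "norm \<rho> = \<bar>u\<bar> * norm \<phi> * (norm \<phi> * norm \<phi>')"
    by (simp add: \<rho>_def norm_mult norm_power power2_eq_square)
  also have "\<dots> \<le> (1 / n) * (1 * 1)"
  proof (intro mult_mono)
    show "\<bar>u\<bar> * norm \<phi> \<le> 1 / n"
      using norm_exponential_cf(2)[of "u * n"] n0 by (simp add: \<phi>_def abs_mult field_simps)
  qed (auto simp: \<phi>_def \<phi>'_def norm_exponential_cf)
  finally have \<rho>: "norm \<rho> \<le> 1 / n" by simp
  define h where "h = norm (of_nat n * (\<psi> - \<phi>))"
  have h: "h = n * norm (\<psi> - \<phi>)" by (simp add: h_def norm_mult)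
  have "of_nat n * \<psi> - of_nat (Suc n) * \<phi>' + \<psi>\<^sup>2 = (\<psi> - \<phi>) * (of_nat n + \<psi> + \<phi>) - \<rho>"
    unfolding rec by (simp add: algebra_simps power2_eq_square)
  also have "norm \<dots> \<le> norm (\<psi> - \<phi>) * (n + 2) + 1 / n"
  proof (rule order_trans[OF norm_triangle_ineq4], rule add_mono[OF _ \<rho>], unfold norm_mult, rule mult_left_mono)
    have "norm (of_nat n + \<psi> + \<phi>) \<le> norm (of_nat n :: complex) + norm \<psi> + norm \<phi>"
      by (intro norm_triangle_le add_right_mono norm_triangle_ineq)
    also have "\<dots> \<le> n + 2"
      using \<psi> norm_exponential_cf(1)[of "u * n"] by (simp add: \<phi>_def)
    finally show "norm (of_nat n + \<psi> + \<phi>) \<le> n + 2" .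
  qed simp
  also have "norm (\<psi> - \<phi>) * (n + 2) + 1 / n = (1 + 2 / n) * h + 1 / n"
    using n0 by (simp add: h field_simps)
  finally have le: "norm (of_nat n * \<psi> - of_nat (Suc n) * \<phi>' + \<psi>\<^sup>2) \<le> (1 + 2 / n) * h + 1 / n" .
  have h0: "0 \<le> h" by (simp add: h_def)
  let ?a = "(1 + 2 / real n) * h"
  have "(norm (of_nat n * \<psi> - of_nat (Suc n) * \<phi>' + \<psi>\<^sup>2))\<^sup>2 \<le> (?a + 1 / n)\<^sup>2"
    by (rule power_mono[OF le]) simp
  also have "\<dots> \<le> (1 + 1 / n) * ?a\<^sup>2 + (1 + n) * (1 / n)\<^sup>2"
  proof -
    have "0 \<le> (?a - 1)\<^sup>2 / n" by simp
    also have "(?a - 1)\<^sup>2 / n = (1 + 1 / n) * ?a\<^sup>2 + (1 + n) * (1 / n)\<^sup>2 - (?a + 1 / n)\<^sup>2"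
    proof -
      have "(x - 1)\<^sup>2 / n = (1 + 1 / n) * x\<^sup>2 + (1 + n) * (1 / n)\<^sup>2 - (x + 1 / n)\<^sup>2" for x :: real
        using n0 by (simp add: power2_eq_square field_simps)
      then show ?thesis .
    qed
    finally show ?thesis by simp
  qed
  also have "(1 + n) * (1 / n)\<^sup>2 \<le> 2"
  proof -
    have "real n * 1 \<le> real n * real n" "1 \<le> real n" using n by (auto intro: mult_left_mono)
    then have "1 + real n \<le> 2 * (real n)\<^sup>2" unfolding power2_eq_square by linarith
    then show ?thesis using n0 by (simp add: power_divide divide_le_eq)
  qed
  also have "(1 + 1 / n) * ?a\<^sup>2 \<le> (1 + 1 / n) ^ 5 * h\<^sup>2"
  proof -
    have "1 + 2 / real n \<le> (1 + 1 / n)\<^sup>2" by (simp add: power2_eq_square algebra_simps)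
    then have "(1 + 2 / real n)\<^sup>2 \<le> ((1 + 1 / n)\<^sup>2)\<^sup>2" by (intro power_mono) auto
    then have "(1 + 1 / n) * ((1 + 2 / real n)\<^sup>2 * h\<^sup>2) \<le> (1 + 1 / n) * (((1 + 1 / n)\<^sup>2)\<^sup>2 * h\<^sup>2)"
      by (intro mult_left_mono mult_right_mono) auto
    then show ?thesis by (simp add: power_mult_distrib eval_nat_numeral mult_ac)
  qed
  finally show ?thesis by (simp add: h_def \<phi>_def \<phi>'_def)
qed

lemma ecf_interpolation:
  assumes k: "1 \<le> k" "k \<le> n"
  shows "norm (ecf y n (1 / n) - ecf y k (1 / k)) \<le>
    (2 + (\<Sum>j=1..k. \<bar>y j\<bar>) / (real k)\<^sup>2) * (1 - real k / real n)"
proof -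
  have n0: "real n > 0" "real k > 0" using k by auto
  let ?c = "\<lambda>m j. cis (1 / real m * y j)"
  have split: "(\<Sum>j=1..n. ?c n j) = (\<Sum>j=1..k. ?c n j) + (\<Sum>j=Suc k..n. ?c n j)"
    using k by (subst sum.union_disjoint[symmetric]) (auto intro!: sum.cong)
  have eq: "ecf y n (1 / n) - ecf y k (1 / k) = (\<Sum>j=Suc k..n. ?c n j) / of_nat n
      + of_real (1 / n - 1 / k) * (\<Sum>j=1..k. ?c n j) + (\<Sum>j=1..k. ?c n j - ?c k j) / of_nat k"
    unfolding ecf_def split sum_subtractf using n0
    by (simp add: field_simps)
  have "norm (ecf y n (1 / n) - ecf y k (1 / k)) \<le> norm ((\<Sum>j=Suc k..n. ?c n j) / of_nat n)
      + norm (of_real (1 / n - 1 / k) * (\<Sum>j=1..k. ?c n j)) + norm ((\<Sum>j=1..k. ?c n j - ?c k j) / of_nat k)"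
    unfolding eq by (intro norm_triangle_le add_right_mono norm_triangle_ineq)
  also have "\<dots> \<le> (1 - k / n) + (1 - k / n) + (\<Sum>j=1..k. \<bar>y j\<bar>) / (real k)\<^sup>2 * (1 - k / n)"
  proof (intro add_mono)
    have "norm (\<Sum>j=Suc k..n. ?c n j) \<le> (\<Sum>j=Suc k..n. 1)"
      by (rule order_trans[OF norm_sum]) (simp add: norm_cis)
    then show "norm ((\<Sum>j=Suc k..n. ?c n j) / of_nat n) \<le> 1 - k / n"
      using k n0 by (simp add: norm_divide field_simps of_nat_diff)
    have "norm (\<Sum>j=1..k. ?c n j) \<le> (\<Sum>j=1..k. 1)"
      by (rule order_trans[OF norm_sum]) (simp add: norm_cis)
    then have "norm (of_real (1 / n - 1 / k) * (\<Sum>j=1..k. ?c n j)) \<le> \<bar>1 / n - 1 / k\<bar> * k"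
      unfolding norm_mult norm_of_real by (intro mult_left_mono) auto
    also have "\<bar>1 / real n - 1 / real k\<bar> = 1 / k - 1 / n"
      using k n0 by (simp add: abs_if divide_simps)
    also have "(1 / real k - 1 / real n) * k = 1 - k / n"
      using n0 by (simp add: field_simps)
    finally show "norm (of_real (1 / n - 1 / k) * (\<Sum>j=1..k. ?c n j)) \<le> 1 - k / n" .
    have "norm (\<Sum>j=1..k. ?c n j - ?c k j) \<le> (\<Sum>j=1..k. \<bar>y j\<bar> * (1 / k - 1 / n))"
    proof (rule order_trans[OF norm_sum], rule sum_mono)
      fix j
      have "1 / real n * y j - 1 / real k * y j = - (y j * (1 / k - 1 / n))"
        by (simp add: algebra_simps)
      moreover have "\<bar>1 / real k - 1 / n\<bar> = 1 / k - 1 / n"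
        using k n0 by (simp add: abs_if divide_simps)
      ultimately have eq: "\<bar>1 / real n * y j - 1 / real k * y j\<bar> = \<bar>y j\<bar> * (1 / k - 1 / n)"
        by (simp only: abs_minus_cancel abs_mult)
      show "norm (?c n j - ?c k j) \<le> \<bar>y j\<bar> * (1 / k - 1 / n)"
        unfolding eq[symmetric] by (rule norm_cis_diff)
    qed
    then have "norm ((\<Sum>j=1..k. ?c n j - ?c k j) / of_nat k) \<le> (\<Sum>j=1..k. \<bar>y j\<bar>) * (1 / k - 1 / n) / k"
      unfolding norm_divide norm_of_nat sum_distrib_right[symmetric]
      by (intro divide_right_mono) auto
    also have "\<dots> = (\<Sum>j=1..k. \<bar>y j\<bar>) / (real k)\<^sup>2 * (1 - k / n)"
      using n0 by (simp add: field_simps power2_eq_square)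
    finally show "norm ((\<Sum>j=1..k. ?c n j - ?c k j) / of_nat k) \<le> (\<Sum>j=1..k. \<bar>y j\<bar>) / (real k)\<^sup>2 * (1 - k / n)" .
  qed
  also have "\<dots> = (2 + (\<Sum>j=1..k. \<bar>y j\<bar>) / (real k)\<^sup>2) * (1 - k / n)"
    by (simp add: algebra_simps)
  finally show ?thesis .
qed

section \<open>Propagation of the error of the characteristic function\<close>

context addition_urn begin

text \<open>
  The slope is estimated at time \<open>n0\<close> and then kept fixed, so that the comparison function is determined by the history at
  time \<open>n0\<close>.
\<close>

definition cf_error :: "(nat \<Rightarrow> 'a \<Rightarrow> real) \<Rightarrow> nat \<Rightarrow> real \<Rightarrow> nat \<Rightarrow> 'a \<Rightarrow> complex" where
  "cf_error Y n0 t n \<omega> = ecf (\<lambda>j. Y j \<omega>) n t - exponential_cf (t * label_sum Y n0 \<omega> / (real n0)\<^sup>2 * n)"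

lemma simple_function_ecf:
  assumes Y: "label_process Y" and "m \<le> n"
  shows "simple_function (history n) (\<lambda>\<omega>. ecf (\<lambda>j. Y j \<omega>) m t)"
proof -
  have "simple_function (history n) (\<lambda>\<omega>. \<Sum>j=1..m. cis (t * Y j \<omega>))"
    by (rule simple_function_sum, rule simple_function_compose1[where g = "\<lambda>x. cis (t * x)"],
        rule label_simple_function[OF Y]) (use assms in auto)
  then show ?thesis unfolding ecf_def
    by (rule simple_function_compose1[where g = "\<lambda>z. z / of_nat m"])
qed

lemma simple_function_cf_error:
  assumes Y: "label_process Y" and "m \<le> n" "n0 \<le> n"
  shows "simple_function (history n) (cf_error Y n0 t m)"
  unfolding cf_error_def[abs_def]
  by (rule simple_function_compose2[where h = "\<lambda>z s. z - exponential_cf (t * s / (real n0)\<^sup>2 * m)",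
        OF simple_function_ecf[OF Y assms(2)] simple_function_label_sum(1)[OF Y assms(3)]])

text \<open>
  The weight \<open>W\<close> may be any function of the past with values in \<open>[0, 1]\<close>. It is used to damp those realizations for which
  the error at the initial time is large.
\<close>

lemma cf_error_step:
  fixes t :: real
  assumes Y: "label_process Y" and n: "\<tau>0 \<le> n" "n0 \<le> n"
    and W: "simple_function (history n) W" "\<And>\<omega>. 0 \<le> W \<omega>" "\<And>\<omega>. W \<omega> \<le> 1"
  defines "h \<equiv> \<lambda>n. expectation (\<lambda>\<omega>. W \<omega> * (norm (of_nat n * cf_error Y n0 t n \<omega>))\<^sup>2)"
  shows "h (Suc n) \<le> (1 + 1 / n) ^ 5 * h n + 3"
proof -
  have n1: "1 \<le> n" using n initial_size by simp
  define u where "u \<omega> = t * label_sum Y n0 \<omega> / (real n0)\<^sup>2" for \<omega>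
  define \<psi> where "\<psi> \<omega> = ecf (\<lambda>j. Y j \<omega>) n t" for \<omega>
  define b where "b \<omega> = of_nat n * \<psi> \<omega> - of_nat (Suc n) * exponential_cf (u \<omega> * real (Suc n))" for \<omega>
  have \<psi>: "simple_function (history n) \<psi>"
    unfolding \<psi>_def[abs_def] by (rule simple_function_ecf[OF Y order_refl])
  have b: "simple_function (history n) b"
    unfolding b_def[abs_def] u_def
    by (rule simple_function_compose2[where h = "\<lambda>z s. of_nat n * z -
          of_nat (Suc n) * exponential_cf (t * s / (real n0)\<^sup>2 * real (Suc n))",
          OF \<psi> simple_function_label_sum(1)[OF Y n(2)]])
  let ?z = "\<lambda>j \<omega>. cis (t * Y j \<omega>)"
  let ?K = "\<lambda>j k \<omega>. W \<omega> * (norm (b \<omega> + ?z j \<omega> * ?z k \<omega>))\<^sup>2"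
  have sf: "simple_function (history n) (?K j k)" if "j \<in> {1..n}" "k \<in> {1..n}" for j k
  proof -
    have 1: "simple_function (history n) (\<lambda>\<omega>. (Y j \<omega>, Y k \<omega>))"
      using that by (intro simple_function_Pair label_simple_function[OF Y]) auto
    have "simple_function (history n) (\<lambda>\<omega>. (norm (b \<omega> + ?z j \<omega> * ?z k \<omega>))\<^sup>2)"
      using simple_function_compose2[where h = "\<lambda>b (x, y). (norm (b + cis (t * x) * cis (t * y)))\<^sup>2", OF b 1]
      by simp
    with W(1) show ?thesis by (rule simple_function_mult)
  qed
  have step: "of_nat (Suc n) * cf_error Y n0 t (Suc n) \<omega> = b \<omega> + ?z (D n False \<omega>) \<omega> * ?z (D n True \<omega>) \<omega>"
    if "\<omega> \<in> space M" for \<omega>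
  proof -
    have "of_nat (Suc n) * ecf (\<lambda>j. Y j \<omega>) (Suc n) t = (\<Sum>j=1..n. ?z j \<omega>) + ?z (Suc n) \<omega>"
      unfolding ecf_def by (simp del: of_nat_Suc)
    moreover have "(\<Sum>j=1..n. ?z j \<omega>) = of_nat n * \<psi> \<omega>" using n1 by (simp add: \<psi>_def ecf_def)
    moreover have "?z (Suc n) \<omega> = ?z (D n False \<omega>) \<omega> * ?z (D n True \<omega>) \<omega>"
      unfolding label_process_step[OF Y n(1) that] by (simp add: cis_mult distrib_left)
    ultimately show ?thesis
      unfolding cf_error_def right_diff_distrib b_def u_def by (simp only:) simp
  qed
  have "h (Suc n) = expectation (\<lambda>\<omega>. ?K (D n False \<omega>) (D n True \<omega>) \<omega>)"
    unfolding h_def by (intro Bochner_Integration.integral_cong refl) (simp only: step)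
  also have "\<dots> = expectation (\<lambda>\<omega>. (\<Sum>j=1..n. \<Sum>k=1..n. ?K j k \<omega>) / (real n)\<^sup>2)"
    by (rule expectation_draws(2)[OF n(1) sf])
  also have "\<dots> \<le> expectation (\<lambda>\<omega>. (1 + 1 / n) ^ 5 * (W \<omega> * (norm (of_nat n * cf_error Y n0 t n \<omega>))\<^sup>2) + 3)"
  proof (rule integral_mono)
    have "simple_function (history n) (\<lambda>\<omega>. \<Sum>j=1..n. \<Sum>k=1..n. ?K j k \<omega>)"
      by (intro simple_function_sum sf)
    then show "integrable M (\<lambda>\<omega>. (\<Sum>j=1..n. \<Sum>k=1..n. ?K j k \<omega>) / (real n)\<^sup>2)"
      by (intro integrable_divide simple_function_history_integrable(1))
    have "simple_function (history n) (\<lambda>\<omega>. W \<omega> * (norm (of_nat n * cf_error Y n0 t n \<omega>))\<^sup>2)"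
      by (rule simple_function_mult[OF W(1)],
          rule simple_function_compose1[where g = "\<lambda>z. (norm (of_nat n * z))\<^sup>2"],
          rule simple_function_cf_error[OF Y order_refl n(2)])
    then show "integrable M (\<lambda>\<omega>. (1 + 1 / n) ^ 5 * (W \<omega> * (norm (of_nat n * cf_error Y n0 t n \<omega>))\<^sup>2) + 3)"
      by (intro Bochner_Integration.integrable_add integrable_mult_right simple_function_history_integrable(1)) simp_all
    fix \<omega>
    have "(\<Sum>j=1..n. \<Sum>k=1..n. ?K j k \<omega>) / (real n)\<^sup>2
        = W \<omega> * ((\<Sum>j=1..n. \<Sum>k=1..n. (norm (b \<omega> + ?z j \<omega> * ?z k \<omega>))\<^sup>2) / (real n)\<^sup>2)"
      by (simp add: sum_distrib_left)
    also have "\<dots> \<le> W \<omega> * ((norm (b \<omega> + (\<psi> \<omega>)\<^sup>2))\<^sup>2 + 1)"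
      unfolding \<psi>_def ecf_def by (intro mult_left_mono W(2) average_pair_noise n1) (simp add: norm_cis)
    also have "\<dots> \<le> W \<omega> * (((1 + 1 / n) ^ 5 * (norm (of_nat n * cf_error Y n0 t n \<omega>))\<^sup>2 + 2) + 1)"
      unfolding b_def cf_error_def \<psi>_def[symmetric] u_def[symmetric]
      by (intro mult_left_mono W(2) add_right_mono exponential_cf_recursion n1)
        (simp add: \<psi>_def norm_ecf_le_1)
    also have "\<dots> \<le> (1 + 1 / n) ^ 5 * (W \<omega> * (norm (of_nat n * cf_error Y n0 t n \<omega>))\<^sup>2) + 3"
      using W(3)[of \<omega>] by (simp add: algebra_simps)
    finally show "(\<Sum>j=1..n. \<Sum>k=1..n. ?K j k \<omega>) / (real n)\<^sup>2
        \<le> (1 + 1 / n) ^ 5 * (W \<omega> * (norm (of_nat n * cf_error Y n0 t n \<omega>))\<^sup>2) + 3" .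
  qed
  also have "\<dots> = (1 + 1 / n) ^ 5 * h n + 3"
  proof -
    have "simple_function (history n) (\<lambda>\<omega>. W \<omega> * (norm (of_nat n * cf_error Y n0 t n \<omega>))\<^sup>2)"
      by (rule simple_function_mult[OF W(1)],
          rule simple_function_compose1[where g = "\<lambda>z. (norm (of_nat n * z))\<^sup>2"],
          rule simple_function_cf_error[OF Y order_refl n(2)])
    from simple_function_history_integrable(1)[OF this] show ?thesis
      unfolding h_def by (subst Bochner_Integration.integral_add) (simp_all add: prob_space)
  qed
  finally show ?thesis .
qed

lemma cf_error_growth:
  fixes t :: real
  assumes Y: "label_process Y" and n: "\<tau>0 \<le> n0" "n0 \<le> n"
    and W: "simple_function (history n0) W" "\<And>\<omega>. 0 \<le> W \<omega>" "\<And>\<omega>. W \<omega> \<le> 1"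
  defines "h \<equiv> \<lambda>n. expectation (\<lambda>\<omega>. W \<omega> * (norm (of_nat n * cf_error Y n0 t n \<omega>))\<^sup>2)"
  shows "h n \<le> (real n / real n0) ^ 5 * (h n0 + 3 * (real n - real n0))"
  using n(2)
proof (induction n rule: dec_induct)
  case base
  then show ?case using n initial_size by simp
next
  case (step n)
  have n0: "real n > 0" "real n0 > 0" using n(1) initial_size step by auto
  have sub: "simple_function (history n) W"
    unfolding simple_function_eq_measurable
    using W(1) measurable_history_mono[OF _ step(1)] by (auto simp: simple_function_eq_measurable)
  have "h (Suc n) \<le> (1 + 1 / n) ^ 5 * h n + 3"
    unfolding h_def using n step by (intro cf_error_step Y sub W) auto
  also have "\<dots> \<le> (1 + 1 / n) ^ 5 * ((real n / real n0) ^ 5 * (h n0 + 3 * (real n - real n0))) + 3"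
    by (intro add_right_mono mult_left_mono step.IH) simp
  also have "\<dots> = (real (Suc n) / real n0) ^ 5 * (h n0 + 3 * (real n - real n0)) + 3"
  proof -
    have "(1 + 1 / real n) * (real n / real n0) = real (Suc n) / real n0"
      using n0 by (simp add: field_simps)
    then show ?thesis by (simp only: mult.assoc[symmetric] power_mult_distrib[symmetric])
  qed
  also have "\<dots> \<le> (real (Suc n) / real n0) ^ 5 * (h n0 + 3 * (real n - real n0)) + (real (Suc n) / real n0) ^ 5 * 3"
  proof -
    have "1 \<le> real (Suc n) / real n0" using n0 step by simp
    from one_le_power[OF this, of 5] show ?thesis by simp
  qed
  also have "\<dots> = (real (Suc n) / real n0) ^ 5 * (h n0 + 3 * (real (Suc n) - real n0))"
    by (simp add: algebra_simps)
  finally show ?case .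
qed

end

section \<open>Almost sure limit of the empirical characteristic function\<close>

lemma tendsto_exponential_cf:
  assumes "(f \<longlongrightarrow> a) F"
  shows "((\<lambda>x. exponential_cf (f x)) \<longlongrightarrow> exponential_cf a) F"
  unfolding exponential_cf_def
  by (intro tendsto_intros assms one_minus_i_real_nonzero)

context addition_urn begin

text \<open>
  The initial error is bounded by a multiple of \<open>Q n\<close>, so its square involves fourth moments of the labels. The weight brings
  this down to the first moment of \<open>Q n\<close>, which is controlled by \<open>second_moment_bounds\<close>.
\<close>

lemma weighted_initial_error:
  assumes n: "1 \<le> n"
  shows "1 / (1 + square_sum Y n \<omega> / real n ^ 3) * (norm (of_nat n * cf_error Y n t n \<omega>))\<^sup>2 \<le> 4 * t ^ 4 * real n ^ 3 * square_sum Y n \<omega>"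
proof -
  let ?Q = "square_sum Y n \<omega>"
  define W where "W = 1 / (1 + ?Q / real n ^ 3)"
  have n0: "real n > 0" using n by simp
  have Q0: "0 \<le> ?Q" by (rule square_sum_nonneg)
  have D: "0 < 1 + ?Q / real n ^ 3" using Q0 n0 by (simp add: add_pos_nonneg)
  have "norm (cf_error Y n t n \<omega>) \<le> 2 * t\<^sup>2 * ?Q / n"
    using ecf_near_exponential_cf[OF n, of "\<lambda>j. Y j \<omega>" t] n0
    by (simp add: cf_error_def label_sum_def square_sum_def power2_eq_square)
  then have "norm (of_nat n * cf_error Y n t n \<omega>) \<le> 2 * t\<^sup>2 * ?Q"
    using n0 by (simp add: norm_mult field_simps)
  then have "(norm (of_nat n * cf_error Y n t n \<omega>))\<^sup>2 \<le> (2 * t\<^sup>2 * ?Q)\<^sup>2"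
    by (rule power_mono) simp
  also have "\<dots> = 4 * t ^ 4 * ?Q\<^sup>2"
    by (simp add: power_mult_distrib flip: power_mult)
  finally have "W * (norm (of_nat n * cf_error Y n t n \<omega>))\<^sup>2 \<le> W * (4 * t ^ 4 * ?Q\<^sup>2)"
    using D by (intro mult_left_mono) (auto simp: W_def)
  also have "\<dots> = 4 * t ^ 4 * (W * ?Q\<^sup>2)" by simp
  also have "W * ?Q\<^sup>2 \<le> real n ^ 3 * ?Q"
  proof -
    have "?Q\<^sup>2 \<le> real n ^ 3 * ?Q * (1 + ?Q / real n ^ 3)"
      using n0 Q0 by (simp add: power2_eq_square distrib_left)
    then show ?thesis unfolding W_def using D by (simp add: pos_divide_le_eq)
  qed
  finally show ?thesis by (simp add: mult_left_mono mult.assoc W_def)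
qed

text \<open>
  With \<open>N = m ^ 24\<close> and \<open>n0 = m ^ 20\<close> the weighted mean square error at time \<open>N\<close> is at most
  \<open>8 B n0 / N + 3 N ^ 4 / n0 ^ 5 = (8 B + 3) / m ^ 4\<close>, with \<open>B\<close> from \<open>second_moment_bounds\<close>. The two exponents balance the initial error against the noise.
  This bound is strong enough to remove the weight \<open>1 / (1 + R)\<close> with \<open>R = Q n0 / n0 ^ 3\<close>,
  since the expectation of \<open>R\<close> is bounded and hence \<open>R = o (m\<^sup>2)\<close> almost surely.
\<close>

lemma AE_cf_error_tendsto_0:
  assumes Y: "label_process Y"
  shows "AE \<omega> in M. (\<lambda>m. cf_error Y (m ^ 20) (1 / real (m ^ 24)) (m ^ 24) \<omega>) \<longlonglongrightarrow> 0"
proof -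
  obtain B where B: "0 \<le> B"
    "\<And>n. \<tau>0 \<le> n \<Longrightarrow> expectation (square_sum Y n) \<le> B * real n ^ 2 * (real n + 1)"
    using second_moment_bounds[OF Y] by blast
  have B3: "expectation (square_sum Y n) \<le> 2 * B * real n ^ 3" if "\<tau>0 \<le> n" for n
  proof -
    have "real n + 1 \<le> 2 * real n" using that initial_size by simp
    then have "B * real n ^ 2 * (real n + 1) \<le> B * real n ^ 2 * (2 * real n)"
      using B(1) by (intro mult_left_mono) auto
    with B(2)[OF that] show ?thesis by (simp add: eval_nat_numeral mult_ac)
  qed
  define R where "R m \<omega> = square_sum Y (m ^ 20) \<omega> / real (m ^ 20) ^ 3" for m \<omega>
  define e where "e m \<omega> = cf_error Y (m ^ 20) (1 / real (m ^ 24)) (m ^ 24) \<omega>" for m \<omega>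
  define W where "W m \<omega> = 1 / (1 + R m \<omega>)" for m \<omega>
  have R0: "0 \<le> R m \<omega>" for m \<omega> by (simp add: R_def square_sum_nonneg)
  have W: "0 \<le> W m \<omega>" "W m \<omega> \<le> 1" for m \<omega> using R0[of m \<omega>] by (auto simp: W_def)
  have sfR: "simple_function (history n) (R m)" if "m ^ 20 \<le> n" for m n
    unfolding R_def[abs_def]
    by (rule simple_function_compose1[OF simple_function_label_sum(2)[OF Y that]])
  have sfW: "simple_function (history n) (W m)" if "m ^ 20 \<le> n" for m n
    unfolding W_def[abs_def] by (rule simple_function_compose1[OF sfR[OF that]])
  have large: "\<tau>0 \<le> m ^ 20" "1 \<le> m" if "\<tau>0 \<le> m" for m
  proof -
    show "1 \<le> m" using that initial_size by simp
    then have "m \<le> m ^ 20" by (intro self_le_power) auto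
    with that show "\<tau>0 \<le> m ^ 20" by simp
  qed
  have AE_R: "AE \<omega> in M. summable (\<lambda>m. R m \<omega> / (real m)\<^sup>2)"
  proof (rule AE_summable_of_expectation[where C = "2 * B" and ?m0.0 = \<tau>0])
    fix m assume m: "\<tau>0 \<le> m"
    note l = large[OF m]
    have "integrable M (R m)" by (rule simple_function_history_integrable(1)[OF sfR[OF order_refl]])
    then show "integrable M (\<lambda>\<omega>. R m \<omega> / (real m)\<^sup>2)" by simp
    have "expectation (R m) = expectation (square_sum Y (m ^ 20)) / real (m ^ 20) ^ 3"
      by (simp add: R_def[abs_def])
    also have "\<dots> \<le> 2 * B" using B3[OF l(1)] l(2) by (simp add: pos_divide_le_eq)
    finally show "expectation (\<lambda>\<omega>. R m \<omega> / (real m)\<^sup>2) \<le> 2 * B / (real m)\<^sup>2"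
      by (simp add: divide_right_mono)
  qed (simp add: R0)
  have AE_e: "AE \<omega> in M. summable (\<lambda>m. (real m)\<^sup>2 * (W m \<omega> * (norm (e m \<omega>))\<^sup>2))"
  proof (rule AE_summable_of_expectation[where C = "8 * B + 3" and ?m0.0 = \<tau>0])
    fix m assume m: "\<tau>0 \<le> m"
    note l = large[OF m]
    let ?n = "m ^ 20" and ?N = "m ^ 24" and ?t = "1 / real (m ^ 24)"
    let ?x = "real m"
    have x0: "?x > 0" using l by simp
    have nN: "?n \<le> ?N" using l(2) by (intro power_increasing) auto
    have "simple_function (history ?N) (\<lambda>\<omega>. W m \<omega> * (norm (e m \<omega>))\<^sup>2)"
      unfolding e_def[abs_def]
      by (rule simple_function_mult[OF sfW[OF nN]], rule simple_function_compose1[where g = "\<lambda>z. (norm z)\<^sup>2"],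
          rule simple_function_cf_error[OF Y order_refl nN])
    from simple_function_history_integrable(1)[OF this]
    show "integrable M (\<lambda>\<omega>. (real m)\<^sup>2 * (W m \<omega> * (norm (e m \<omega>))\<^sup>2))" by simp
    have "expectation (\<lambda>\<omega>. W m \<omega> * (norm (of_nat ?n * cf_error Y ?n ?t ?n \<omega>))\<^sup>2)
        \<le> expectation (\<lambda>\<omega>. 4 * ?t ^ 4 * real ?n ^ 3 * square_sum Y ?n \<omega>)"
    proof (rule integral_mono)
      have "simple_function (history ?n) (\<lambda>\<omega>. W m \<omega> * (norm (of_nat ?n * cf_error Y ?n ?t ?n \<omega>))\<^sup>2)"
        by (rule simple_function_mult[OF sfW[OF order_refl]],
            rule simple_function_compose1[where g = "\<lambda>z. (norm (of_nat ?n * z))\<^sup>2"],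
            rule simple_function_cf_error[OF Y order_refl order_refl])
      then show "integrable M (\<lambda>\<omega>. W m \<omega> * (norm (of_nat ?n * cf_error Y ?n ?t ?n \<omega>))\<^sup>2)"
        by (rule simple_function_history_integrable(1))
      show "integrable M (\<lambda>\<omega>. 4 * ?t ^ 4 * real ?n ^ 3 * square_sum Y ?n \<omega>)"
        by (intro integrable_mult_right integrable_label_polynomial[OF Y])
      show "W m \<omega> * (norm (of_nat ?n * cf_error Y ?n ?t ?n \<omega>))\<^sup>2 \<le> 4 * ?t ^ 4 * real ?n ^ 3 * square_sum Y ?n \<omega>" for \<omega>
        unfolding W_def R_def using l(2) by (intro weighted_initial_error) simp
    qed
    also have "\<dots> = 4 * ?t ^ 4 * real ?n ^ 3 * expectation (square_sum Y ?n)" by simp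
    also have "\<dots> \<le> 4 * ?t ^ 4 * real ?n ^ 3 * (2 * B * real ?n ^ 3)"
      by (intro mult_left_mono B3[OF l(1)]) simp
    also have "\<dots> = 8 * B * (?t ^ 4 * ?x ^ 120)"
      by (simp flip: power_mult power_add)
    also have "?t ^ 4 * ?x ^ 120 = ?x ^ 24"
    proof -
      have 1: "?x ^ 120 = ?x ^ 96 * ?x ^ 24" by (simp flip: power_add)
      have 2: "?t ^ 4 = 1 / ?x ^ 96" by (simp add: power_divide flip: power_mult)
      have cancel: "1 / a * (a * b) = b" if "a \<noteq> 0" for a b :: real
        using that by simp
      show ?thesis unfolding 1 2 by (rule cancel) (use x0 in simp)
    qed
    finally have init: "expectation (\<lambda>\<omega>. W m \<omega> * (norm (of_nat ?n * cf_error Y ?n ?t ?n \<omega>))\<^sup>2) \<le> 8 * B * ?x ^ 24" .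
    have ratio: "(real ?N / real ?n) ^ 5 = ?x ^ 20"
    proof -
      have "real ?N = ?x ^ 4 * real ?n" by (simp flip: power_add)
      moreover have "real ?n \<noteq> 0" using x0 by simp
      ultimately have "real ?N / real ?n = ?x ^ 4"
        by (simp only:) (rule nonzero_mult_div_cancel_right)
      then show ?thesis by (simp flip: power_mult)
    qed
    have "?x ^ 48 * expectation (\<lambda>\<omega>. W m \<omega> * (norm (e m \<omega>))\<^sup>2) =
       expectation (\<lambda>\<omega>. W m \<omega> * (norm (of_nat ?N * cf_error Y ?n ?t ?N \<omega>))\<^sup>2)"
      unfolding e_def norm_mult norm_of_nat power_mult_distrib
      by (subst integral_mult_right_zero[symmetric]) (simp add: mult_ac flip: power_mult)
    also have "\<dots> \<le> (real ?N / real ?n) ^ 5 *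
        (expectation (\<lambda>\<omega>. W m \<omega> * (norm (of_nat ?n * cf_error Y ?n ?t ?n \<omega>))\<^sup>2) + 3 * (real ?N - real ?n))"
      by (rule cf_error_growth[OF Y l(1) nN sfW[OF order_refl] W])
    also have "\<dots> \<le> ?x ^ 20 * (8 * B * ?x ^ 24 + 3 * ?x ^ 24)"
      unfolding ratio using init by (intro mult_left_mono add_mono) auto
    also have "\<dots> = (8 * B + 3) * ?x ^ 44"
    proof -
      have "?x ^ 44 = ?x ^ 20 * ?x ^ 24" by (simp flip: power_add)
      then show ?thesis by (simp add: algebra_simps)
    qed
    finally have le: "?x ^ 48 * expectation (\<lambda>\<omega>. W m \<omega> * (norm (e m \<omega>))\<^sup>2) \<le> (8 * B + 3) * ?x ^ 44" .
    have x48: "?x ^ 48 = ?x ^ 44 * ?x ^ 4" by (simp flip: power_add)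
    have "?x ^ 44 * (?x ^ 4 * expectation (\<lambda>\<omega>. W m \<omega> * (norm (e m \<omega>))\<^sup>2)) \<le> ?x ^ 44 * (8 * B + 3)"
      using le unfolding x48 mult.assoc mult.commute[of "8 * B + 3"] .
    then have "?x ^ 4 * expectation (\<lambda>\<omega>. W m \<omega> * (norm (e m \<omega>))\<^sup>2) \<le> 8 * B + 3"
      by (rule mult_left_le_imp_le) (use x0 in simp)
    moreover have "?x ^ 4 = ?x\<^sup>2 * ?x\<^sup>2" by (simp flip: power_add)
    moreover have "a * b \<le> c / a" if "a * a * b \<le> c" "0 < a" for a b c :: real
      using that by (simp add: pos_le_divide_eq mult_ac)
    moreover have "0 < ?x\<^sup>2" using x0 by simp
    ultimately have "?x\<^sup>2 * expectation (\<lambda>\<omega>. W m \<omega> * (norm (e m \<omega>))\<^sup>2) \<le> (8 * B + 3) / ?x\<^sup>2"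
      by (simp only:)
    then show "expectation (\<lambda>\<omega>. (real m)\<^sup>2 * (W m \<omega> * (norm (e m \<omega>))\<^sup>2)) \<le> (8 * B + 3) / (real m)\<^sup>2"
      by simp
  qed (simp add: W)
  show ?thesis
    using AE_R AE_e
  proof eventually_elim
    case (elim \<omega>)
    let ?f = "\<lambda>m. (real m)\<^sup>2 * (W m \<omega> * (norm (e m \<omega>))\<^sup>2)"
    have inv: "(\<lambda>m. 1 / (real m)\<^sup>2) \<longlonglongrightarrow> 0"
      using tendsto_power[OF lim_1_over_n, of 2] by (simp add: power_one_over)
    have "(\<lambda>m. ?f m * (1 / (real m)\<^sup>2 + R m \<omega> / (real m)\<^sup>2)) \<longlonglongrightarrow> 0 * (0 + 0)"
      using elim by (intro tendsto_mult tendsto_add inv summable_LIMSEQ_zero)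
    moreover have "\<forall>\<^sub>F m in sequentially. ?f m * (1 / (real m)\<^sup>2 + R m \<omega> / (real m)\<^sup>2) = (norm (e m \<omega>))\<^sup>2"
      using eventually_gt_at_top[of 0]
    proof eventually_elim
      case (elim m)
      have "W m \<omega> * (1 + R m \<omega>) = 1" using R0[of m \<omega>] by (simp add: W_def)
      moreover have "?f m * (1 / (real m)\<^sup>2 + R m \<omega> / (real m)\<^sup>2) = (W m \<omega> * (1 + R m \<omega>)) * (norm (e m \<omega>))\<^sup>2"
        using elim by (simp add: add_divide_distrib[symmetric])
      ultimately show ?case by simp
    qed
    ultimately have "(\<lambda>m. (norm (e m \<omega>))\<^sup>2) \<longlonglongrightarrow> 0"
      by (simp add: filterlim_cong[OF refl refl])
    then have "(\<lambda>m. sqrt ((norm (e m \<omega>))\<^sup>2)) \<longlonglongrightarrow> sqrt 0" by (rule tendsto_real_sqrt)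
    then show ?case by (simp add: e_def tendsto_norm_zero_iff)
  qed
qed

text \<open>
  The limit is first identified along the times \<open>m ^ 24\<close>; in between, the characteristic function changes little by
  \<open>ecf_interpolation\<close>, because the mean absolute value of the labels is \<open>O (n)\<close>.
\<close>

lemma AE_ecf_limit:
  assumes Y: "label_process Y"
  shows "AE \<omega> in M. \<forall>A. (\<lambda>n. label_sum Y n \<omega> / (real n)\<^sup>2) \<longlonglongrightarrow> A \<longrightarrow>
    (\<lambda>n. ecf (\<lambda>j. Y j \<omega>) n (1 / real n)) \<longlonglongrightarrow> exponential_cf A"
proof -
  obtain c where c: "0 \<le> c"
    "\<And>n \<omega>. 1 \<le> n \<Longrightarrow> \<omega> \<in> space M \<Longrightarrow> norm (Y n \<omega>) \<le> c * summand_count n \<omega>"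
    using label_dominated[OF Y] by blast
  show ?thesis
    using AE_cf_error_tendsto_0[OF Y] AE_summand_count_convergent AE_space
  proof eventually_elim
    case (elim \<omega>)
    from elim(2) obtain L where L: "(\<lambda>n. label_sum summand_count n \<omega> / (real n)\<^sup>2) \<longlonglongrightarrow> L"
      unfolding convergent_def by blast
    show ?case
    proof (intro allI impI)
      fix A assume A: "(\<lambda>n. label_sum Y n \<omega> / (real n)\<^sup>2) \<longlonglongrightarrow> A"
      let ?e = "\<lambda>n. ecf (\<lambda>j. Y j \<omega>) n (1 / real n)"
      have "(\<lambda>m. cf_error Y (m ^ 20) (1 / real (m ^ 24)) (m ^ 24) \<omega>
          + exponential_cf (label_sum Y (m ^ 20) \<omega> / (real (m ^ 20))\<^sup>2)) \<longlonglongrightarrow> 0 + exponential_cf A"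
        by (intro tendsto_add elim(1) tendsto_exponential_cf filterlim_compose[OF A power_at_top]) simp
      moreover have "\<forall>\<^sub>F m in sequentially. cf_error Y (m ^ 20) (1 / real (m ^ 24)) (m ^ 24) \<omega>
          + exponential_cf (label_sum Y (m ^ 20) \<omega> / (real (m ^ 20))\<^sup>2) = ?e (m ^ 24)"
        using eventually_gt_at_top[of 0]
      proof eventually_elim
        case (elim m)
        have cancel: "1 / x * s / d * x = s / d" if "x \<noteq> 0" for x s d :: real
          using that by simp
        have "real (m ^ 24) \<noteq> 0" using elim by simp
        from cancel[OF this] show ?case unfolding cf_error_def by (simp only: diff_add_cancel)
      qed
      ultimately have along: "(\<lambda>m. ?e (m ^ 24)) \<longlonglongrightarrow> exponential_cf A"
        by (simp only: filterlim_cong[OF refl refl] add_0_left)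
      let ?k = "\<lambda>n. nth_root_nat 24 n ^ 24"
      have root: "filterlim (nth_root_nat 24) at_top sequentially"
        by (rule nth_root_nat_at_top) simp
      have k: "filterlim ?k at_top sequentially"
        by (rule filterlim_compose[OF power_at_top root]) simp
      have "(\<lambda>n. (2 + c * (label_sum summand_count (?k n) \<omega> / (real (?k n))\<^sup>2)) * (1 - real (?k n) / real n))
          \<longlonglongrightarrow> (2 + c * L) * (1 - 1)"
        by (intro tendsto_intros filterlim_compose[OF L k] nth_root_nat_ratio(1)) simp
      then have gap: "(\<lambda>n. (2 + c * (label_sum summand_count (?k n) \<omega> / (real (?k n))\<^sup>2)) * (1 - real (?k n) / real n)) \<longlonglongrightarrow> 0"
        by simp
      have "(\<lambda>n. ?e n - ?e (?k n)) \<longlonglongrightarrow> 0"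
      proof (rule Lim_null_comparison[OF _ gap])
        have "\<forall>\<^sub>F n in sequentially. 1 \<le> ?k n"
          using k unfolding filterlim_at_top by blast
        then show "\<forall>\<^sub>F n in sequentially. norm (?e n - ?e (?k n)) \<le>
            (2 + c * (label_sum summand_count (?k n) \<omega> / (real (?k n))\<^sup>2)) * (1 - real (?k n) / real n)"
          using eventually_gt_at_top[of 0]
        proof eventually_elim
          case (elim n)
          have kn: "?k n \<le> n" by (rule nth_root_nat_power_le) simp
          have "(\<Sum>j=1..?k n. \<bar>Y j \<omega>\<bar>) \<le> (\<Sum>j=1..?k n. c * summand_count j \<omega>)"
            using c(2) \<open>\<omega> \<in> space M\<close> by (intro sum_mono) auto
          then have "(\<Sum>j=1..?k n. \<bar>Y j \<omega>\<bar>) / (real (?k n))\<^sup>2 \<le> c * (label_sum summand_count (?k n) \<omega> / (real (?k n))\<^sup>2)"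
            by (simp add: label_sum_def sum_distrib_left[symmetric] divide_right_mono)
          moreover have "0 \<le> 1 - real (?k n) / real n" using kn elim(2) by simp
          ultimately have "(2 + (\<Sum>j=1..?k n. \<bar>Y j \<omega>\<bar>) / (real (?k n))\<^sup>2) * (1 - real (?k n) / real n)
              \<le> (2 + c * (label_sum summand_count (?k n) \<omega> / (real (?k n))\<^sup>2)) * (1 - real (?k n) / real n)"
            by (intro mult_right_mono add_left_mono)
          then show ?case by (rule order_trans[OF ecf_interpolation[OF elim(1) kn]])
        qed
      qed
      from tendsto_add[OF this filterlim_compose[OF along root]]
      show "?e \<longlonglongrightarrow> exponential_cf A" by simp
    qed
  qed
qed

lemma AE_mean_norm_bounded:
  fixes Y :: "nat \<Rightarrow> 'a \<Rightarrow> 'b::real_normed_vector"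
  assumes Y: "label_process Y"
  shows "AE \<omega> in M. \<exists>C. \<forall>n. (\<Sum>j=1..n. norm (Y j \<omega>)) \<le> C * (real n)\<^sup>2"
proof -
  obtain c where c: "0 \<le> c"
    "\<And>n \<omega>. 1 \<le> n \<Longrightarrow> \<omega> \<in> space M \<Longrightarrow> norm (Y n \<omega>) \<le> c * summand_count n \<omega>"
    using label_dominated[OF Y] by blast
  show ?thesis
    using AE_summand_count_convergent AE_space
  proof eventually_elim
    case (elim \<omega>)
    obtain K where K: "\<And>n. \<bar>label_sum summand_count n \<omega> / (real n)\<^sup>2\<bar> \<le> K"
      using convergent_imp_Bseq[OF elim(1)] unfolding Bseq_def by auto
    have "(\<Sum>j=1..n. norm (Y j \<omega>)) \<le> c * K * (real n)\<^sup>2" for n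
    proof (cases "n = 0")
      case False
      have "(\<Sum>j=1..n. norm (Y j \<omega>)) \<le> (\<Sum>j=1..n. c * summand_count j \<omega>)"
        using c(2) elim(2) by (intro sum_mono) auto
      also have "\<dots> = c * label_sum summand_count n \<omega>"
        by (simp add: label_sum_def sum_distrib_left)
      also have "\<dots> \<le> c * (K * (real n)\<^sup>2)"
        using order_trans[OF abs_ge_self K[of n]] False
        by (intro mult_left_mono c(1)) (simp add: divide_le_eq)
      finally show ?thesis by (simp add: mult.assoc)
    qed simp
    then show ?case by blast
  qed
qed

end

section \<open>The characteristic function of the Gamma law\<close>

lemma exponential_cf_derivative:
  fixes s x :: real
  defines "l \<equiv> 1 - \<i> * of_real s"
  shows "((\<lambda>x. - (of_real x / l + 1 / l\<^sup>2) * exp (- l * of_real x))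
    has_vector_derivative of_real x * exp (- l * of_real x)) (at x)"
proof -
  have l: "l \<noteq> 0" unfolding l_def by (rule one_minus_i_real_nonzero)
  have "((\<lambda>z. - (z / l + 1 / l\<^sup>2) * exp (- l * z)) has_field_derivative
      of_real x * exp (- l * of_real x)) (at (of_real x))"
    using l by (auto intro!: derivative_eq_intros simp: field_simps power2_eq_square)
  then show ?thesis
    by (rule has_vector_derivative_real_field)
qed

lemma erlang_density_1_1: "erlang_density 1 1 x = (if x < 0 then 0 else x * exp (- x))"
  by (simp add: erlang_density_def)

lemma prob_space_gamma_2_1: "prob_space gamma_2_1"
  unfolding gamma_2_1_def by (rule prob_space_erlang_density) simp

lemma sets_gamma_2_1 [simp, measurable_cong]: "sets gamma_2_1 = sets borel"
  by (simp add: gamma_2_1_def)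

lemma space_gamma_2_1 [simp]: "space gamma_2_1 = UNIV"
  by (simp add: gamma_2_1_def)

lemma integrable_erlang_density_1_1: "integrable lborel (erlang_density 1 1)"
proof -
  interpret prob_space "density lborel (erlang_density 1 1)"
    by (rule prob_space_erlang_density) simp
  have "integrable (density lborel (erlang_density 1 1)) (\<lambda>_. 1 :: real)"
    by (rule integrable_const)
  then show ?thesis
    by (subst (asm) integrable_density) (auto simp: erlang_density_nonneg)
qed

text \<open>
  By the fundamental theorem of calculus: with \<open>l = 1 - i s\<close> the integral of \<open>x exp (- l x)\<close> over the positive half-line is
  \<open>1 / l\<^sup>2\<close>.
\<close>

lemma gamma_2_1_cf: "(\<integral>x. cis (s * x) \<partial>gamma_2_1) = (exponential_cf s)\<^sup>2"
proof -
  define l where "l = 1 - \<i> * of_real s"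
  have l: "l \<noteq> 0" unfolding l_def by (rule one_minus_i_real_nonzero)
  have l1: "1 \<le> norm l" unfolding l_def by (rule norm_one_minus_i_real_ge)
  let ?f = "\<lambda>x::real. of_real x * exp (- l * of_real x) :: complex"
  let ?F = "\<lambda>x::real. - (of_real x / l + 1 / l\<^sup>2) * exp (- l * of_real x) :: complex"
  have norm_exp: "norm (exp (- l * of_real x)) = exp (- x)" for x :: real
    by (simp add: norm_exp_eq_Re l_def)
  have f_eq: "erlang_density 1 1 x *\<^sub>R cis (s * x) = indicator (einterval 0 \<infinity>) x *\<^sub>R ?f x" for x
  proof (cases "0 < x")
    case True
    have "exp (- of_real x) * cis (s * x) = exp (- l * of_real x)"
      by (simp add: cis_conv_exp l_def exp_add[symmetric] algebra_simps)
    with True show ?thesis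
      by (simp add: erlang_density_1_1 einterval_def zero_ereal_def scaleR_conv_of_real mult.assoc
          del: One_nat_def flip: exp_of_real)
  next
    case False
    then show ?thesis by (simp add: erlang_density_1_1 einterval_def zero_ereal_def not_less del: One_nat_def)
  qed
  have "(\<integral>x. cis (s * x) \<partial>gamma_2_1) = (\<integral>x. erlang_density 1 1 x *\<^sub>R cis (s * x) \<partial>lborel)"
    unfolding gamma_2_1_def by (rule integral_density) (auto simp: erlang_density_nonneg cis_conv_exp)
  also have "\<dots> = (LBINT x=0..\<infinity>. ?f x)"
    unfolding interval_lebesgue_integral_def set_lebesgue_integral_def f_eq by simp
  also have "\<dots> = 0 - ?F 0"
  proof (rule interval_integral_FTC_integrable)
    show "(?F has_vector_derivative ?f x) (at x)" for x
      unfolding l_def by (rule exponential_cf_derivative)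
    show "isCont ?f x" for x by (intro continuous_intros)
    show "set_integrable lborel (einterval 0 \<infinity>) ?f"
      unfolding set_integrable_def f_eq[symmetric]
      by (rule Bochner_Integration.integrable_bound[OF integrable_erlang_density_1_1])
        (auto simp: erlang_density_nonneg cis_conv_exp)
    have "isCont ?F 0" by (intro continuous_intros l) (simp add: l)
    then have "(?F \<longlongrightarrow> ?F 0) (at_right 0)"
      unfolding isCont_def by (rule filterlim_mono) (auto simp: at_le)
    then show "((?F \<circ> real_of_ereal) \<longlongrightarrow> ?F 0) (at_right 0)"
      by (simp only: zero_ereal_def ereal_tendsto_simps1)
    have bound: "norm (?F x) \<le> (x + 1) * exp (- x)" if "0 \<le> x" for x
    proof -
      have "norm (of_real x / l + 1 / l\<^sup>2) \<le> x / norm l + 1 / (norm l)\<^sup>2"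
        using that by (intro norm_triangle_le) (simp add: norm_divide norm_power)
      also have "\<dots> \<le> x / 1 + 1 / 1"
        using l1 that by (intro add_mono divide_left_mono) (auto simp: one_le_power)
      finally show ?thesis
        by (simp only: norm_mult norm_minus_cancel norm_exp) (intro mult_right_mono, auto)
    qed
    have "((\<lambda>x::real. (x + 1) * exp (- x)) \<longlongrightarrow> 0) at_top"
    proof -
      have "((\<lambda>x::real. x ^ 1 / exp x + x ^ 0 / exp x) \<longlongrightarrow> 0 + 0) at_top"
        by (intro tendsto_add tendsto_power_div_exp_0)
      then show ?thesis by (simp add: exp_minus field_simps)
    qed
    then have "(?F \<longlongrightarrow> 0) at_top"
      using bound by (intro Lim_null_comparison[of ?F "\<lambda>x. (x + 1) * exp (- x)"])
        (auto intro: eventually_mono[OF eventually_ge_at_top[of 0]])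
    then show "((?F \<circ> real_of_ereal) \<longlongrightarrow> 0) (at_left \<infinity>)"
      by (simp only: ereal_tendsto_simps1)
  qed simp
  also have "\<dots> = (exponential_cf s)\<^sup>2"
    by (simp add: exponential_cf_def l_def power_divide)
  finally show ?thesis .
qed

lemma real_distribution_gamma_scaled: "real_distribution (distr gamma_2_1 borel (\<lambda>g. g * c))"
  by (intro real_distribution.intro prob_space.prob_space_distr prob_space_gamma_2_1)
    (auto simp: real_distribution_axioms_def)

lemma char_gamma_scaled: "char (distr gamma_2_1 borel (\<lambda>g. g * c)) t = (exponential_cf (t * c))\<^sup>2"
proof -
  have "char (distr gamma_2_1 borel (\<lambda>g. g * c)) t = (\<integral>g. cis ((t * c) * g) \<partial>gamma_2_1)"
    unfolding char_def by (subst integral_distr) (auto simp: cis_conv_exp mult_ac)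
  then show ?thesis by (simp add: gamma_2_1_cf)
qed

section \<open>Weak convergence to a law on a line\<close>

text \<open>
  If every one-dimensional projection converges to the projection of \<open>G A\<close>, then the projections that annihilate \<open>A\<close> converge to 0,
  so the mass concentrates on the line through \<open>A\<close>. The test function may therefore be composed with a projection
  \<open>p\<close> onto this line, which leaves a one-dimensional problem. Tightness provides the compact set
  on which the test function is uniformly continuous.
\<close>

lemma weak_convergence_to_line:
  fixes L :: "nat \<Rightarrow> 'v::euclidean_space measure" and A :: 'v
  assumes prob: "\<And>n. prob_space (L n)" and sets: "\<And>n. sets (L n) = sets borel"
    and proj: "\<And>\<theta> (g :: real \<Rightarrow> real) B. continuous_on UNIV g \<Longrightarrow> (\<And>x. \<bar>g x\<bar> \<le> B) \<Longrightarrow>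
      (\<lambda>n. \<integral>y. g (\<theta> \<bullet> y) \<partial>L n) \<longlonglongrightarrow> (\<integral>s. g (s * (\<theta> \<bullet> A)) \<partial>gamma_2_1)"
    and tight: "\<forall>\<^sub>F n in sequentially. integrable (L n) norm \<and> (\<integral>y. norm y \<partial>L n) \<le> K"
  shows "weakly_converges L (distr gamma_2_1 borel (\<lambda>g. g *\<^sub>R A))"
  unfolding weakly_converges_def
proof (intro allI impI, elim conjE)
  fix f :: "'v \<Rightarrow> real"
  assume f: "continuous_on UNIV f" and "bounded (range f)"
  then obtain B0 where B0: "\<And>x. \<bar>f x\<bar> \<le> B0" unfolding bounded_iff by auto
  define B where "B = max 1 B0"
  have B: "0 < B" "\<And>x. \<bar>f x\<bar> \<le> B" using B0 by (auto simp: B_def intro: le_max_iff_disj[THEN iffD2])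
  \<comment> \<open>for \<open>A = 0\<close> this is 0, and then \<open>p\<close> is constantly 0, which is what is needed\<close>
  define w where "w = (1 / (norm A)\<^sup>2) *\<^sub>R A"
  have wA: "(w \<bullet> A) *\<^sub>R A = A"
    by (cases "A = 0") (simp_all add: w_def dot_square_norm)
  define p where "p y = (w \<bullet> y) *\<^sub>R A" for y
  have p: "continuous_on UNIV p" unfolding p_def by (intro continuous_intros)
  have fm: "f \<in> borel_measurable borel" using f by (rule borel_measurable_continuous_onI)
  have pm: "p \<in> borel_measurable borel" using p by (rule borel_measurable_continuous_onI)
  define r where "r y = norm (y - p y)" for y
  have rm: "r \<in> borel_measurable borel" unfolding r_def[abs_def] using pm by measurable
  have minr: "(\<lambda>y. min 1 (r y)) \<in> borel_measurable borel"
    using rm by (intro borel_measurable_min) auto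
  have rnn: "\<bar>min 1 (r y)\<bar> \<le> 1" for y by (simp add: r_def)
  have fpm: "(\<lambda>y. f (p y)) \<in> borel_measurable borel" using fm pm by measurable
  have int: "integrable (L n) h" if "h \<in> borel_measurable borel" "\<And>x. \<bar>h x\<bar> \<le> c" for h :: "'v \<Rightarrow> real" and c n
  proof -
    interpret prob_space "L n" by (rule prob)
    show ?thesis using that(1) sets[of n]
      by (intro integrable_const_bound[of h c]) (auto simp: that(2) cong: measurable_cong_sets)
  qed
  \<comment> \<open>the part of \<open>y\<close> that is transversal to the line is negligible\<close>
  have r0: "(\<lambda>n. \<integral>y. min 1 (r y) \<partial>L n) \<longlonglongrightarrow> 0"
  proof (rule tendsto_sandwich[OF _ _ tendsto_const])
    define \<theta> where "\<theta> b = b - (A \<bullet> b) *\<^sub>R w" for b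
    have \<theta>: "\<theta> b \<bullet> y = (y - p y) \<bullet> b" for b y
      by (simp add: \<theta>_def p_def inner_diff_left inner_diff_right inner_commute)
    have \<theta>A: "\<theta> b \<bullet> A = 0" for b
      unfolding \<theta> p_def wA by simp
    have "(\<lambda>n. \<integral>y. min 1 \<bar>\<theta> b \<bullet> y\<bar> \<partial>L n) \<longlonglongrightarrow> 0" for b
    proof -
      have "continuous_on UNIV (\<lambda>x::real. min 1 \<bar>x\<bar>)" by (intro continuous_intros)
      from proj[OF this, of 1 "\<theta> b"] show ?thesis by (simp add: \<theta>A)
    qed
    then have "(\<lambda>n. \<Sum>b\<in>Basis. \<integral>y. min 1 \<bar>\<theta> b \<bullet> y\<bar> \<partial>L n) \<longlonglongrightarrow> (\<Sum>b\<in>(Basis :: 'v set). 0)"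
      by (intro tendsto_sum)
    then show "(\<lambda>n. \<Sum>b\<in>Basis. \<integral>y. min 1 \<bar>\<theta> b \<bullet> y\<bar> \<partial>L n) \<longlonglongrightarrow> 0" by simp
    have i: "integrable (L n) (\<lambda>y. min 1 \<bar>\<theta> b \<bullet> y\<bar>)" for n b
      by (rule int[of _ 1]) auto
    have "(\<integral>y. min 1 (r y) \<partial>L n) \<le> (\<Sum>b\<in>Basis. \<integral>y. min 1 \<bar>\<theta> b \<bullet> y\<bar> \<partial>L n)" for n
    proof -
      have le: "min 1 (r y) \<le> (\<Sum>b\<in>Basis. min 1 \<bar>\<theta> b \<bullet> y\<bar>)" for y
      proof (cases "\<exists>b\<in>Basis. 1 \<le> \<bar>\<theta> b \<bullet> y\<bar>")
        case True
        then obtain b where b: "b \<in> Basis" "1 \<le> \<bar>\<theta> b \<bullet> y\<bar>" by blast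
        have "min 1 (r y) \<le> min 1 \<bar>\<theta> b \<bullet> y\<bar>" using b by simp
        also have "\<dots> \<le> (\<Sum>b\<in>Basis. min 1 \<bar>\<theta> b \<bullet> y\<bar>)"
          by (rule member_le_sum) (use b in auto)
        finally show ?thesis .
      next
        case False
        have "min 1 (r y) \<le> (\<Sum>b\<in>Basis. \<bar>\<theta> b \<bullet> y\<bar>)"
          using norm_le_l1[of "y - p y"] by (simp add: r_def \<theta>)
        also have "\<dots> = (\<Sum>b\<in>Basis. min 1 \<bar>\<theta> b \<bullet> y\<bar>)"
          using False by (intro sum.cong refl) (auto simp: not_le)
        finally show ?thesis .
      qed
      have "(\<integral>y. min 1 (r y) \<partial>L n) \<le> (\<integral>y. (\<Sum>b\<in>Basis. min 1 \<bar>\<theta> b \<bullet> y\<bar>) \<partial>L n)"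
        by (intro integral_mono le Bochner_Integration.integrable_sum i int[OF minr rnn])
      then show ?thesis by (simp add: i)
    qed
    then show "\<forall>\<^sub>F n in sequentially. (\<integral>y. min 1 (r y) \<partial>L n) \<le> (\<Sum>b\<in>Basis. \<integral>y. min 1 \<bar>\<theta> b \<bullet> y\<bar> \<partial>L n)"
      by simp
    show "\<forall>\<^sub>F n in sequentially. 0 \<le> (\<integral>y. min 1 (r y) \<partial>L n)"
      by (intro always_eventually allI Bochner_Integration.integral_nonneg) (simp add: r_def)
  qed
  have diff: "(\<lambda>n. (\<integral>y. f y \<partial>L n) - (\<integral>y. f (p y) \<partial>L n)) \<longlonglongrightarrow> 0"
  proof (rule LIMSEQ_I)
    fix e :: real assume e: "0 < e"
    define R where "R = max 1 (2 * B * (\<bar>K\<bar> + 1) * 4 / e)"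
    have R: "1 \<le> R" "2 * B * (\<bar>K\<bar> + 1) * 4 / e \<le> R" by (simp_all add: R_def)
    have RK: "2 * B / R * K \<le> e / 4"
    proof -
      have "2 * B * K \<le> 2 * B * (\<bar>K\<bar> + 1)" using B(1) by (intro mult_left_mono) auto
      also have "\<dots> \<le> R * e / 4" using R(2) e by (simp add: field_simps)
      finally show ?thesis using R(1) by (simp add: field_simps)
    qed
    have "uniformly_continuous_on (cball 0 (R + 1)) f"
      by (rule compact_uniformly_continuous[OF continuous_on_subset[OF f]]) auto
    then obtain d0 where d0: "0 < d0"
      "\<And>x y. x \<in> cball 0 (R + 1) \<Longrightarrow> y \<in> cball 0 (R + 1) \<Longrightarrow> dist y x < d0 \<Longrightarrow> dist (f y) (f x) < e / 4"
      unfolding uniformly_continuous_on_def using e by (metis zero_less_divide_iff zero_less_numeral)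
    define d where "d = min 1 d0"
    have d: "0 < d" "d \<le> 1" "d \<le> d0" using d0(1) by (auto simp: d_def)
    have pointwise: "\<bar>f y - f (p y)\<bar> \<le> e / 4 + 2 * B / d * min 1 (r y) + 2 * B / R * norm y" for y
    proof -
      have nn: "0 \<le> 2 * B / d * min 1 (r y)" "0 \<le> 2 * B / R * norm y"
        using B(1) d(1) R(1) by (auto simp: r_def)
      have triv: "\<bar>f y - f (p y)\<bar> \<le> 2 * B" using B(2)[of y] B(2)[of "p y"] by linarith
      consider "R \<le> norm y" | "d \<le> r y" | "norm y < R" "r y < d" by linarith
      then show ?thesis
      proof cases
        case 1
        have "2 * B / R * R \<le> 2 * B / R * norm y"
          using 1 B(1) R(1) by (intro mult_left_mono) auto
        then have "2 * B \<le> 2 * B / R * norm y" using R(1) by simp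
        with triv nn e show ?thesis by linarith
      next
        case 2
        have "2 * B / d * d \<le> 2 * B / d * min 1 (r y)"
          using 2 B(1) d by (intro mult_left_mono) auto
        then have "2 * B \<le> 2 * B / d * min 1 (r y)" using d(1) by simp
        with triv nn e show ?thesis by linarith
      next
        case 3
        have "norm (p y) \<le> norm y + r y"
          using norm_triangle_ineq4[of y "y - p y"] by (simp add: r_def)
        then have "dist (f y) (f (p y)) < e / 4"
          using 3 d by (intro d0(2)) (auto simp: r_def dist_norm)
        with nn show ?thesis by (simp add: dist_real_def)
      qed
    qed
    have "\<forall>\<^sub>F n in sequentially. (\<integral>y. min 1 (r y) \<partial>L n) < e * d / (8 * B)"
      using r0 e d(1) B(1) by (intro order_tendstoD(2)) auto
    with tight have "\<forall>\<^sub>F n in sequentially. norm ((\<integral>y. f y \<partial>L n) - (\<integral>y. f (p y) \<partial>L n) - 0) < e"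
    proof eventually_elim
      case (elim n)
      interpret prob_space "L n" by (rule prob)
      have i: "integrable (L n) f" "integrable (L n) (\<lambda>y. f (p y))" "integrable (L n) (\<lambda>y. min 1 (r y))"
        by (rule int[OF fm B(2)], rule int[OF fpm B(2)], rule int[OF minr rnn])
      have "\<bar>(\<integral>y. f y \<partial>L n) - (\<integral>y. f (p y) \<partial>L n)\<bar> = \<bar>\<integral>y. f y - f (p y) \<partial>L n\<bar>"
        using i by simp
      also have "\<dots> \<le> (\<integral>y. \<bar>f y - f (p y)\<bar> \<partial>L n)" by (rule integral_abs_bound)
      also have "\<dots> \<le> (\<integral>y. e / 4 + 2 * B / d * min 1 (r y) + 2 * B / R * norm y \<partial>L n)"
        using i elim by (intro integral_mono pointwise) auto
      also have "\<dots> = e / 4 + 2 * B / d * (\<integral>y. min 1 (r y) \<partial>L n) + 2 * B / R * (\<integral>y. norm y \<partial>L n)"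
        using i elim by (simp add: prob_space)
      also have "2 * B / d * (\<integral>y. min 1 (r y) \<partial>L n) \<le> 2 * B / d * (e * d / (8 * B))"
        using elim B(1) d(1) by (intro mult_left_mono) auto
      also have "2 * B / d * (e * d / (8 * B)) = e / 4" using B(1) d(1) by simp
      also have "2 * B / R * (\<integral>y. norm y \<partial>L n) \<le> 2 * B / R * K"
        using elim B(1) R(1) by (intro mult_left_mono) auto
      finally show ?case using RK e by simp
    qed
    then show "\<exists>no. \<forall>n\<ge>no. norm ((\<integral>y. f y \<partial>L n) - (\<integral>y. f (p y) \<partial>L n) - 0) < e"
      by (simp add: eventually_sequentially)
  qed
  have "continuous_on UNIV (\<lambda>u. f (u *\<^sub>R A))"
    by (rule continuous_on_compose2[OF f]) (auto intro!: continuous_intros)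
  from proj[OF this B(2), of w]
  have "(\<lambda>n. \<integral>y. f (p y) \<partial>L n) \<longlonglongrightarrow> (\<integral>s. f ((s * (w \<bullet> A)) *\<^sub>R A) \<partial>gamma_2_1)"
    unfolding p_def .
  also have "(\<lambda>s. f ((s * (w \<bullet> A)) *\<^sub>R A)) = (\<lambda>s. f (s *\<^sub>R A))"
    unfolding scaleR_scaleR[symmetric] wA ..
  also have "(\<integral>s. f (s *\<^sub>R A) \<partial>gamma_2_1) = (\<integral>y. f y \<partial>distr gamma_2_1 borel (\<lambda>g. g *\<^sub>R A))"
    using fm by (subst integral_distr) auto
  finally have "(\<lambda>n. \<integral>y. f (p y) \<partial>L n) \<longlonglongrightarrow> (\<integral>y. f y \<partial>distr gamma_2_1 borel (\<lambda>g. g *\<^sub>R A))" .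
  from tendsto_add[OF diff this]
  show "(\<lambda>n. \<integral>y. f y \<partial>L n) \<longlonglongrightarrow> (\<integral>y. f y \<partial>distr gamma_2_1 borel (\<lambda>g. g *\<^sub>R A))" by simp
qed

section \<open>The quenched law of the next label\<close>

lemma real_vec_add: "real_vec (x + y) = real_vec x + real_vec y"
  by (simp add: real_vec_def vec_eq_iff)

lemma finite_set_pmf_empirical:
  assumes "1 \<le> n"
  shows "finite (set_pmf (empirical x n))"
  using assms by (simp add: empirical_def)

lemma integral_empirical:
  fixes f :: "'b \<Rightarrow> real"
  assumes "1 \<le> n"
  shows "(\<integral>y. f y \<partial>measure_pmf (empirical x n)) = (\<Sum>i=1..n. f (x i)) / n"
  using assms by (simp add: empirical_def integral_pmf_of_set)

lemma integral_sum_law_empirical: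
  fixes f :: "'b::plus \<Rightarrow> 'c::{banach, second_countable_topology}"
  assumes n: "1 \<le> n"
  shows "integrable (measure_pmf (sum_law (empirical x n))) f"
    and "(\<integral>y. f y \<partial>measure_pmf (sum_law (empirical x n))) =
      (1 / (real n)\<^sup>2) *\<^sub>R (\<Sum>j=1..n. \<Sum>k=1..n. f (x j + x k))"
proof -
  let ?U = "pmf_of_set {1..n}"
  have "sum_law (empirical x n) = map_pmf (\<lambda>(j, k). x j + x k) (pair_pmf ?U ?U)"
    unfolding sum_law_def empirical_def pair_map_pmf1 pair_map_pmf2 map_pmf_comp
    by (intro map_pmf_cong refl) auto
  note sl = this
  have fin: "finite (set_pmf (pair_pmf ?U ?U))" using n by simp
  have "finite (set_pmf (sum_law (empirical x n)))" unfolding sl using fin by simp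
  then show "integrable (measure_pmf (sum_law (empirical x n))) f"
    by (rule integrable_measure_pmf_finite)
  have "(\<integral>y. f y \<partial>measure_pmf (sum_law (empirical x n))) =
      (\<integral>p. f (x (fst p) + x (snd p)) \<partial>measure_pmf (pair_pmf ?U ?U))"
    unfolding sl by (simp add: case_prod_beta)
  also have "\<dots> = (\<Sum>p\<in>{1..n} \<times> {1..n}. pmf (pair_pmf ?U ?U) p *\<^sub>R f (x (fst p) + x (snd p)))"
    by (rule integral_measure_pmf) (use n in auto)
  also have "\<dots> = (\<Sum>p\<in>{1..n} \<times> {1..n}. (1 / (real n)\<^sup>2) *\<^sub>R f (x (fst p) + x (snd p)))"
    using n by (intro sum.cong refl) (auto simp: pmf_pair power2_eq_square)
  also have "\<dots> = (1 / (real n)\<^sup>2) *\<^sub>R (\<Sum>j=1..n. \<Sum>k=1..n. f (x j + x k))"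
    unfolding scaleR_sum_right[symmetric] sum.cartesian_product by (simp add: case_prod_beta)
  finally show "(\<integral>y. f y \<partial>measure_pmf (sum_law (empirical x n))) =
      (1 / (real n)\<^sup>2) *\<^sub>R (\<Sum>j=1..n. \<Sum>k=1..n. f (x j + x k))" .
qed

lemma prob_space_quenched_law: "prob_space (quenched_law x n)"
  unfolding quenched_law_def
  by (rule prob_space.prob_space_distr[OF prob_space_measure_pmf]) simp

lemma sets_quenched_law [simp, measurable_cong]: "sets (quenched_law x n) = sets borel"
  by (simp add: quenched_law_def)

lemma ecf_lipschitz:
  "norm (ecf y n s - ecf z n t) \<le> (\<Sum>j=1..n. \<bar>s * y j - t * z j\<bar>) / n"
proof -
  have "ecf y n s - ecf z n t = (\<Sum>j=1..n. cis (s * y j) - cis (t * z j)) / of_nat n"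
    by (simp add: ecf_def sum_subtractf diff_divide_distrib)
  then show ?thesis
    by (simp only: norm_divide norm_of_nat)
      (intro divide_right_mono order_trans[OF norm_sum] sum_mono norm_cis_diff, simp)
qed

text \<open>
  The square is the independence of the two draws.
\<close>

lemma char_quenched_law:
  assumes n: "2 \<le> n"
  shows "char (distr (quenched_law x n) borel (\<lambda>y. \<theta> \<bullet> y)) t =
    (ecf (\<lambda>j. (t *\<^sub>R \<theta>) \<bullet> real_vec (x j)) (n - 1) (1 / n))\<^sup>2"
proof -
  let ?y = "\<lambda>j. (t *\<^sub>R \<theta>) \<bullet> real_vec (x j)" and ?m = "n - 1"
  have m: "1 \<le> ?m" using n by simp
  have "char (distr (quenched_law x n) borel (\<lambda>y. \<theta> \<bullet> y)) t =
      (\<integral>y. cis (t * (\<theta> \<bullet> ((1 / n) *\<^sub>R real_vec y))) \<partial>measure_pmf (sum_law (empirical x ?m)))"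
    unfolding char_def quenched_law_def cis_conv_exp
    by (subst integral_distr, simp, simp, subst integral_distr) auto
  also have "\<dots> = (1 / (real ?m)\<^sup>2) *\<^sub>R (\<Sum>j=1..?m. \<Sum>k=1..?m. cis (1 / n * ?y j) * cis (1 / n * ?y k))"
    unfolding integral_sum_law_empirical(2)[OF m] cis_mult
    by (simp add: real_vec_add inner_add_right add_divide_distrib distrib_left)
  also have "\<dots> = (ecf ?y ?m (1 / n))\<^sup>2"
    unfolding sum_product[symmetric] ecf_def using m
    by (simp add: power_divide power2_eq_square scaleR_conv_of_real)
  finally show ?thesis .
qed

lemma sum_pairs_add:
  fixes a :: "nat \<Rightarrow> real"
  shows "(\<Sum>j=1..n. \<Sum>k=1..n. a j + a k) = 2 * real n * (\<Sum>j=1..n. a j)"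
  by (simp add: sum.distrib sum_distrib_left[symmetric])

lemma quenched_law_first_moment:
  assumes n: "2 \<le> n" and bound: "\<And>n. (\<Sum>j=1..n. norm (real_vec (x j))) \<le> C * (real n)\<^sup>2"
  shows "integrable (quenched_law x n) norm" and "(\<integral>y. norm y \<partial>quenched_law x n) \<le> 2 * C"
proof -
  let ?m = "n - 1"
  have m: "1 \<le> ?m" using n by simp
  have m0: "real ?m > 0" using m by simp
  have C0: "0 \<le> C" using order_trans[OF sum_nonneg bound[of 1]] by simp
  show "integrable (quenched_law x n) norm"
    unfolding quenched_law_def
    by (subst integrable_distr_eq, simp, simp) (rule integral_sum_law_empirical(1)[OF m])
  let ?T = "\<Sum>j=1..?m. norm (real_vec (x j))"
  have "(\<integral>y. norm y \<partial>quenched_law x n) =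
      (\<integral>y. norm ((1 / n) *\<^sub>R real_vec y) \<partial>measure_pmf (sum_law (empirical x ?m)))"
    unfolding quenched_law_def by (subst integral_distr) auto
  also have "\<dots> = (1 / (real ?m)\<^sup>2) * (\<Sum>j=1..?m. \<Sum>k=1..?m. norm (real_vec (x j) + real_vec (x k)) / n)"
    unfolding integral_sum_law_empirical(2)[OF m] real_scaleR_def by (simp add: real_vec_add)
  also have "\<dots> \<le> (1 / (real ?m)\<^sup>2) * (\<Sum>j=1..?m. \<Sum>k=1..?m. (norm (real_vec (x j)) + norm (real_vec (x k))) / n)"
    by (intro mult_left_mono sum_mono divide_right_mono norm_triangle_ineq) auto
  also have "\<dots> = (1 / (real ?m)\<^sup>2) * (2 * ?m * ?T / n)"
    by (simp only: sum_divide_distrib[symmetric] sum_pairs_add)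
  also have "\<dots> \<le> (1 / (real ?m)\<^sup>2) * (2 * ?m * (C * (real ?m)\<^sup>2) / n)"
    by (intro mult_left_mono divide_right_mono bound) auto
  also have "\<dots> = 2 * C * (real ?m / n)"
    using m0 by simp
  also have "\<dots> \<le> 2 * C * 1"
    using C0 n by (intro mult_left_mono) auto
  finally show "(\<integral>y. norm y \<partial>quenched_law x n) \<le> 2 * C" by simp
qed

text \<open>
  A deterministic statement about a single realization. The quenched law averages over the first \<open>n - 1\<close> labels but divides by
  \<open>n\<close>; the first moment bound shows that this shift is harmless.
\<close>

lemma quenched_law_weakly_converges:
  fixes x :: "nat \<Rightarrow> int ^ 'd" and A :: "real ^ 'd"
  assumes cf: "\<And>\<theta>. (\<lambda>n. ecf (\<lambda>j. \<theta> \<bullet> real_vec (x j)) n (1 / real n)) \<longlonglongrightarrow> exponential_cf (\<theta> \<bullet> A)"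
    and bound: "\<And>n. (\<Sum>j=1..n. norm (real_vec (x j))) \<le> C * (real n)\<^sup>2"
  shows "weakly_converges (quenched_law x) (distr gamma_2_1 borel (\<lambda>g. g *\<^sub>R A))"
proof (rule weak_convergence_to_line[where K = "2 * C"])
  show "prob_space (quenched_law x n)" for n by (rule prob_space_quenched_law)
  show "sets (quenched_law x n) = sets borel" for n by simp
  show "\<forall>\<^sub>F n in sequentially. integrable (quenched_law x n) norm \<and> (\<integral>y. norm y \<partial>quenched_law x n) \<le> 2 * C"
    using eventually_ge_at_top[of 2]
    by eventually_elim (intro conjI quenched_law_first_moment[OF _ bound])
  fix \<theta> and g :: "real \<Rightarrow> real" and B
  assume g: "continuous_on UNIV g" "\<And>x. \<bar>g x\<bar> \<le> B"
  let ?P = "\<lambda>n. distr (quenched_law x n) borel (\<lambda>y. \<theta> \<bullet> y)"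
  let ?G = "distr gamma_2_1 borel (\<lambda>s. s * (\<theta> \<bullet> A))"
  have P: "real_distribution (?P n)" for n
    by (intro real_distribution.intro prob_space.prob_space_distr prob_space_quenched_law)
      (auto simp: real_distribution_axioms_def)
  have "weak_conv_m ?P ?G"
  proof (rule levy_continuity[OF P real_distribution_gamma_scaled])
    fix t
    let ?y = "\<lambda>j. (t *\<^sub>R \<theta>) \<bullet> real_vec (x j)"
    have inv: "(\<lambda>n. norm (t *\<^sub>R \<theta>) * C * (1 / real n)) \<longlonglongrightarrow> 0"
      using tendsto_mult_right_zero[OF lim_1_over_n] .
    have "(\<lambda>n. ecf ?y n (1 / Suc n) - ecf ?y n (1 / n)) \<longlonglongrightarrow> 0"
    proof (rule Lim_null_comparison[OF _ inv])
      show "\<forall>\<^sub>F n in sequentially. norm (ecf ?y n (1 / Suc n) - ecf ?y n (1 / n)) \<le> norm (t *\<^sub>R \<theta>) * C * (1 / n)"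
        using eventually_gt_at_top[of 0]
      proof eventually_elim
        case (elim n)
        have n0: "real n > 0" using elim by simp
        have gap: "\<bar>1 / Suc n * ?y j - 1 / n * ?y j\<bar> \<le> norm (t *\<^sub>R \<theta>) * norm (real_vec (x j)) * (1 / (real n)\<^sup>2)" for j
        proof -
          have "1 / Suc n * ?y j - 1 / n * ?y j = - (?y j * (1 / (real n * Suc n)))"
            using n0 by (simp add: field_simps)
          then have "\<bar>1 / Suc n * ?y j - 1 / n * ?y j\<bar> = \<bar>?y j\<bar> * (1 / (real n * Suc n))"
            by (simp only: abs_minus_cancel abs_mult) simp
          also have "\<dots> \<le> (norm (t *\<^sub>R \<theta>) * norm (real_vec (x j))) * (1 / (real n)\<^sup>2)"
            using n0 by (intro mult_mono Cauchy_Schwarz_ineq2 divide_left_mono) (auto simp: power2_eq_square)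
          finally show ?thesis .
        qed
        have "norm (ecf ?y n (1 / Suc n) - ecf ?y n (1 / n)) \<le> (\<Sum>j=1..n. \<bar>1 / Suc n * ?y j - 1 / n * ?y j\<bar>) / n"
          by (rule ecf_lipschitz)
        also have "\<dots> \<le> (\<Sum>j=1..n. norm (t *\<^sub>R \<theta>) * norm (real_vec (x j)) * (1 / (real n)\<^sup>2)) / n"
          by (intro divide_right_mono sum_mono gap) simp
        also have "\<dots> = norm (t *\<^sub>R \<theta>) * (1 / (real n)\<^sup>2) * (\<Sum>j=1..n. norm (real_vec (x j))) / n"
          by (simp only: sum_distrib_left mult_ac)
        also have "\<dots> \<le> norm (t *\<^sub>R \<theta>) * (1 / (real n)\<^sup>2) * (C * (real n)\<^sup>2) / n"
          by (intro divide_right_mono mult_left_mono bound) auto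
        also have "\<dots> = norm (t *\<^sub>R \<theta>) * C * (1 / n)" using n0 by simp
        finally show ?case .
      qed
    qed
    from tendsto_add[OF this cf[of "t *\<^sub>R \<theta>"]]
    have "(\<lambda>n. (ecf ?y n (1 / Suc n))\<^sup>2) \<longlonglongrightarrow> (exponential_cf ((t *\<^sub>R \<theta>) \<bullet> A))\<^sup>2"
      by (intro tendsto_power) simp
    then have "(\<lambda>n. (ecf ?y (Suc n - 1) (1 / Suc n))\<^sup>2) \<longlonglongrightarrow> (exponential_cf ((t *\<^sub>R \<theta>) \<bullet> A))\<^sup>2"
      by simp
    then have "(\<lambda>n. (ecf ?y (n - 1) (1 / n))\<^sup>2) \<longlonglongrightarrow> (exponential_cf ((t *\<^sub>R \<theta>) \<bullet> A))\<^sup>2"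
      by (rule LIMSEQ_imp_Suc)
    moreover have "\<forall>\<^sub>F n in sequentially. char (?P n) t = (ecf ?y (n - 1) (1 / n))\<^sup>2"
      using eventually_ge_at_top[of 2] by eventually_elim (rule char_quenched_law)
    ultimately show "(\<lambda>n. char (?P n) t) \<longlonglongrightarrow> char ?G t"
      unfolding char_gamma_scaled by (simp add: filterlim_cong[OF refl refl])
  qed
  then have "(\<lambda>n. integral\<^sup>L (?P n) g) \<longlonglongrightarrow> integral\<^sup>L ?G g"
    using g by (intro weak_conv_imp_integral_bdd_continuous_conv[OF P real_distribution_gamma_scaled])
      (auto simp: continuous_on_eq_continuous_at)
  moreover have "g \<in> borel_measurable borel" using g(1) by (rule borel_measurable_continuous_onI)
  then have "integral\<^sup>L (?P n) g = (\<integral>y. g (\<theta> \<bullet> y) \<partial>quenched_law x n)" for n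
    by (subst integral_distr) auto
  moreover have "integral\<^sup>L ?G g = (\<integral>s. g (s * (\<theta> \<bullet> A)) \<partial>gamma_2_1)"
    using \<open>g \<in> borel_measurable borel\<close> by (subst integral_distr) auto
  ultimately show "(\<lambda>n. \<integral>y. g (\<theta> \<bullet> y) \<partial>quenched_law x n) \<longlonglongrightarrow> (\<integral>s. g (s * (\<theta> \<bullet> A)) \<partial>gamma_2_1)"
    by simp
qed

text \<open>
  The characteristic functions are equicontinuous in \<open>\<theta>\<close> by the first moment bound. Almost sure statements only reach
  countably many directions at a time, whereas the directions used for the weak convergence depend on \<open>A\<close>, hence on
  the realization.
\<close>

lemma ecf_limit_extend_dense:
  fixes x :: "nat \<Rightarrow> 'v::real_inner" and A :: 'v
  assumes dense: "\<And>U. open U \<Longrightarrow> U \<noteq> {} \<Longrightarrow> \<exists>\<theta>\<in>T. \<theta> \<in> U"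
    and cf: "\<And>\<theta>. \<theta> \<in> T \<Longrightarrow> (\<lambda>n. ecf (\<lambda>j. \<theta> \<bullet> x j) n (1 / real n)) \<longlonglongrightarrow> exponential_cf (\<theta> \<bullet> A)"
    and bound: "\<And>n. (\<Sum>j=1..n. norm (x j)) \<le> C * (real n)\<^sup>2"
  shows "(\<lambda>n. ecf (\<lambda>j. \<theta> \<bullet> x j) n (1 / real n)) \<longlonglongrightarrow> exponential_cf (\<theta> \<bullet> A)"
proof (rule LIMSEQ_I)
  fix e :: real assume e: "0 < e"
  have "((\<lambda>\<eta>. exponential_cf (\<eta> \<bullet> A)) \<longlongrightarrow> exponential_cf (\<theta> \<bullet> A)) (nhds \<theta>)"
    by (intro tendsto_exponential_cf tendsto_inner filterlim_ident tendsto_const)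
  moreover have "((\<lambda>\<eta>. norm (\<theta> - \<eta>) * C) \<longlongrightarrow> norm (\<theta> - \<theta>) * C) (nhds \<theta>)"
    by (intro tendsto_intros filterlim_ident)
  ultimately have "\<forall>\<^sub>F \<eta> in nhds \<theta>. dist (exponential_cf (\<eta> \<bullet> A)) (exponential_cf (\<theta> \<bullet> A)) < e / 3 \<and> norm (\<theta> - \<eta>) * C < e / 3"
    using e by (intro eventually_conj tendstoD order_tendstoD(2)) auto
  then obtain U where U: "open U" "\<theta> \<in> U"
    "\<And>\<eta>. \<eta> \<in> U \<Longrightarrow> dist (exponential_cf (\<eta> \<bullet> A)) (exponential_cf (\<theta> \<bullet> A)) < e / 3 \<and> norm (\<theta> - \<eta>) * C < e / 3"
    unfolding eventually_nhds by blast
  then obtain \<eta> where \<eta>: "\<eta> \<in> T" "\<eta> \<in> U" using dense[of U] by blast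
  have "\<forall>\<^sub>F n in sequentially. dist (ecf (\<lambda>j. \<eta> \<bullet> x j) n (1 / real n)) (exponential_cf (\<eta> \<bullet> A)) < e / 3"
    using tendstoD[OF cf[OF \<eta>(1)], of "e / 3"] e by simp
  then have "\<forall>\<^sub>F n in sequentially. norm (ecf (\<lambda>j. \<theta> \<bullet> x j) n (1 / real n) - exponential_cf (\<theta> \<bullet> A)) < e"
    using eventually_gt_at_top[of 0]
  proof eventually_elim
    case (elim n)
    have n0: "real n > 0" using elim by simp
    have "norm (ecf (\<lambda>j. \<theta> \<bullet> x j) n (1 / n) - ecf (\<lambda>j. \<eta> \<bullet> x j) n (1 / n)) \<le>
        (\<Sum>j=1..n. \<bar>1 / n * (\<theta> \<bullet> x j) - 1 / n * (\<eta> \<bullet> x j)\<bar>) / n"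
      by (rule ecf_lipschitz)
    also have "\<dots> \<le> (\<Sum>j=1..n. 1 / n * (norm (\<theta> - \<eta>) * norm (x j))) / n"
    proof (intro divide_right_mono sum_mono)
      fix j
      have "1 / n * (\<theta> \<bullet> x j) - 1 / n * (\<eta> \<bullet> x j) = 1 / n * ((\<theta> - \<eta>) \<bullet> x j)"
        by (simp add: inner_diff_left diff_divide_distrib)
      then show "\<bar>1 / n * (\<theta> \<bullet> x j) - 1 / n * (\<eta> \<bullet> x j)\<bar> \<le> 1 / n * (norm (\<theta> - \<eta>) * norm (x j))"
        by (simp only: abs_mult) (intro mult_mono Cauchy_Schwarz_ineq2, auto)
    qed simp
    also have "\<dots> = norm (\<theta> - \<eta>) * (\<Sum>j=1..n. norm (x j)) / (real n)\<^sup>2"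
      by (simp only: sum_distrib_left[symmetric]) (simp add: power2_eq_square)
    also have "\<dots> \<le> norm (\<theta> - \<eta>) * (C * (real n)\<^sup>2) / (real n)\<^sup>2"
      by (intro divide_right_mono mult_left_mono bound) auto
    also have "\<dots> = norm (\<theta> - \<eta>) * C" using n0 by simp
    also have "\<dots> < e / 3" using U(3)[OF \<eta>(2)] by simp
    finally have "dist (ecf (\<lambda>j. \<theta> \<bullet> x j) n (1 / n)) (ecf (\<lambda>j. \<eta> \<bullet> x j) n (1 / n)) < e / 3"
      by (simp add: dist_norm)
    with elim(1) U(3)[OF \<eta>(2)]
    have "dist (ecf (\<lambda>j. \<theta> \<bullet> x j) n (1 / n)) (exponential_cf (\<theta> \<bullet> A)) < e / 3 + e / 3 + e / 3"
      using dist_triangle[of "ecf (\<lambda>j. \<theta> \<bullet> x j) n (1 / n)" "exponential_cf (\<theta> \<bullet> A)" "ecf (\<lambda>j. \<eta> \<bullet> x j) n (1 / n)"]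
        dist_triangle[of "ecf (\<lambda>j. \<eta> \<bullet> x j) n (1 / n)" "exponential_cf (\<theta> \<bullet> A)" "exponential_cf (\<eta> \<bullet> A)"]
      by linarith
    then show ?case by (simp add: dist_norm)
  qed
  then show "\<exists>no. \<forall>n\<ge>no. norm (ecf (\<lambda>j. \<theta> \<bullet> x j) n (1 / real n) - exponential_cf (\<theta> \<bullet> A)) < e"
    by (simp add: eventually_sequentially)
qed

section \<open>The conditional expectation and its limit\<close>

context addition_urn begin

lemma label_process_inner: "label_process (\<lambda>i \<omega>. \<theta> \<bullet> real_vec (X i \<omega>))"
  by (rule label_process_map[OF label_process_X]) (simp add: real_vec_add inner_add_right)

lemma label_process_coordinate: "label_process (\<lambda>i \<omega>. real_vec (X i \<omega>) $ c)"
  by (rule label_process_map[OF label_process_X]) (simp add: real_vec_add)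

lemma label_process_real_vec: "label_process (\<lambda>i \<omega>. real_vec (X i \<omega>))"
  by (rule label_process_map[OF label_process_X]) (rule real_vec_add)

lemma empirical_measurable:
  assumes n: "\<tau>0 \<le> n"
  shows "(\<lambda>\<omega>. measure_pmf (empirical (\<lambda>i. X i \<omega>) n)) \<in> history n \<rightarrow>\<^sub>M subprob_algebra (count_space UNIV)"
proof (rule measurable_subprob_algebra)
  fix S :: "(int ^ 'd) set"
  have n1: "1 \<le> n" using n initial_size by simp
  have "simple_function (history n) (\<lambda>\<omega>. indicator S (X i \<omega>) :: real)" if "i \<in> {1..n}" for i
    by (rule simple_function_compose1[where g = "indicator S"], rule label_simple_function[OF label_process_X])
      (use that in auto)
  then have "simple_function (history n) (\<lambda>\<omega>. \<Sum>i=1..n. indicator S (X i \<omega>) :: real)"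
    by (rule simple_function_sum)
  then have "simple_function (history n) (\<lambda>\<omega>. ennreal ((1 / real n) * (\<Sum>i=1..n. indicator S (X i \<omega>))))"
    by (rule simple_function_compose1)
  then show "(\<lambda>\<omega>. emeasure (measure_pmf (empirical (\<lambda>i. X i \<omega>) n)) S) \<in> borel_measurable (history n)"
    unfolding emeasure_empirical[OF n1] by (rule borel_measurable_simple_function)
qed (auto intro: measure_pmf.subprob_space_axioms)

lemma sets_empirical_algebra:
  assumes "\<tau>0 \<le> n"
  shows "sets (empirical_algebra M X n) \<subseteq> sets (history n)"
  unfolding empirical_algebra_def
  by (intro sets_image_in_sets empirical_measurable assms) simp

lemma space_empirical_algebra [simp]: "space (empirical_algebra M X n) = space M"
  by (simp add: empirical_algebra_def)

text \<open>
  The mean label is the integral of the coordinate function against the empirical measure. That function is unbounded, so the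
  integral is split into two nonnegative parts, each of which depends measurably on the measure.
\<close>

lemma coordinate_sum_measurable_empirical:
  assumes n: "\<tau>0 \<le> n"
  shows "(\<lambda>\<omega>. label_sum (\<lambda>i \<omega>. real_vec (X i \<omega>) $ c) n \<omega> / n) \<in> borel_measurable (empirical_algebra M X n)"
proof -
  have n1: "1 \<le> n" using n initial_size by simp
  let ?\<mu> = "\<lambda>\<omega>. measure_pmf (empirical (\<lambda>i. X i \<omega>) n)" and ?f = "\<lambda>x. real_vec x $ c"
  have \<mu>: "?\<mu> \<in> empirical_algebra M X n \<rightarrow>\<^sub>M subprob_algebra (count_space UNIV)"
    unfolding empirical_algebra_def
    by (rule measurable_vimage_algebra1) (use measurable_space[OF empirical_measurable[OF n]] in auto)
  have nn: "(\<lambda>\<omega>. \<integral>\<^sup>+x. h x \<partial>?\<mu> \<omega>) \<in> borel_measurable (empirical_algebra M X n)" for h :: "int ^ 'd \<Rightarrow> ennreal"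
    by (rule measurable_compose[OF \<mu> nn_integral_measurable_subprob_algebra]) simp
  have "label_sum (\<lambda>i \<omega>. real_vec (X i \<omega>) $ c) n \<omega> / n = (\<integral>x. ?f x \<partial>?\<mu> \<omega>)" for \<omega>
    by (simp add: integral_empirical[OF n1] label_sum_def)
  also have "(\<integral>x. ?f x \<partial>?\<mu> \<omega>) = enn2real (\<integral>\<^sup>+x. ennreal (?f x) \<partial>?\<mu> \<omega>) - enn2real (\<integral>\<^sup>+x. ennreal (- ?f x) \<partial>?\<mu> \<omega>)" for \<omega>
    by (rule real_lebesgue_integral_def, rule integrable_measure_pmf_finite, rule finite_set_pmf_empirical[OF n1])
  finally show ?thesis
    using nn by (simp only:) (intro borel_measurable_diff borel_measurable_enn2real nn)
qed

text \<open>
  The history is finer than the \<open>\<sigma>\<close>-algebra of the empirical measure, so the draws can be averaged out over every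
  event of the latter; the average depends on the empirical measure only.
\<close>

lemma cond_exp_coordinate:
  assumes n: "\<tau>0 \<le> n"
  shows "AE \<omega> in M. real_cond_exp M (empirical_algebra M X n) (\<lambda>\<omega>. real_vec (X (n + 1) \<omega>) $ c) \<omega> =
    2 * (label_sum (\<lambda>i \<omega>. real_vec (X i \<omega>) $ c) n \<omega> / n)"
proof -
  have n0: "real n > 0" using n initial_size by simp
  let ?Y = "\<lambda>i \<omega>. real_vec (X i \<omega>) $ c" and ?G = "empirical_algebra M X n"
  have Y: "label_process ?Y" by (rule label_process_coordinate)
  interpret G: finite_measure_subalgebra M ?G
    by unfold_locales (use sets_empirical_algebra[OF n] history_subset[of n] in \<open>auto simp: subalgebra_def\<close>)
  show ?thesis
  proof (rule G.real_cond_exp_charact)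
    show "integrable M (\<lambda>\<omega>. ?Y (n + 1) \<omega>)"
      by (rule simple_function_history_integrable(1)[of "n + 1"], rule label_simple_function[OF Y]) auto
    show "integrable M (\<lambda>\<omega>. 2 * (label_sum ?Y n \<omega> / n))"
      by (intro integrable_mult_right integrable_divide simple_function_history_integrable(1)[OF simple_function_label_sum(1)[OF Y order_refl]])
    show "(\<lambda>\<omega>. 2 * (label_sum ?Y n \<omega> / n)) \<in> borel_measurable ?G"
      by (intro borel_measurable_times coordinate_sum_measurable_empirical n) simp
    fix B assume "B \<in> sets ?G"
    then have B: "B \<in> sets (history n)" using sets_empirical_algebra[OF n] by blast
    let ?K = "\<lambda>j k \<omega>. indicator B \<omega> * (?Y j \<omega> + ?Y k \<omega>)"
    have sf: "simple_function (history n) (?K j k)" if "j \<in> {1..n}" "k \<in> {1..n}" for j k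
      using that B by (intro simple_function_mult simple_function_add simple_function_indicator
          label_simple_function[OF Y]) auto
    have "(\<integral>\<omega>\<in>B. ?Y (n + 1) \<omega> \<partial>M) = expectation (\<lambda>\<omega>. ?K (D n False \<omega>) (D n True \<omega>) \<omega>)"
      unfolding set_lebesgue_integral_def
      by (intro Bochner_Integration.integral_cong refl) (simp add: label_process_step[OF Y n])
    also have "\<dots> = expectation (\<lambda>\<omega>. (\<Sum>j=1..n. \<Sum>k=1..n. ?K j k \<omega>) / (real n)\<^sup>2)"
      by (rule expectation_draws(2)[OF n sf])
    also have "\<dots> = expectation (\<lambda>\<omega>. indicator B \<omega> * (2 * (label_sum ?Y n \<omega> / n)))"
    proof (intro Bochner_Integration.integral_cong refl)
      fix \<omega>
      have "(\<Sum>j=1..n. \<Sum>k=1..n. ?K j k \<omega>) = indicator B \<omega> * (\<Sum>j=1..n. \<Sum>k=1..n. ?Y j \<omega> + ?Y k \<omega>)"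
        by (simp only: sum_distrib_left)
      also have "(\<Sum>j=1..n. \<Sum>k=1..n. ?Y j \<omega> + ?Y k \<omega>) = 2 * n * label_sum ?Y n \<omega>"
        by (simp add: sum.distrib sum_distrib_left[symmetric] label_sum_def)
      finally show "(\<Sum>j=1..n. \<Sum>k=1..n. ?K j k \<omega>) / (real n)\<^sup>2 = indicator B \<omega> * (2 * (label_sum ?Y n \<omega> / n))"
        using n0 by (simp add: power2_eq_square)
    qed
    finally show "(\<integral>\<omega>\<in>B. ?Y (n + 1) \<omega> \<partial>M) = (\<integral>\<omega>\<in>B. 2 * (label_sum ?Y n \<omega> / n) \<partial>M)"
      unfolding set_lebesgue_integral_def real_scaleR_def .
  qed
qed

lemma AE_urn_ratio:
  "AE \<omega> in M. \<forall>n\<ge>\<tau>0. urn_ratio M X n \<omega> = (\<chi> c. normalized_sum (\<lambda>i \<omega>. real_vec (X i \<omega>) $ c) n \<omega>)"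
proof -
  have coord: "AE \<omega> in M. \<forall>c. real_cond_exp M (empirical_algebra M X n) (\<lambda>\<omega>. real_vec (X (n + 1) \<omega>) $ c) \<omega> =
    2 * (label_sum (\<lambda>i \<omega>. real_vec (X i \<omega>) $ c) n \<omega> / n)" if "\<tau>0 \<le> n" for n
    using cond_exp_coordinate[OF that] by (simp add: AE_all_countable)
  have "AE \<omega> in M. urn_ratio M X n \<omega> = (\<chi> c. normalized_sum (\<lambda>i \<omega>. real_vec (X i \<omega>) $ c) n \<omega>)"
    if "\<tau>0 \<le> n" for n
    using coord[OF that]
  proof eventually_elim
    case (elim \<omega>)
    have n0: "real n > 0" using that initial_size by simp
    show ?case
      unfolding vec_eq_iff
    proof
      fix c
      have "urn_ratio M X n \<omega> $ c =
          1 / (2 * (real n + 1)) * (2 * (label_sum (\<lambda>i \<omega>. real_vec (X i \<omega>) $ c) n \<omega> / n))"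
        unfolding urn_ratio_def urn_cond_exp_def vector_scaleR_component vec_lambda_beta
          real_scaleR_def spec[OF elim, of c] ..
      also have "\<dots> = normalized_sum (\<lambda>i \<omega>. real_vec (X i \<omega>) $ c) n \<omega>"
        using n0 unfolding normalized_sum_def by (simp add: divide_simps)
      finally show "urn_ratio M X n \<omega> $ c = (\<chi> c. normalized_sum (\<lambda>i \<omega>. real_vec (X i \<omega>) $ c) n \<omega>) $ c"
        by simp
    qed
  qed
  then show ?thesis by (auto simp: AE_all_countable)
qed

lemma urn_limit_measurable: "urn_limit M X \<in> borel_measurable M"
proof -
  have "(\<lambda>\<omega>. urn_ratio M X n \<omega> $ i) \<in> borel_measurable M" for n i
    unfolding urn_ratio_def urn_cond_exp_def by simp
  then have "(\<lambda>\<omega>. urn_ratio M X n \<omega>) \<in> borel_measurable M" for n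
    by (subst borel_measurable_euclidean_space) (auto simp: Basis_vec_def inner_axis)
  then show ?thesis
    unfolding urn_limit_def[abs_def] by (rule borel_measurable_lim_metric)
qed

lemma AE_urn_ratio_tendsto:
  "AE \<omega> in M. (\<lambda>n. urn_ratio M X n \<omega>) \<longlonglongrightarrow> urn_limit M X \<omega> \<and>
    (\<forall>c. (\<lambda>n. label_sum (\<lambda>i \<omega>. real_vec (X i \<omega>) $ c) n \<omega> / (real n)\<^sup>2) \<longlonglongrightarrow> urn_limit M X \<omega> $ c)"
proof -
  let ?Y = "\<lambda>c i \<omega>. real_vec (X i \<omega>) $ c"
  have "AE \<omega> in M. \<forall>c. convergent (\<lambda>n. label_sum (?Y c) n \<omega> / (real n)\<^sup>2)"
    using AE_label_sum_convergent[OF label_process_coordinate] by (simp add: AE_all_countable)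
  then show ?thesis
    using AE_urn_ratio
  proof eventually_elim
    case (elim \<omega>)
    define a where "a c = lim (\<lambda>n. label_sum (?Y c) n \<omega> / (real n)\<^sup>2)" for c
    have a: "(\<lambda>n. label_sum (?Y c) n \<omega> / (real n)\<^sup>2) \<longlonglongrightarrow> a c" for c
      unfolding a_def using elim(1) by (simp only: convergent_LIMSEQ_iff)
    have "(\<lambda>n. \<chi> c. normalized_sum (?Y c) n \<omega>) \<longlonglongrightarrow> (\<chi> c. a c)"
      using a by (intro vec_tendstoI) (simp add: filterlim_normalized_sum[OF filterlim_ident])
    moreover have "\<forall>\<^sub>F n in sequentially. (\<chi> c. normalized_sum (?Y c) n \<omega>) = urn_ratio M X n \<omega>"
      using eventually_ge_at_top[of \<tau>0] by eventually_elim (use elim in simp)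
    ultimately have "(\<lambda>n. urn_ratio M X n \<omega>) \<longlonglongrightarrow> (\<chi> c. a c)"
      by (simp only: filterlim_cong[OF refl refl])
    moreover from this have "urn_limit M X \<omega> = (\<chi> c. a c)"
      unfolding urn_limit_def by (rule limI)
    ultimately show ?case using a by simp
  qed
qed

lemma label_sum_inner:
  "label_sum (\<lambda>i \<omega>. \<theta> \<bullet> real_vec (X i \<omega>)) n \<omega> / (real n)\<^sup>2 =
    (\<Sum>c\<in>UNIV. \<theta> $ c * (label_sum (\<lambda>i \<omega>. real_vec (X i \<omega>) $ c) n \<omega> / (real n)\<^sup>2))"
proof -
  have "(\<Sum>i=1..n. \<theta> \<bullet> real_vec (X i \<omega>)) = (\<Sum>c\<in>UNIV. \<theta> $ c * (\<Sum>i=1..n. real_vec (X i \<omega>) $ c))"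
    unfolding inner_vec_def sum_distrib_left by (subst sum.swap) simp
  then show ?thesis
    by (simp only: label_sum_def sum_divide_distrib[of _ UNIV] times_divide_eq_right)
qed

lemma AE_weakly_converges:
  "AE \<omega> in M. weakly_converges (quenched_law (\<lambda>n. X n \<omega>)) (distr gamma_2_1 borel (\<lambda>g. g *\<^sub>R urn_limit M X \<omega>))"
proof -
  obtain T :: "(real ^ 'd) set" where T: "countable T" "\<And>U. open U \<Longrightarrow> U \<noteq> {} \<Longrightarrow> \<exists>\<theta>\<in>T. \<theta> \<in> U"
    by (rule countable_dense_setE) (rule that)
  have "AE \<omega> in M. \<forall>\<theta>\<in>T. \<forall>A. (\<lambda>n. label_sum (\<lambda>i \<omega>. \<theta> \<bullet> real_vec (X i \<omega>)) n \<omega> / (real n)\<^sup>2) \<longlonglongrightarrow> A \<longrightarrow>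
      (\<lambda>n. ecf (\<lambda>j. \<theta> \<bullet> real_vec (X j \<omega>)) n (1 / real n)) \<longlonglongrightarrow> exponential_cf A"
    using AE_ecf_limit[OF label_process_inner] T(1) by (simp add: AE_ball_countable)
  then show ?thesis
    using AE_mean_norm_bounded[OF label_process_real_vec] AE_urn_ratio_tendsto
  proof eventually_elim
    case (elim \<omega>)
    let ?A = "urn_limit M X \<omega>"
    from elim(2) obtain C where C: "\<And>n. (\<Sum>j=1..n. norm (real_vec (X j \<omega>))) \<le> C * (real n)\<^sup>2" by blast
    have lim: "(\<lambda>n. label_sum (\<lambda>i \<omega>. \<theta> \<bullet> real_vec (X i \<omega>)) n \<omega> / (real n)\<^sup>2) \<longlonglongrightarrow> \<theta> \<bullet> ?A" for \<theta>
    proof -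
      have "\<theta> \<bullet> ?A = (\<Sum>c\<in>UNIV. \<theta> $ c * ?A $ c)" by (simp add: inner_vec_def)
      then show ?thesis
        unfolding label_sum_inner
        by (simp only:) (intro tendsto_sum tendsto_mult_left spec[OF conjunct2[OF elim(3)]])
    qed
    show ?case
    proof (rule quenched_law_weakly_converges[OF _ C], rule ecf_limit_extend_dense[OF T(2) _ C])
      show "(\<lambda>n. ecf (\<lambda>j. \<eta> \<bullet> real_vec (X j \<omega>)) n (1 / real n)) \<longlonglongrightarrow> exponential_cf (\<eta> \<bullet> ?A)"
        if "\<eta> \<in> T" for \<eta>
        using elim(1) lim[of \<eta>] that by blast
    qed
  qed
qed

lemma urn_limit_nonzero:
  assumes k: "k \<in> {1..\<tau>0}" "x0 k $ c \<noteq> 0"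
  shows "0 < measure M {\<omega> \<in> space M. urn_limit M X \<omega> $ c \<noteq> 0}"
proof (rule ccontr)
  let ?E = "{\<omega> \<in> space M. urn_limit M X \<omega> $ c \<noteq> 0}"
  assume "\<not> ?thesis"
  then have "measure M ?E = 0" using measure_nonneg[of M ?E] by linarith
  moreover have "?E \<in> events"
    using urn_limit_measurable by measurable
  ultimately have "AE \<omega> in M. \<omega> \<notin> ?E"
    by (intro AE_not_in) (simp add: null_sets_def emeasure_eq_measure)
  then have "AE \<omega> in M. (\<lambda>n. label_sum (\<lambda>i \<omega>. real_vec (X i \<omega>) $ c) n \<omega> / (real n)\<^sup>2) \<longlonglongrightarrow> 0"
    using AE_urn_ratio_tendsto AE_space
  proof eventually_elim
    case (elim \<omega>)
    then have "urn_limit M X \<omega> $ c = 0" by simp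
    with spec[OF conjunct2[OF elim(2)], of c] show ?case by (simp only:)
  qed
  moreover have "real_vec (X k \<omega>) $ c \<noteq> 0" if "\<omega> \<in> space M" for \<omega>
    using initial_labels[OF k(1) that] k(2) by (simp add: real_vec_def)
  ultimately show False
    using label_limit_nonzero[OF label_process_coordinate k(1)] by blast
qed

end

theorem theorem1p2:
  fixes M :: "'a measure"
    and \<tau>0 :: nat
    and x0 :: "nat \<Rightarrow> int ^ 'd"
    and D :: "nat \<Rightarrow> bool \<Rightarrow> 'a \<Rightarrow> nat"
    and X :: "nat \<Rightarrow> 'a \<Rightarrow> int ^ 'd"
  assumes "addition_urn M \<tau>0 x0 D X"
  shows "(AE \<omega> in M. convergent (\<lambda>n. urn_ratio M X n \<omega>)) \<and>
    (\<forall>i. (\<exists>k\<in>{1..\<tau>0}. x0 k $ i \<noteq> 0) \<longrightarrow>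
      measure M {\<omega> \<in> space M. urn_limit M X \<omega> $ i \<noteq> 0} > 0) \<and>
    (AE \<omega> in M. weakly_converges (quenched_law (\<lambda>n. X n \<omega>))
      (distr gamma_2_1 borel (\<lambda>g. g *\<^sub>R urn_limit M X \<omega>)))"
proof -
  interpret addition_urn M \<tau>0 x0 D X by fact
  have "AE \<omega> in M. convergent (\<lambda>n. urn_ratio M X n \<omega>)"
    using AE_urn_ratio_tendsto by eventually_elim (auto intro: convergentI)
  then show ?thesis
    using AE_weakly_converges by (auto intro: urn_limit_nonzero)
qed

end
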